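(* Let $\mathbf m=(m_1,\dots,m_s)$ be a tuple of positive integers and let $n\in\mathbb N$ be finite. Every canonical basis element $U_f$ in the completion $\widehat{\mathcal E}^{\mathbf m|n}_+$ (that is, $f\in\mathbb Z_{++}^{\mathbf m|n}$) actually lies in $\mathcal E^{\mathbf m|n}_+$; that is, $U_f$ is a finite sum of monomials $K_g$ (with coefficients).
   Context: $\mathbb N=\{0,1,2,\dots\}$. Quantum group. $U_q\mathfrak{gl}_\infty$ is the $\mathbb Q(q)$-algebra with generators $E_a,F_a,K_a^{\pm1}$ ($a\in\mathbb Z$), commuting $K$'s, $K_aE_bK_a^{-1}=q^{\delta_{a,b}-\delta_{a,b+1}}E_b$, $K_aF_bK_a^{-1}=q^{\delta_{a,b+1}-\delta_{a,b}}F_b$, $E_aF_b-F_bE_a=\delta_{a,b}(K_{a,a+1}-K_{a+1,a})/(q-q^{-1})$ with $K_{a,b}=K_aK_b^{-1}$, and the usual quantum Serre relations. $\mathcal U=U_q\mathfrak{sl}_\infty$ is the subalgebra generated by all $E_a,F_a,K_{a,a+1}^{\pm1}$. Comultiplication: $\Delta(E_a)=1\otimes E_a+E_a\otimes K_{a+1,a}$, $\Delta(F_a)=F_a\otimes1+K_{a,a+1}\otimes F_a$, $\Delta(K_a)=K_a\otimes K_a$. Bar involution on $\mathcal U$: the automorphism, anti-linear for $q\mapsto q^{-1}$, fixing $E_a,F_a$ and inverting $K_{a}$. $\mathbb V$ has basis $v_b$ ($b\in\mathbb Z$) with $K_av_b=q^{\delta_{ab}}v_b$, $E_av_b=\delta_{a+1,b}v_a$,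 $F_av_b=\delta_{a,b}v_{a+1}$; $\mathbb W=\mathbb V^*$ has basis $w_b$ with $K_aw_b=q^{-\delta_{ab}}w_b$, $E_aw_b=\delta_{a,b}w_{a+1}$, $F_aw_b=\delta_{a+1,b}w_a$. $\Lambda^k\mathbb V$ is the quotient of $\mathbb V^{\otimes k}$ by the relations (in adjacent factors) $v_a\otimes v_a=0$, $v_b\otimes v_a+q\,v_a\otimes v_b=0$ ($a<b$); $\Lambda^k\mathbb W$ is the quotient of $\mathbb W^{\otimes k}$ by $w_a\otimes w_a=0$, $w_a\otimes w_b+q\,w_b\otimes w_a=0$ ($a<b$); images of pure tensors are written with $\wedge$. Fock space. Let $m=\sum_a m_a$, $I(m|n)=\{-m,\dots,-1\}\cup\{1,\dots,n\}$, and cut $\{-m,\dots,-1\}$ into consecutive intervals of lengths $m_1,\dots,m_s$. $\mathbb Z^{m|n}$ is the set of functions $I(m|n)\to\mathbb Z$; $\mathbb Z_+^{\mathbf m|n}$ is the set of those that are strictly decreasing on each of the $s$ intervals and strictly increasing on $\{1,\dots,n\}$; $\mathbb Z_{++}^{\mathbf m|n}=\{f\in\mathbb Z_+^{\mathbf m|n}: f(n)\le n\}$. $\mathcal E^{\mathbf m|n}=\Lambda^{m_1}\mathbb V\otimes\cdots\otimes\Lambda^{m_s}\mathbb V\otimes\Lambda^n\mathbb W$ is a $\mathcal U$-module with monomial basis $K_f$ ($f\in\mathbb Z_+^{\mathbf m|n}$), the tensor product of the wedges of the $v_{f(i)}$ over each interval (in increasing order of $i$) and $w_{f(1)}\wedge\cdots\wedge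 w_{f(n)}$. $\mathcal E^{\mathbf m|n}_+$ is the span of $K_f$, $f\in\mathbb Z_{++}^{\mathbf m|n}$. For $d\in\mathbb N$ let $\mathcal E^{\mathbf m|n}_{\ge-d}$ be the span of $K_f$ with $f(i)\ge-d$ for all $i>0$; the completion $\widehat{\mathcal E}^{\mathbf m|n}$ consists of possibly infinite linear combinations of the $K_f$ whose projection to each $\mathcal E^{\mathbf m|n}_{\ge-d}$ is a finite sum; $\widehat{\mathcal E}^{\mathbf m|n}_+$ is the subspace of those involving only $K_f$ with $f\in\mathbb Z_{++}^{\mathbf m|n}$. Super Bruhat order. For $f,g\in\mathbb Z^{m|n}$ write $f\downarrow g$ if (a) for some $i<0<j$ with $f(i)=f(j)$, $g$ is obtained from $f$ by lowering both values $f(i),f(j)$ by $1$; or (b) $g=f\cdot\tau_{ij}$ (values at $i,j$ interchanged) for some $i<j<0$ with $f(i)>f(j)$; or (c) $g=f\cdot\tau_{ij}$ for some $0<i<j$ with $f(i)<f(j)$. $\succcurlyeq$ is the reflexive-transitive closure ($f\succcurlyeq g$ if $f\downarrow\cdots\downarrow g$), restricted to $\mathbb Z_+^{\mathbf m|n}$. Bar map and canonical basis. There is a unique continuous anti-linear map $\overline{\phantom{u}}$ on $\widehat{\mathcal E}^{\mathbf m|n}$ with: $\overline{K_f}=K_f$ for $f$ minimal in the super Bruhat order; $\overline{Xu}=\overline X\,\overline u$ for $X\in\mathcal U$; it is an involution; $\overline{K_f}=K_f+$ a (possibly infinite) $\mathbb Z[q,q^{-1}]$-combination of $K_g$, $g\prec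 f$. The canonical basis $\{U_f\}_{f\in\mathbb Z_+^{\mathbf m|n}}$ is the unique bar-invariant topological basis of $\widehat{\mathcal E}^{\mathbf m|n}$ with $U_f\in K_f+\sum_{g\prec f}q\mathbb Z[q]K_g$ (possibly infinite sum). *)

theory Defs
  imports
    "HOL-Analysis.Analysis"
    "HOL-Library.FuncSet"
    "HOL-Library.Poly_Mapping"
    "HOL-Computational_Algebra.Polynomial_Factorial"
    "HOL-Computational_Algebra.Field_as_Ring"
begin

section \<open>The field of rational functions and its bar involution\<close>

type_synonym qfield = "rat poly fract"

definition qq :: qfield where
  "qq = to_fract [:0, 1:]"

definition poly_at_q_inv :: "rat poly \<Rightarrow> qfield" where
  "poly_at_q_inv p = poly (map_poly (\<lambda>c. to_fract [:c:]) p) (inverse qq)"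

text \<open>The involution \<open>q \<mapsto> q\<inverse>\<close> is computed on the reduced fraction; \<open>qbar_Fract\<close> below shows that
  the choice of fraction does not matter.\<close>

definition qbar :: "qfield \<Rightarrow> qfield" where
  "qbar x = poly_at_q_inv (fst (quot_of_fract x)) / poly_at_q_inv (snd (quot_of_fract x))"

definition Z_q :: "qfield set" where
  "Z_q = range (\<lambda>p :: int poly. to_fract (map_poly of_int p))"

definition q_Z_q :: "qfield set" where
  "q_Z_q = (\<lambda>c. qq * c) ` Z_q"

definition Z_q_qinv :: "qfield set" where
  "Z_q_qinv = {c / qq ^ k | c k. c \<in> Z_q}"

lemma qq_nonzero [simp]: "qq \<noteq> 0"
  by (simp add: qq_def)

lemma to_fract_const_hom:
  "to_fract [:a + b:] = to_fract [:a:] + to_fract [:b :: rat:]"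
  "to_fract [:a * b:] = to_fract [:a:] * to_fract [:b :: rat:]"
  by (simp_all flip: to_fract_add to_fract_mult)

lemma poly_at_q_inv_0 [simp]: "poly_at_q_inv 0 = 0"
  by (simp add: poly_at_q_inv_def)

lemma poly_at_q_inv_pCons [simp]:
  "poly_at_q_inv (pCons c p) = to_fract [:c:] + inverse qq * poly_at_q_inv p"
  by (simp add: poly_at_q_inv_def map_poly_pCons)

lemma poly_at_q_inv_1 [simp]: "poly_at_q_inv 1 = 1"
  by (simp add: poly_at_q_inv_def map_poly_1 flip: one_pCons)

lemma poly_at_q_inv_add: "poly_at_q_inv (a + b) = poly_at_q_inv a + poly_at_q_inv b"
  by (induction a b rule: poly_induct2) (simp_all add: to_fract_const_hom algebra_simps)

lemma poly_at_q_inv_smult: "poly_at_q_inv (smult c p) = to_fract [:c:] * poly_at_q_inv p"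
  by (induction p) (simp_all add: to_fract_const_hom algebra_simps)

lemma poly_at_q_inv_mult: "poly_at_q_inv (a * b) = poly_at_q_inv a * poly_at_q_inv b"
  by (induction a) (simp_all add: poly_at_q_inv_add poly_at_q_inv_smult algebra_simps)

lemma poly_at_q_inv_eq_reflect: "poly_at_q_inv p * qq ^ degree p = to_fract (reflect_poly p)"
proof (induction p)
  case 0
  show ?case by simp
next
  case (pCons c p)
  have monom: "to_fract (monom c k) = to_fract [:c:] * qq ^ k" for c :: rat and k
  proof (induction k)
    case 0
    show ?case by (simp add: monom_0)
  next
    case (Suc k)
    have "monom c (Suc k) = [:0, 1:] * monom c k"
      by (simp add: monom_Suc)
    then show ?case
      using Suc.IH by (simp only: to_fract_mult qq_def power_Suc ac_simps)
  qed
  show ?case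
  proof (cases "p = 0")
    case True
    then show ?thesis by simp
  next
    case False
    have "poly_at_q_inv (pCons c p) * qq ^ degree (pCons c p)
        = to_fract [:c:] * qq ^ Suc (degree p) + poly_at_q_inv p * qq ^ degree p"
      using False by (simp add: field_simps)
    also have "\<dots> = to_fract (reflect_poly (pCons c p))"
      using False pCons.IH by (simp add: reflect_poly_pCons' to_fract_add monom)
    finally show ?thesis .
  qed
qed

lemma poly_at_q_inv_eq_0_iff [simp]: "poly_at_q_inv p = 0 \<longleftrightarrow> p = 0"
proof
  assume "poly_at_q_inv p = 0"
  then have "to_fract (reflect_poly p) = 0"
    using poly_at_q_inv_eq_reflect [of p] by simp
  then show "p = 0" by simp
qed simp

lemma qbar_Fract:
  assumes "b \<noteq> 0"
  shows "qbar (Fract a b) = poly_at_q_inv a / poly_at_q_inv b"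
proof -
  obtain c d where cd: "quot_of_fract (Fract a b) = (c, d)"
    by force
  have "d \<noteq> 0"
    using snd_quot_of_fract_nonzero [of "Fract a b"] cd by simp
  have "Fract c d = Fract a b"
    using quot_to_fract_quot_of_fract [of "Fract a b"] cd by (simp add: quot_to_fract_def)
  then have "c * b = a * d"
    using assms \<open>d \<noteq> 0\<close> by (simp add: eq_fract)
  then have "poly_at_q_inv c * poly_at_q_inv b = poly_at_q_inv a * poly_at_q_inv d"
    by (metis poly_at_q_inv_mult)
  then show ?thesis
    using assms \<open>d \<noteq> 0\<close> cd by (simp add: qbar_def frac_eq_eq)
qed

lemma qbar_qq: "qbar qq = inverse qq"
proof -
  have "qbar qq = poly_at_q_inv [:0, 1:]"
    using qbar_Fract [of 1 "[:0, 1:]"] by (simp add: qq_def to_fract_def)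
  also have "\<dots> = inverse qq"
    by (simp flip: one_pCons)
  finally show ?thesis .
qed

lemma qbar_add: "qbar (x + y) = qbar x + qbar y"
  by (cases x; cases y)
    (simp add: qbar_Fract poly_at_q_inv_add poly_at_q_inv_mult add_frac_eq)

lemma qbar_mult: "qbar (x * y) = qbar x * qbar y"
  by (cases x; cases y) (simp add: qbar_Fract poly_at_q_inv_mult)


section \<open>The quantum group\<close>

datatype uq_gen = UE int | UF int | UK int | UKinv int

datatype uq_word = Word (letters: "uq_gen list")

instantiation uq_word :: monoid_add
begin

definition zero_uq_word :: uq_word where "0 = Word []"

definition plus_uq_word :: "uq_word \<Rightarrow> uq_word \<Rightarrow> uq_word" where
  "v + w = Word (letters v @ letters w)"

instance
  by standard (auto simp: zero_uq_word_def plus_uq_word_def)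

end

text \<open>With concatenation as the (additively written) monoid operation on words, \<open>uq_free\<close> is the
  free associative algebra on the generators.  An element of \<open>U\<^sub>q(gl\<^sub>\<infinity>)\<close> is represented by an
  element of \<open>uq_free\<close>, and two elements represent the same one iff their difference lies in
  \<open>uq_ideal\<close>.\<close>

type_synonym uq_free = "uq_word \<Rightarrow>\<^sub>0 qfield"

definition gen :: "uq_gen \<Rightarrow> uq_free" where
  "gen x = Poly_Mapping.single (Word [x]) 1"

definition scal :: "qfield \<Rightarrow> uq_free" where
  "scal c = Poly_Mapping.single 0 c"

definition delta :: "int \<Rightarrow> int \<Rightarrow> int" where
  "delta a b = (if a = b then 1 else 0)"

abbreviation "gE a \<equiv> gen (UE a)"
abbreviation "gF a \<equiv> gen (UF a)"
abbreviation "gK a \<equiv> gen (UK a)"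
abbreviation "gKinv a \<equiv> gen (UKinv a)"

inductive_set uq_relators :: "uq_free set" where
  K_Kinv: "gK a * gKinv a - 1 \<in> uq_relators"
| Kinv_K: "gKinv a * gK a - 1 \<in> uq_relators"
| K_K: "gK a * gK b - gK b * gK a \<in> uq_relators"
| K_E: "gK a * gE b * gKinv a - scal (qq powi (delta a b - delta a (b + 1))) * gE b \<in> uq_relators"
| K_F: "gK a * gF b * gKinv a - scal (qq powi (delta a (b + 1) - delta a b)) * gF b \<in> uq_relators"
| E_F: "gE a * gF b - gF b * gE a
        - scal (of_int (delta a b) / (qq - inverse qq)) * (gK a * gKinv (a + 1) - gK (a + 1) * gKinv a)
        \<in> uq_relators"
| E_E: "\<bar>a - b\<bar> > 1 \<Longrightarrow> gE a * gE b - gE b * gE a \<in> uq_relators"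
| F_F: "\<bar>a - b\<bar> > 1 \<Longrightarrow> gF a * gF b - gF b * gF a \<in> uq_relators"
| Serre_E: "\<bar>a - b\<bar> = 1 \<Longrightarrow>
    gE a * gE a * gE b - scal (qq + inverse qq) * gE a * gE b * gE a + gE b * gE a * gE a \<in> uq_relators"
| Serre_F: "\<bar>a - b\<bar> = 1 \<Longrightarrow>
    gF a * gF a * gF b - scal (qq + inverse qq) * gF a * gF b * gF a + gF b * gF a * gF a \<in> uq_relators"

inductive_set uq_ideal :: "uq_free set" where
  zero: "0 \<in> uq_ideal"
| step: "r \<in> uq_relators \<Longrightarrow> z \<in> uq_ideal \<Longrightarrow> x * r * y + z \<in> uq_ideal"

inductive_set usl_generated :: "uq_free set" where
  scal: "scal c \<in> usl_generated"
| E: "gE a \<in> usl_generated"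
| F: "gF a \<in> usl_generated"
| KKinv: "gK a * gKinv (a + 1) \<in> usl_generated"
| KinvK: "gK (a + 1) * gKinv a \<in> usl_generated"
| add: "x \<in> usl_generated \<Longrightarrow> y \<in> usl_generated \<Longrightarrow> x + y \<in> usl_generated"
| mult: "x \<in> usl_generated \<Longrightarrow> y \<in> usl_generated \<Longrightarrow> x * y \<in> usl_generated"

text \<open>All representatives of all elements of the subalgebra \<open>U\<^sub>q(sl\<^sub>\<infinity>)\<close>.\<close>

definition usl :: "uq_free set" where
  "usl = {x. \<exists>y \<in> usl_generated. x - y \<in> uq_ideal}"

fun gen_bar :: "uq_gen \<Rightarrow> uq_gen" where
  "gen_bar (UE a) = UE a"
| "gen_bar (UF a) = UF a"
| "gen_bar (UK a) = UKinv a"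
| "gen_bar (UKinv a) = UK a"

text \<open>The anti-linear algebra automorphism of \<open>uq_free\<close> that induces the bar involution.\<close>

definition uq_bar :: "uq_free \<Rightarrow> uq_free" where
  "uq_bar x = (\<Sum>w \<in> Poly_Mapping.keys x.
     Poly_Mapping.single (Word (map gen_bar (letters w))) (qbar (Poly_Mapping.lookup x w)))"


section \<open>Index sets and the super Bruhat order\<close>

text \<open>Throughout, \<open>ms = [m\<^sub>1, \<dots>, m\<^sub>s]\<close>, and functions on \<open>I(m|n)\<close> are represented by functions on
  \<open>int\<close> that are extensional outside of \<open>I(m|n)\<close>.\<close>

definition Imn :: "nat list \<Rightarrow> nat \<Rightarrow> int set" where
  "Imn ms n = {- int (sum_list ms)..-1} \<union> {1..int n}"

definition vblock :: "nat list \<Rightarrow> nat \<Rightarrow> int set" where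
  "vblock ms k = {- int (sum_list ms) + int (sum_list (take k ms))
                 ..< - int (sum_list ms) + int (sum_list (take (Suc k) ms))}"

definition Zmn :: "nat list \<Rightarrow> nat \<Rightarrow> (int \<Rightarrow> int) set" where
  "Zmn ms n = Imn ms n \<rightarrow>\<^sub>E UNIV"

definition Zmn_plus :: "nat list \<Rightarrow> nat \<Rightarrow> (int \<Rightarrow> int) set" where
  "Zmn_plus ms n = {f \<in> Zmn ms n.
     (\<forall>k < length ms. strict_antimono_on (vblock ms k) f) \<and> strict_mono_on {1..int n} f}"

definition Zmn_plusplus :: "nat list \<Rightarrow> nat \<Rightarrow> (int \<Rightarrow> int) set" where
  "Zmn_plusplus ms n = {f \<in> Zmn_plus ms n. n > 0 \<longrightarrow> f (int n) \<le> int n}"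

definition swap_at :: "int \<Rightarrow> int \<Rightarrow> (int \<Rightarrow> int) \<Rightarrow> int \<Rightarrow> int" where
  "swap_at i j f = f(i := f j, j := f i)"

inductive bruhat_down :: "nat list \<Rightarrow> nat \<Rightarrow> (int \<Rightarrow> int) \<Rightarrow> (int \<Rightarrow> int) \<Rightarrow> bool"
  for ms n where
  "f \<in> Zmn ms n \<Longrightarrow> i \<in> Imn ms n \<Longrightarrow> j \<in> Imn ms n \<Longrightarrow> i < 0 \<Longrightarrow> 0 < j \<Longrightarrow> f i = f j \<Longrightarrow>
     bruhat_down ms n f (f(i := f i - 1, j := f j - 1))"
| "f \<in> Zmn ms n \<Longrightarrow> i \<in> Imn ms n \<Longrightarrow> j \<in> Imn ms n \<Longrightarrow> i < j \<Longrightarrow> j < 0 \<Longrightarrow> f i > f j \<Longrightarrow>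
     bruhat_down ms n f (swap_at i j f)"
| "f \<in> Zmn ms n \<Longrightarrow> i \<in> Imn ms n \<Longrightarrow> j \<in> Imn ms n \<Longrightarrow> 0 < i \<Longrightarrow> i < j \<Longrightarrow> f i < f j \<Longrightarrow>
     bruhat_down ms n f (swap_at i j f)"

text \<open>The order is restricted to \<open>Zmn_plus\<close>, but the intermediate terms of a chain need not lie
  there.\<close>

definition bruhat_less :: "nat list \<Rightarrow> nat \<Rightarrow> (int \<Rightarrow> int) \<Rightarrow> (int \<Rightarrow> int) \<Rightarrow> bool" where
  "bruhat_less ms n g f \<longleftrightarrow>
     f \<in> Zmn_plus ms n \<and> g \<in> Zmn_plus ms n \<and> (bruhat_down ms n)\<^sup>*\<^sup>* f g \<and> g \<noteq> f"

definition bruhat_minimal :: "nat list \<Rightarrow> nat \<Rightarrow> (int \<Rightarrow> int) \<Rightarrow> bool" where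
  "bruhat_minimal ms n f \<longleftrightarrow> f \<in> Zmn_plus ms n \<and> (\<nexists>g. bruhat_less ms n g f)"


section \<open>The tensor space and the Fock space\<close>

text \<open>An element of \<open>V\<^bsup>\<otimes>m\<^esup> \<otimes> W\<^bsup>\<otimes>n\<^esup>\<close> is a finitely supported function on \<open>Zmn ms n\<close>; the basis
  vector at \<open>f\<close> is the pure tensor of the \<open>v\<close> (at \<open>i < 0\<close>) and \<open>w\<close> (at \<open>i > 0\<close>) with index
  \<open>f i\<close>.\<close>

type_synonym tensor = "(int \<Rightarrow> int) \<Rightarrow>\<^sub>0 qfield"

text \<open>The exponent of the power of \<open>q\<close> by which \<open>K\<^sub>a\<close> acts on the factor \<open>v\<^sub>b\<close> (if \<open>i < 0\<close>) or
  \<open>w\<^sub>b\<close> (if \<open>i > 0\<close>).\<close>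

definition K_exp :: "int \<Rightarrow> int \<Rightarrow> int \<Rightarrow> int" where
  "K_exp a i b = (if i < 0 then delta a b else - delta a b)"

definition E_factor :: "int \<Rightarrow> int \<Rightarrow> int \<Rightarrow> int option" where
  "E_factor a i b = (if i < 0 then (if b = a + 1 then Some a else None)
                     else (if b = a then Some (a + 1) else None))"

definition F_factor :: "int \<Rightarrow> int \<Rightarrow> int \<Rightarrow> int option" where
  "F_factor a i b = (if i < 0 then (if b = a then Some (a + 1) else None)
                     else (if b = a + 1 then Some a else None))"

text \<open>By iterating the comultiplication, \<open>E\<^sub>a\<close> acts as the sum over the positions \<open>i\<close> of \<open>E\<^sub>a\<close> at
  position \<open>i\<close> with \<open>K\<^sub>a\<^sub>+\<^sub>1 K\<^sub>a\<inverse>\<close> at all positions to its right, and \<open>F\<^sub>a\<close> as the sum of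
  \<open>F\<^sub>a\<close> at \<open>i\<close> with \<open>K\<^sub>a K\<^sub>a\<^sub>+\<^sub>1\<inverse>\<close> at all positions to its left.\<close>

fun gen_tensor :: "nat list \<Rightarrow> nat \<Rightarrow> uq_gen \<Rightarrow> (int \<Rightarrow> int) \<Rightarrow> tensor" where
  "gen_tensor ms n (UE a) f = (\<Sum>i \<in> Imn ms n. case E_factor a i (f i) of
      None \<Rightarrow> 0
    | Some c \<Rightarrow> Poly_Mapping.single (f(i := c))
        (qq powi (\<Sum>j \<in> {j \<in> Imn ms n. i < j}. K_exp (a + 1) j (f j) - K_exp a j (f j))))"
| "gen_tensor ms n (UF a) f = (\<Sum>i \<in> Imn ms n. case F_factor a i (f i) of
      None \<Rightarrow> 0
    | Some c \<Rightarrow> Poly_Mapping.single (f(i := c))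
        (qq powi (\<Sum>j \<in> {j \<in> Imn ms n. j < i}. K_exp a j (f j) - K_exp (a + 1) j (f j))))"
| "gen_tensor ms n (UK a) f =
     Poly_Mapping.single f (qq powi (\<Sum>j \<in> Imn ms n. K_exp a j (f j)))"
| "gen_tensor ms n (UKinv a) f =
     Poly_Mapping.single f (qq powi (- (\<Sum>j \<in> Imn ms n. K_exp a j (f j))))"

text \<open>The span of the defining relations of the quantum wedges, imposed in adjacent positions
  \<open>i, i + 1\<close> of a common wedge factor.\<close>

definition adjacent :: "nat list \<Rightarrow> nat \<Rightarrow> int \<Rightarrow> bool" where
  "adjacent ms n i \<longleftrightarrow>
     (\<exists>k < length ms. {i, i + 1} \<subseteq> vblock ms k) \<or> {i, i + 1} \<subseteq> {1..int n}"

inductive_set wedge_relations :: "nat list \<Rightarrow> nat \<Rightarrow> tensor set" for ms n where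
  zero: "0 \<in> wedge_relations ms n"
| equal: "x \<in> wedge_relations ms n \<Longrightarrow> f \<in> Zmn ms n \<Longrightarrow> adjacent ms n i \<Longrightarrow> f i = f (i + 1) \<Longrightarrow>
    Poly_Mapping.single f c + x \<in> wedge_relations ms n"
| swap: "x \<in> wedge_relations ms n \<Longrightarrow> f \<in> Zmn ms n \<Longrightarrow> adjacent ms n i \<Longrightarrow>
    (if i < 0 then f i > f (i + 1) else f i < f (i + 1)) \<Longrightarrow>
    Poly_Mapping.single f c + Poly_Mapping.single (swap_at i (i + 1) f) (c * qq) + x
      \<in> wedge_relations ms n"

text \<open>The Fock space is the quotient of the tensor space by \<open>wedge_relations\<close>; the images \<open>K\<^sub>f\<close> of the
  basis tensors with \<open>f \<in> Zmn_plus\<close> form its monomial basis.  \<open>wedge ms n x\<close> gives the coordinates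
  of the class of \<open>x\<close> with respect to that basis.\<close>

definition wedge :: "nat list \<Rightarrow> nat \<Rightarrow> tensor \<Rightarrow> tensor" where
  "wedge ms n x = (THE y. Poly_Mapping.keys y \<subseteq> Zmn_plus ms n \<and> x - y \<in> wedge_relations ms n)"


section \<open>The completed Fock space\<close>

text \<open>A possibly infinite linear combination of the \<open>K\<^sub>f\<close> is its function of coefficients.\<close>

type_synonym fock = "(int \<Rightarrow> int) \<Rightarrow> qfield"

definition bounded_below :: "nat \<Rightarrow> nat \<Rightarrow> (int \<Rightarrow> int) set" where
  "bounded_below n d = {f. \<forall>i \<in> {1..int n}. f i \<ge> - int d}"

definition fock_hat :: "nat list \<Rightarrow> nat \<Rightarrow> fock set" where
  "fock_hat ms n = {u. {f. u f \<noteq> 0} \<subseteq> Zmn_plus ms n \<and>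
     (\<forall>d. finite ({f. u f \<noteq> 0} \<inter> bounded_below n d))}"

definition fock_plus :: "nat list \<Rightarrow> nat \<Rightarrow> fock set" where
  "fock_plus ms n = {u. {f. u f \<noteq> 0} \<subseteq> Zmn_plusplus ms n \<and> finite {f. u f \<noteq> 0}}"

text \<open>The inverse limit topology: two vectors are close if they have the same projection to the
  span of the \<open>K\<^sub>f\<close> with \<open>f \<in> bounded_below n d\<close>, for a large \<open>d\<close>.\<close>

definition fock_topology :: "nat list \<Rightarrow> nat \<Rightarrow> fock topology" where
  "fock_topology ms n = topology_generated_by
     {{v \<in> fock_hat ms n. \<forall>f \<in> bounded_below n d. v f = u f} | u d. u \<in> fock_hat ms n}"

definition monomial :: "(int \<Rightarrow> int) \<Rightarrow> fock" where
  "monomial f = (\<lambda>g. if g = f then 1 else 0)"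

text \<open>The action on the Fock space, extended by continuity.  The sum is finite for
  \<open>u \<in> fock_hat ms n\<close>: a generator changes at most one index of a tensor, by at most 1, so each
  \<open>K\<^sub>g\<close> occurs in the images of finitely many \<open>K\<^sub>f\<close>.\<close>

definition gen_act :: "nat list \<Rightarrow> nat \<Rightarrow> uq_gen \<Rightarrow> fock \<Rightarrow> fock" where
  "gen_act ms n x u = (\<lambda>g.
     \<Sum>f \<in> {f \<in> Zmn_plus ms n. u f \<noteq> 0 \<and> Poly_Mapping.lookup (wedge ms n (gen_tensor ms n x f)) g \<noteq> 0}.
       u f * Poly_Mapping.lookup (wedge ms n (gen_tensor ms n x f)) g)"

definition uq_act :: "nat list \<Rightarrow> nat \<Rightarrow> uq_free \<Rightarrow> fock \<Rightarrow> fock" where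
  "uq_act ms n x u = (\<lambda>g.
     \<Sum>w \<in> Poly_Mapping.keys x. Poly_Mapping.lookup x w * foldr (gen_act ms n) (letters w) u g)"


section \<open>The bar involution and the canonical basis\<close>

text \<open>The values of \<open>\<psi>\<close> outside of \<open>fock_hat ms n\<close> are irrelevant.\<close>

definition is_bar_map :: "nat list \<Rightarrow> nat \<Rightarrow> (fock \<Rightarrow> fock) \<Rightarrow> bool" where
  "is_bar_map ms n \<psi> \<longleftrightarrow>
     continuous_map (fock_topology ms n) (fock_topology ms n) \<psi> \<and>
     (\<forall>u \<in> fock_hat ms n. \<forall>v \<in> fock_hat ms n. \<psi> (\<lambda>f. u f + v f) = (\<lambda>f. \<psi> u f + \<psi> v f)) \<and>
     (\<forall>c. \<forall>u \<in> fock_hat ms n. \<psi> (\<lambda>f. c * u f) = (\<lambda>f. qbar c * \<psi> u f)) \<and>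
     (\<forall>f. bruhat_minimal ms n f \<longrightarrow> \<psi> (monomial f) = monomial f) \<and>
     (\<forall>x \<in> usl. \<forall>u \<in> fock_hat ms n. \<psi> (uq_act ms n x u) = uq_act ms n (uq_bar x) (\<psi> u)) \<and>
     (\<forall>u \<in> fock_hat ms n. \<psi> (\<psi> u) = u) \<and>
     (\<forall>f \<in> Zmn_plus ms n. \<psi> (monomial f) f = 1 \<and>
        (\<forall>g. g \<noteq> f \<longrightarrow> \<psi> (monomial f) g \<in> Z_q_qinv \<and>
           (\<psi> (monomial f) g \<noteq> 0 \<longrightarrow> bruhat_less ms n g f)))"

text \<open>A topological basis: every vector is in exactly one way an unconditionally convergent sum of
  multiples of basis vectors.\<close>

definition topological_basis_on :: "nat list \<Rightarrow> nat \<Rightarrow> ((int \<Rightarrow> int) \<Rightarrow> fock) \<Rightarrow> bool" where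
  "topological_basis_on ms n U \<longleftrightarrow>
     (\<forall>f \<in> Zmn_plus ms n. U f \<in> fock_hat ms n) \<and>
     (\<forall>u \<in> fock_hat ms n. \<exists>!c. {f. c f \<noteq> 0} \<subseteq> Zmn_plus ms n \<and>
        limitin (fock_topology ms n) (\<lambda>S g. \<Sum>f \<in> S. c f * U f g) u
          (finite_subsets_at_top (Zmn_plus ms n)))"

definition is_canonical_basis ::
    "nat list \<Rightarrow> nat \<Rightarrow> (fock \<Rightarrow> fock) \<Rightarrow> ((int \<Rightarrow> int) \<Rightarrow> fock) \<Rightarrow> bool" where
  "is_canonical_basis ms n \<psi> U \<longleftrightarrow>
     topological_basis_on ms n U \<and>
     (\<forall>f \<in> Zmn_plus ms n. \<psi> (U f) = U f \<and> U f f = 1 \<and>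
        (\<forall>g. g \<noteq> f \<longrightarrow> U f g \<in> q_Z_q \<and> (U f g \<noteq> 0 \<longrightarrow> bruhat_less ms n g f)))"

end

theory Submission
  imports Defs
begin

text \<open>
  For a simple root \<open>a\<close>, the Fock space is a sum of tensor products of copies of the two-dimensional
  representation of \<open>U\<^sub>q(sl\<^sub>2)\<close> generated by \<open>E\<^sub>a\<close>, which have a basis of strings
  \<open>b, E\<^sub>a b, E\<^sub>a\<^bsup>(2)\<^esup> b, \<dots>\<close> over the functions regular at \<open>q = 0\<close>.  If \<open>f\<close> is at position \<open>r > 0\<close>
  of its string and \<open>h\<close> is at position \<open>0\<close>, then \<open>E\<^sub>a\<^bsup>(r)\<^esup> U\<^sub>h\<close> equals \<open>K\<^sub>f\<close> modulo \<open>q\<close>, up to poles at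
  positions \<open>R > r\<close>.  Subtracting bar-invariant multiples of finitely many \<open>E\<^sub>a\<^bsup>(R)\<^esup> U\<^sub>k\<close> removes the
  poles, one order after another, and the bar-invariant result must be \<open>U\<^sub>f\<close>.  So \<open>U\<^sub>f\<close> is
  finite if all these \<open>U\<^sub>h\<close> and \<open>U\<^sub>k\<close> are.

  The sum of the squares of the multiplicities in a weight is bounded; it increases strictly from \<open>f\<close>
  to \<open>k\<close>, and weakly from \<open>f\<close> to \<open>h\<close>.  Taking for \<open>a + 1\<close> the smallest value at a positive position
  that has not yet been moved sufficiently far below all values at negative positions, \<open>h\<close> arises
  from \<open>f\<close> by lowering this value and possibly raising others at negative positions.  This ends
  when the values at positive positions are smaller than those at negative ones, where only finitely
  many monomials lie below \<open>f\<close>.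
\<close>

section \<open>Rational functions regular at zero and Laurent polynomials\<close>

text \<open>Move (a) of the order can be repeated without end, so infinitely many monomials may lie
  below f, and triangularity alone gives no finiteness. The comparison rests on rigidity instead: a
  bar-invariant vector whose coefficients are Laurent polynomials vanishing at q = 0 is zero.
  Congruences modulo q are read in string coordinates, whose denominators are quantum integers, so
  they live in the local ring of all functions regular at 0; integrality is tracked separately as
  membership in \<open>laurent\<close>. The poles come from E^(r) E^(R-r) b = [R choose r] E^(R) b,
  since the quantum binomial has a pole at 0 for 0 < r < R. The sum of squares is the invariant norm
  of the weight. Moving r units from a to a + 1 changes it by 2r(r - d), where d is the difference
  of the two multiplicities. At f, d = phi - eps, so the change is 2r eps for r = phi and positive
  for every R > phi. This is why the corrections can be treated as already known.\<close>

definition regular :: "qfield set" where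
  "regular = {to_fract p / to_fract d | p d. coeff d 0 \<noteq> 0}"

definition vanishing :: "qfield set" where
  "vanishing = (*) qq ` regular"

definition laurent :: "qfield set" where
  "laurent = {x. \<exists>k p. x * qq ^ k = to_fract p}"

lemma regularI: "coeff d 0 \<noteq> 0 \<Longrightarrow> to_fract p / to_fract d \<in> regular"
  by (auto simp: regular_def)

lemma to_fract_regular [simp]: "to_fract p \<in> regular"
  using regularI [of 1 p] by simp

lemma regular_0 [simp]: "0 \<in> regular" and regular_1 [simp]: "1 \<in> regular"
  using to_fract_regular [of 0] to_fract_regular [of 1] by (simp_all del: to_fract_regular)

lemma qq_regular [simp]: "qq \<in> regular"
  by (simp add: qq_def)

lemma regular_mult [simp]: "x \<in> regular \<Longrightarrow> y \<in> regular \<Longrightarrow> x * y \<in> regular"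
proof -
  assume "x \<in> regular" "y \<in> regular"
  then obtain p d p' d' where "x = to_fract p / to_fract d" "coeff d 0 \<noteq> 0"
    "y = to_fract p' / to_fract d'" "coeff d' 0 \<noteq> 0"
    by (auto simp: regular_def)
  then show ?thesis
    using regularI [of "d * d'" "p * p'"] by (simp add: coeff_mult)
qed

lemma regular_add [simp]: "x \<in> regular \<Longrightarrow> y \<in> regular \<Longrightarrow> x + y \<in> regular"
proof -
  assume "x \<in> regular" "y \<in> regular"
  then obtain p d p' d' where *: "x = to_fract p / to_fract d" "coeff d 0 \<noteq> 0"
    "y = to_fract p' / to_fract d'" "coeff d' 0 \<noteq> 0"
    by (auto simp: regular_def)
  then have "d \<noteq> 0" "d' \<noteq> 0"
    by auto
  then have "x + y = to_fract (p * d' + p' * d) / to_fract (d * d')"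
    using * by (simp add: add_frac_eq)
  then show ?thesis
    using * regularI [of "d * d'" "p * d' + p' * d"] by (simp add: coeff_mult)
qed

lemma regular_uminus [simp]: "x \<in> regular \<Longrightarrow> - x \<in> regular"
  using regular_mult [OF to_fract_regular [of "-1"]] by simp

lemma regular_power [simp]: "x \<in> regular \<Longrightarrow> x ^ k \<in> regular"
  by (induction k) auto

lemma vanishing_imp_regular: "x \<in> vanishing \<Longrightarrow> x \<in> regular"
  by (auto simp: vanishing_def)

lemma vanishing_0 [simp]: "0 \<in> vanishing"
  by (auto simp: vanishing_def image_iff intro: bexI [of _ 0])

lemma qq_mult_vanishing [simp]: "qq * x \<in> vanishing \<longleftrightarrow> x \<in> regular"
  by (auto simp: vanishing_def)

lemma vanishing_add [simp]: "x \<in> vanishing \<Longrightarrow> y \<in> vanishing \<Longrightarrow> x + y \<in> vanishing"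
  by (auto simp: vanishing_def image_iff simp flip: distrib_left)

lemma vanishing_mult_right [simp]: "x \<in> vanishing \<Longrightarrow> y \<in> regular \<Longrightarrow> x * y \<in> vanishing"
  by (auto simp: vanishing_def image_iff mult.assoc)

lemma vanishing_mult_left [simp]: "y \<in> regular \<Longrightarrow> x \<in> vanishing \<Longrightarrow> y * x \<in> vanishing"
  by (metis mult.commute vanishing_mult_right)

lemma vanishing_uminus [simp]: "x \<in> vanishing \<Longrightarrow> - x \<in> vanishing"
  by (metis mult_minus1 regular_1 regular_uminus vanishing_mult_left)

lemma vanishing_diff [simp]: "x \<in> vanishing \<Longrightarrow> y \<in> vanishing \<Longrightarrow> x - y \<in> vanishing"
  using vanishing_add [of x "- y"] by simp

lemma vanishing_sum: "(\<And>i. i \<in> I \<Longrightarrow> f i \<in> vanishing) \<Longrightarrow> sum f I \<in> vanishing"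
  by (induction I rule: infinite_finite_induct) auto

lemma vanishing_power: "k > 0 \<Longrightarrow> qq ^ k \<in> vanishing"
  by (cases k) auto

text \<open>The residue field at q = 0 is the field of rationals; the witness is the value
  p(0)/d(0). Such residues are bar-invariant, so they can serve as leading coefficients of
  corrections in \<open>kill_poles_at\<close>.\<close>

lemma regular_cong_constant:
  assumes "x \<in> regular"
  obtains c :: rat where "x - to_fract [:c:] \<in> vanishing"
proof -
  obtain p d where x: "x = to_fract p / to_fract d" and d: "coeff d 0 \<noteq> 0"
    using assms by (auto simp: regular_def)
  then have "d \<noteq> 0" by auto
  define c where "c = coeff p 0 / coeff d 0"
  have "coeff (p - smult c d) 0 = 0"
    using d by (simp add: c_def)
  then obtain r where r: "p - smult c d = [:0, 1:] * r"
    by (metis dvd_def poly_0_coeff_0 poly_eq_0_iff_dvd minus_zero)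
  have "x - to_fract [:c:] = to_fract (p - smult c d) / to_fract d"
    using \<open>d \<noteq> 0\<close> x by (simp add: field_simps flip: to_fract_mult)
  also have "\<dots> = qq * (to_fract r / to_fract d)"
    by (simp only: r to_fract_mult qq_def times_divide_eq_right)
  finally show ?thesis
    using that regularI [OF d] by (metis qq_mult_vanishing)
qed

text \<open>A nonzero denominator vanishes at 0 to a finite order s; q^s removes the pole and one
  more factor q forces vanishing. Finite pole orders are what the induction in
  \<open>kill_poles_at\<close> runs on.\<close>

lemma power_mult_vanishing_ex: "\<exists>k. qq ^ k * x \<in> vanishing"
proof -
  obtain p d where x: "x = Fract p d" and "d \<noteq> 0"
    by (cases x)
  define s where "s = order 0 d"
  have "[:0, 1:] ^ s dvd d"
    using order_1 [of 0 d] by (simp add: s_def)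
  then obtain e where e: "d = [:0, 1:] ^ s * e"
    by (auto simp: dvd_def)
  have "\<not> [:0, 1:] ^ Suc s dvd d"
    using order_2 [OF \<open>d \<noteq> 0\<close>, of 0] by (simp add: s_def)
  then have "coeff e 0 \<noteq> 0"
    unfolding e by (metis dvd_def mult.assoc minus_zero poly_0_coeff_0 poly_eq_0_iff_dvd power_Suc2)
  have [simp]: "to_fract ([:0, 1:] ^ s) = qq ^ s" for s
    by (induction s) (auto simp: qq_def simp del: mult_pCons_left)
  have "x = to_fract p / (qq ^ s * to_fract e)"
    by (simp add: x e Fract_conv_to_fract)
  then have "qq ^ Suc s * x = qq * (to_fract p / to_fract e)"
    by simp
  then show ?thesis
    using regularI [OF \<open>coeff e 0 \<noteq> 0\<close>] by (metis qq_mult_vanishing)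
qed

section \<open>Laurent polynomials with rational coefficients\<close>

lemma laurent_to_fract [simp]: "to_fract p \<in> laurent"
  unfolding laurent_def by (rule CollectI, rule exI [of _ 0]) auto

lemma laurent_0 [simp]: "0 \<in> laurent" and laurent_1 [simp]: "1 \<in> laurent"
  using laurent_to_fract [of 0] laurent_to_fract [of 1] by (simp_all del: laurent_to_fract)

lemma laurent_qq [simp]: "qq \<in> laurent"
  by (simp add: qq_def)

lemma laurent_inverse_qq [simp]: "inverse qq \<in> laurent"
  unfolding laurent_def by (rule CollectI, rule exI [of _ 1], rule exI [of _ 1]) simp

lemma to_fract_qq_power: "qq ^ k = to_fract ([:0, 1:] ^ k)"
  by (induction k) (auto simp: qq_def simp del: mult_pCons_left)

lemma laurent_mult [simp]: "x \<in> laurent \<Longrightarrow> y \<in> laurent \<Longrightarrow> x * y \<in> laurent"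
proof -
  assume "x \<in> laurent" "y \<in> laurent"
  then obtain k p l r where "x * qq ^ k = to_fract p" "y * qq ^ l = to_fract r"
    by (auto simp: laurent_def)
  then have "(x * y) * qq ^ (k + l) = to_fract (p * r)"
    by (simp add: power_add algebra_simps flip: \<open>x * qq ^ k = to_fract p\<close>)
  then show ?thesis
    unfolding laurent_def by blast
qed

lemma laurent_add [simp]: "x \<in> laurent \<Longrightarrow> y \<in> laurent \<Longrightarrow> x + y \<in> laurent"
proof -
  assume "x \<in> laurent" "y \<in> laurent"
  then obtain k p l r where *: "x * qq ^ k = to_fract p" "y * qq ^ l = to_fract r"
    by (auto simp: laurent_def)
  have "(x + y) * qq ^ (k + l) = (x * qq ^ k) * qq ^ l + (y * qq ^ l) * qq ^ k"
    by (simp add: power_add algebra_simps)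
  also have "\<dots> = to_fract (p * [:0, 1:] ^ l + r * [:0, 1:] ^ k)"
    by (simp only: * to_fract_add to_fract_mult flip: to_fract_qq_power)
  finally show ?thesis
    unfolding laurent_def by blast
qed

lemma laurent_uminus [simp]: "x \<in> laurent \<Longrightarrow> - x \<in> laurent"
  using laurent_mult [OF laurent_to_fract [of "-1"]] by simp

lemma laurent_diff [simp]: "x \<in> laurent \<Longrightarrow> y \<in> laurent \<Longrightarrow> x - y \<in> laurent"
  using laurent_add [of x "- y"] by simp

lemma laurent_power [simp]: "x \<in> laurent \<Longrightarrow> x ^ k \<in> laurent"
  by (induction k) auto

lemma laurent_powi [simp]: "qq powi k \<in> laurent"
  by (auto simp: power_int_def)

lemma q_Z_q_laurent: "x \<in> q_Z_q \<Longrightarrow> x \<in> laurent"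
  by (auto simp: q_Z_q_def Z_q_def)

lemma q_Z_q_vanishing: "x \<in> q_Z_q \<Longrightarrow> x \<in> vanishing"
  by (auto simp: q_Z_q_def Z_q_def)

section \<open>The bar involution on scalars\<close>

lemma qbar_0 [simp]: "qbar 0 = 0" and qbar_1 [simp]: "qbar 1 = 1"
  using qbar_Fract [of 1 0] qbar_Fract [of 1 1] by (simp_all flip: Zero_fract_def One_fract_def
      add: fract_collapse)

lemma qbar_to_fract: "qbar (to_fract p) = poly_at_q_inv p"
  using qbar_Fract [of 1 p] by (simp add: Fract_conv_to_fract)

lemma qbar_const [simp]: "qbar (to_fract [:c:]) = to_fract [:c:]"
  by (simp add: qbar_to_fract)

lemma qbar_uminus: "qbar (- x) = - qbar x"
  using qbar_add [of x "- x"] by (simp add: eq_neg_iff_add_eq_0 add.commute)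

lemma qbar_power: "qbar (x ^ k) = qbar x ^ k"
  by (induction k) (auto simp: qbar_mult)

lemma qbar_inverse: "qbar (inverse x) = inverse (qbar x)"
proof (cases "x = 0")
  case False
  then have "qbar x * qbar (inverse x) = 1"
    by (simp flip: qbar_mult)
  then show ?thesis
    by (metis inverse_unique)
qed simp

text \<open>Vanishing at 0 turns a Laurent polynomial into a polynomial divisible by q, and bar
  invariance makes it a polynomial in q^-1 as well. Only constants are both.\<close>

lemma laurent_vanishing_bar_invariant_eq_0:
  assumes "x \<in> laurent" "x \<in> vanishing" "qbar x = x"
  shows "x = 0"
proof -
  obtain k p where kp: "x * qq ^ k = to_fract p"
    using assms by (auto simp: laurent_def)
  obtain y where y: "y \<in> regular" "x = qq * y"
    using assms by (auto simp: vanishing_def)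
  obtain a b where ab: "y = to_fract a / to_fract b" "coeff b 0 \<noteq> 0"
    using y by (auto simp: regular_def)
  then have "b \<noteq> 0" by auto
  have "to_fract (p * b) = x * qq ^ k * to_fract b"
    by (simp add: kp)
  also have "\<dots> = qq ^ Suc k * to_fract a"
    using ab y \<open>b \<noteq> 0\<close> by simp
  finally have "p * b = [:0, 1:] ^ Suc k * a"
    by (simp only: to_fract_qq_power flip: to_fract_mult) (simp only: to_fract_eq_iff)
  then have "[:0, 1:] ^ Suc k dvd p * b"
    by (metis dvd_triv_left)
  moreover have "order 0 b = 0"
    using ab by (simp add: order_0I poly_0_coeff_0)
  ultimately have "[:0, 1:] ^ Suc k dvd p"
    using order_divides [of 0 "Suc k" "p * b"] order_divides [of 0 "Suc k" p] \<open>b \<noteq> 0\<close>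
    by (auto simp: order_mult simp del: power_Suc)
  then obtain r where r: "p = [:0, 1:] ^ Suc k * r"
    by (auto simp: dvd_def)
  have "x * qq ^ k = qq ^ Suc k * to_fract r"
    unfolding kp r by (simp only: to_fract_qq_power to_fract_mult)
  then have x: "x = to_fract ([:0, 1:] * r)"
    by (simp add: qq_def del: mult_pCons_left)
  define P where "P = [:0, 1:] * r"
  have "poly_at_q_inv P = to_fract P"
    using assms(3) unfolding x P_def qbar_to_fract .
  then have "to_fract (P * [:0, 1:] ^ degree P) = to_fract (reflect_poly P)"
    using poly_at_q_inv_eq_reflect [of P] by (simp add: to_fract_qq_power)
  then have "P * [:0, 1:] ^ degree P = reflect_poly P"
    by (simp only: to_fract_eq_iff)
  \<comment> \<open>Degrees add up on the left, and reflection never raises the degree, so the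
    degree is 0; a nonzero multiple of q has degree at least 1.\<close>
  then have "P \<noteq> 0 \<Longrightarrow> degree P + degree P \<le> degree P"
    using degree_reflect_poly_le [of P] by (metis degree_linear_power degree_mult_eq pCons_eq_0_iff power_not_zero zero_neq_one)
  then have "P = 0"
    by (cases "r = 0") (auto simp: P_def)
  then show ?thesis
    by (simp add: x P_def)
qed

section \<open>Quantum integers\<close>

definition qint :: "nat \<Rightarrow> qfield" where
  "qint k = (\<Sum>i<k. qq powi (int k - 1 - 2 * int i))"

definition qfact :: "nat \<Rightarrow> qfield" where
  "qfact k = (\<Prod>i=1..k. qint i)"

lemma qint_0 [simp]: "qint 0 = 0"
  by (simp add: qint_def)

lemma qint_Suc: "qint (Suc k) = qq * qint k + inverse qq ^ k"
  by (simp add: qint_def sum_distrib_left power_int_minus power_inverse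
      flip: power_int_add_1' power_int_of_nat)
     (simp add: algebra_simps power_inverse)

lemma qq_power_neq_1: "k > 0 \<Longrightarrow> qq ^ k \<noteq> 1"
proof
  assume "k > 0" "qq ^ k = 1"
  then have "[:0, 1 :: rat:] ^ k = 1"
    by (simp only: to_fract_qq_power flip: to_fract_1) (simp only: to_fract_eq_iff)
  then show False
    using degree_linear_power [of "0 :: rat" k] \<open>k > 0\<close> by simp
qed

lemma inverse_1_minus_qq_power_regular: "k > 0 \<Longrightarrow> inverse (1 - qq ^ k) \<in> regular"
  using regularI [of "1 - [:0, 1:] ^ k" 1]
  by (simp add: coeff_0_power power_0_left inverse_eq_divide flip: to_fract_qq_power)

lemma qq_minus_inverse_neq_0: "qq - inverse qq \<noteq> 0"
  using qq_power_neq_1 [of 2] by (auto simp: power2_eq_square field_simps)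

lemma qint_eq: "qint k * (qq - inverse qq) = qq ^ k - inverse qq ^ k"
proof (induction k)
  case (Suc k)
  have "qint (Suc k) * (qq - inverse qq)
      = qq * (qint k * (qq - inverse qq)) + inverse qq ^ k * (qq - inverse qq)"
    by (simp add: qint_Suc algebra_simps)
  also have "\<dots> = qq ^ Suc k - inverse qq ^ Suc k"
    unfolding Suc by (simp add: algebra_simps power_inverse)
  finally show ?case .
qed simp

lemma qint_Suc': "qint (Suc k) = inverse qq * qint k + qq ^ k"
proof -
  have "(inverse qq * qint k + qq ^ k) * (qq - inverse qq)
      = inverse qq * (qint k * (qq - inverse qq)) + qq ^ k * (qq - inverse qq)"
    by (simp add: algebra_simps)
  also have "\<dots> = qint (Suc k) * (qq - inverse qq)"
    unfolding qint_eq by (simp add: algebra_simps power_inverse)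
  finally show ?thesis
    using qq_minus_inverse_neq_0 by simp
qed

text \<open>All powers of q are collected in the denominator, so that quotients of quantum integers
  become powers of q times quotients of factors 1 - q^(2k), which are units at q = 0 for k >
  0.\<close>

lemma qint_conv: "qint k = (1 - qq ^ (2 * k)) / (qq ^ k * (inverse qq - qq))"
proof -
  have "qint k * (inverse qq - qq) = inverse qq ^ k - qq ^ k"
    using qint_eq [of k] by (simp add: algebra_simps)
  then show ?thesis
    using qq_minus_inverse_neq_0
    by (simp add: field_simps power_mult power2_eq_square mult_2 power_add)
qed

lemma qint_neq_0: "k > 0 \<Longrightarrow> qint k \<noteq> 0"
  using qq_power_neq_1 [of "2 * k"] qq_minus_inverse_neq_0 by (auto simp: qint_conv)

lemma qbar_qint [simp]: "qbar (qint k) = qint k"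
  by (induction k) (simp_all add: qint_Suc [of "_"] qint_Suc' qbar_add qbar_mult qbar_power
      qbar_qq qbar_inverse, simp add: qint_Suc flip: qint_Suc')

text \<open>Together with \<open>qint_quotient_2\<close> this evaluates at q = 0 the two
  coefficients in the clause of \<open>coord\<close> for the letter -1, where j and e are
  \<open>phi\<close> and \<open>eps\<close> of the tail. The pole q^-j cancels against the powers of
  q in the quantum integers.\<close>

lemma qint_quotient_1:
  "inverse qq ^ j * qint (Suc e) / qint (Suc (j + e)) - 1 \<in> vanishing"
proof -
  have ne: "1 - qq ^ (2 * Suc (j + e)) \<noteq> 0"
    using qq_power_neq_1 [of "2 * Suc (j + e)"] by (simp del: power_Suc)
  have quot: "qint (Suc (j + e))
      = (1 - qq ^ (2 * Suc (j + e))) / ((qq ^ j * qq ^ Suc e) * (inverse qq - qq))"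
    by (simp only: qint_conv add_Suc_right flip: power_add)
  have "inverse qq ^ j * qint (Suc e) / qint (Suc (j + e))
     = (1 - qq ^ (2 * Suc e)) / (1 - qq ^ (2 * Suc (j + e)))"
  proof -
    have "inverse x * (A / (y * D)) / (B / ((x * y) * D)) = A / B"
      if "x \<noteq> 0" "y \<noteq> 0" "D \<noteq> 0" for A B x y D :: qfield
      using that by (simp add: field_simps)
    from this [of "qq ^ j" "qq ^ Suc e" "inverse qq - qq"] show ?thesis
      using qq_minus_inverse_neq_0
      by (simp only: qint_conv [of "Suc e"] quot power_inverse) (simp del: power_Suc mult_Suc_right)
  qed
  also have "\<dots> - 1 = (qq ^ (2 * Suc (j + e)) - qq ^ (2 * Suc e)) * inverse (1 - qq ^ (2 * Suc (j + e)))"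
    using ne by (simp add: field_simps)
  also have "\<dots> \<in> vanishing"
    by (intro vanishing_mult_right vanishing_diff vanishing_power inverse_1_minus_qq_power_regular) auto
  finally show ?thesis .
qed

lemma qint_quotient_2: "qint j / qint (Suc (j + e)) \<in> vanishing"
proof -
  have ne: "1 - qq ^ (2 * Suc (j + e)) \<noteq> 0"
    using qq_power_neq_1 [of "2 * Suc (j + e)"] by (simp del: power_Suc)
  have quot: "qint (Suc (j + e))
      = (1 - qq ^ (2 * Suc (j + e))) / ((qq ^ j * qq ^ Suc e) * (inverse qq - qq))"
    by (simp only: qint_conv add_Suc_right flip: power_add)
  have "qint j / qint (Suc (j + e))
     = qq ^ Suc e * (1 - qq ^ (2 * j)) * inverse (1 - qq ^ (2 * Suc (j + e)))"
  proof -
    have "A / (x * D) / (B / ((x * y) * D)) = y * A * inverse B" if "x \<noteq> 0" "D \<noteq> 0"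
      for A B x y D :: qfield
      using that by (simp add: field_simps)
    from this [of "qq ^ j" "inverse qq - qq" "1 - qq ^ (2 * j)" _ "qq ^ Suc e"] show ?thesis
      using qq_minus_inverse_neq_0
      by (simp only: qint_conv [of j] quot) (simp del: power_Suc)
  qed
  also have "\<dots> \<in> vanishing"
    using regular_add [OF regular_1 regular_uminus [OF regular_power [OF qq_regular]]]
    by (intro vanishing_mult_right vanishing_power inverse_1_minus_qq_power_regular) auto
  finally show ?thesis .
qed

lemma qfact_simps [simp]: "qfact 0 = 1" "qfact (Suc k) = qint (Suc k) * qfact k"
  by (simp_all add: qfact_def prod.nat_ivl_Suc')

lemma qfact_neq_0 [simp]: "qfact k \<noteq> 0"
  by (induction k) (auto simp: qint_neq_0)

lemma qbar_qfact [simp]: "qbar (qfact k) = qfact k"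
  by (induction k) (auto simp: qbar_mult)

section \<open>Sign words and the string basis for one simple root\<close>

text \<open>Every \<open>1\<close> is cancelled by a later \<open>-1\<close>, as for parentheses; \<open>phi\<close> and \<open>eps\<close> count the
  uncancelled letters \<open>1\<close> and \<open>-1\<close>.  \<open>fdown\<close> and \<open>eup\<close> are the crystal operators; they are
  meaningful only for \<open>phi w > 0\<close> and \<open>eps w > 0\<close>, respectively.\<close>

fun eps :: "int list \<Rightarrow> nat" where
  "eps [] = 0"
| "eps (x # w) = (if x = -1 then Suc (eps w) else if x = 1 then eps w - 1 else eps w)"

fun phi :: "int list \<Rightarrow> nat" where
  "phi [] = 0"
| "phi (x # w) = (if x = 1 \<and> eps w = 0 then Suc (phi w) else phi w)"

fun fdown :: "int list \<Rightarrow> int list" where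
  "fdown [] = []"
| "fdown (x # w) = (if x = 1 \<and> eps w = 0 then (-1) # w else x # fdown w)"

fun eup :: "int list \<Rightarrow> int list" where
  "eup [] = []"
| "eup (x # w) = (if x = -1 \<and> eps w = 0 then 1 # w else x # eup w)"

lemma length_fdown [simp]: "length (fdown w) = length w"
  by (induction w) auto

lemma length_eup [simp]: "length (eup w) = length w"
  by (induction w) auto

lemma fdown_simps:
  assumes "phi w > 0"
  shows "phi (fdown w) = phi w - 1" "eps (fdown w) = Suc (eps w)" "eup (fdown w) = w"
proof -
  have "phi (fdown w) = phi w - 1 \<and> eps (fdown w) = Suc (eps w) \<and> eup (fdown w) = w"
    using assms by (induction w) (auto split: if_splits)
  then show "phi (fdown w) = phi w - 1" "eps (fdown w) = Suc (eps w)" "eup (fdown w) = w"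
    by auto
qed

lemma eup_simps:
  assumes "eps w > 0"
  shows "phi (eup w) = Suc (phi w)" "eps (eup w) = eps w - 1" "fdown (eup w) = w"
proof -
  have "phi (eup w) = Suc (phi w) \<and> eps (eup w) = eps w - 1 \<and> fdown (eup w) = w"
    using assms
  proof (induction w)
    case (Cons x w)
    then show ?case
      by (cases "eps w = 0"; cases "eps w = 1") (auto split: if_splits)
  qed auto
  then show "phi (eup w) = Suc (phi w)" "eps (eup w) = eps w - 1" "fdown (eup w) = w"
    by auto
qed

definition sign_word :: "int list \<Rightarrow> bool" where
  "sign_word w \<longleftrightarrow> set w \<subseteq> {-1, 0, 1}"

lemma sign_word_Cons [simp]:
  "sign_word (x # w) \<longleftrightarrow> (x = -1 \<or> x = 0 \<or> x = 1) \<and> sign_word w"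
  by (auto simp: sign_word_def)

lemma sign_word_Nil [simp]: "sign_word []"
  by (simp add: sign_word_def)

lemma sum_list_sign_word: "sign_word w \<Longrightarrow> sum_list w = int (phi w) - int (eps w)"
  by (induction w) auto

lemma fdown_eq_list_update:
  assumes "phi w > 0"
  shows "\<exists>k < length w. w ! k = 1 \<and> fdown w = w[k := -1]"
  using assms
proof (induction w)
  case (Cons x w)
  show ?case
  proof (cases "x = 1 \<and> eps w = 0")
    case True
    then show ?thesis by (intro exI [of _ 0]) auto
  next
    case False
    with Cons obtain k where "k < length w" "w ! k = 1" "fdown w = w[k := -1]"
      by (auto split: if_splits)
    with False show ?thesis by (intro exI [of _ "Suc k"]) auto
  qed
qed auto

lemma sum_list_list_update_int:
  "k < length w \<Longrightarrow> sum_list (w[k := x]) = sum_list w + x - (w ! k :: int)"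
  by (induction w arbitrary: k) (auto simp: less_Suc_eq_0_disj)

lemma abs_fdown: "map abs (fdown w) = map abs w"
  by (induction w) auto

lemma abs_eup: "map abs (eup w) = map abs w"
  by (induction w) auto

text \<open>Depending only on absolute values, the property passes to every word with the same zero
  letters, in particular along \<open>fdown\<close> and \<open>eup\<close>.\<close>

lemma sign_word_iff: "sign_word w \<longleftrightarrow> (\<forall>y \<in> set (map abs w). y \<le> 1)"
proof -
  have "x \<in> {-1, 0, 1} \<longleftrightarrow> \<bar>x\<bar> \<le> 1" for x :: int
    by auto
  then show ?thesis
    by (auto simp: sign_word_def)
qed

lemma sign_word_abs_cong: "map abs v = map abs w \<Longrightarrow> sign_word v \<longleftrightarrow> sign_word w"
  unfolding sign_word_iff by simp

lemma sum_list_fdown: "phi w > 0 \<Longrightarrow> sum_list (fdown w) = sum_list w - 2"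
  using fdown_eq_list_update [of w] by (auto simp: sum_list_list_update_int)

lemma sum_list_eup: "eps w > 0 \<Longrightarrow> sum_list (eup w) = sum_list w + 2"
  using sum_list_fdown [of "eup w"] by (simp add: eup_simps)

text \<open>The action of \<open>E\<close> on the functions of sign words, the coefficients of vectors in a tensor
  product of two-dimensional representations (letters \<open>1\<close> and \<open>-1\<close>) and trivial ones (letter \<open>0\<close>).\<close>

fun word_E :: "(int list \<Rightarrow> qfield) \<Rightarrow> int list \<Rightarrow> qfield" where
  "word_E u [] = 0"
| "word_E u (x # w) = word_E (\<lambda>v. u (x # v)) w
     + (if x = 1 then qq powi (- sum_list w) * u ((-1) # w) else 0)"

text \<open>The coordinates with respect to a basis of strings \<open>b, E b, E\<^bsup>(2)\<^esup> b, \<dots>\<close>, obtained by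
  decomposing \<open>V(1) \<otimes> V(p)\<close> into \<open>V(p + 1)\<close> and \<open>V(p - 1)\<close> repeatedly; \<open>phi w\<close> is the position of
  the basis vector of \<open>w\<close> in its string.\<close>

function (sequential) coord :: "int list \<Rightarrow> (int list \<Rightarrow> qfield) \<Rightarrow> qfield" where
  "coord [] u = u []"
| "coord (x # w) u =
    (if x = -1 then
       inverse qq ^ phi w * qint (Suc (eps w)) / qint (Suc (phi w + eps w)) * coord w (\<lambda>v. u ((-1) # v))
       + qint (phi w) / qint (Suc (phi w + eps w)) * coord (fdown w) (\<lambda>v. u (1 # v))
     else if x = 1 then
       coord w (\<lambda>v. u (1 # v))
       - (if eps w = 0 then 0 else qq ^ eps w * coord (eup w) (\<lambda>v. u ((-1) # v)))
     else coord w (\<lambda>v. u (x # v)))"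
  by pat_completeness auto
termination
  by (relation "Wellfounded.measure (\<lambda>(w, u). length w)") auto

lemma coord_linear: "coord w (\<lambda>v. c * u v + u' v) = c * coord w u + coord w u'"
proof (induction w u arbitrary: u' rule: coord.induct)
  case (2 x w u)
  consider "x = -1" | "x = 1" "eps w = 0" | "x = 1" "eps w \<noteq> 0" | "x \<noteq> 1" "x \<noteq> -1"
    by blast
  then show ?case
  proof cases
    case 1
    define P Q where "P = inverse qq ^ phi w * qint (Suc (eps w)) / qint (Suc (phi w + eps w))"
      and "Q = qint (phi w) / qint (Suc (phi w + eps w))"
    show ?thesis
      unfolding coord.simps P_def [symmetric] Q_def [symmetric] 1
      by (simp add: "2.IH"(1,2) [OF 1]) (simp add: algebra_simps)
  next
    case 2
    then show ?thesis by (simp add: "2.IH"(3))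
  next
    case 3
    then show ?thesis by (simp add: "2.IH"(3,4)) (simp add: algebra_simps)
  next
    case 4
    then show ?thesis by (simp add: "2.IH"(5))
  qed
qed simp

lemma coord_zero [simp]: "coord w (\<lambda>v. 0) = 0"
  using coord_linear [of w 1 "\<lambda>v. 0" "\<lambda>v. 0"] by simp

lemma coord_scale: "coord w (\<lambda>v. c * u v) = c * coord w u"
  using coord_linear [of w c u "\<lambda>v. 0"] by simp

lemma coord_add: "coord w (\<lambda>v. u v + u' v) = coord w u + coord w u'"
  using coord_linear [of w 1 u u'] by simp

lemma coord_sum: "coord w (\<lambda>v. \<Sum>i\<in>I. u i v) = (\<Sum>i\<in>I. coord w (u i))"
  by (induction I rule: infinite_finite_induct) (auto simp: coord_add)

text \<open>The recursion stays among words with the same absolute values and the same sum: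
  \<open>fdown\<close> lowers the sum of the tail by 2 while the head goes from -1 to 1, and
  \<open>eup\<close> does the reverse. Where these operators are meaningless, their coefficient is
  0.\<close>

lemma coord_cong:
  assumes "\<And>v. map abs v = map abs w \<Longrightarrow> sum_list v = sum_list w \<Longrightarrow> u v = u' v"
  shows "coord w u = coord w u'"
  using assms
proof (induction w u arbitrary: u' rule: coord.induct)
  case (2 x w u)
  have 1: "coord w (\<lambda>v. u (x # v)) = coord w (\<lambda>v. u' (x # v))"
  proof -
    consider "x = -1" | "x = 1" | "x \<noteq> 1" "x \<noteq> -1"
      by blast
    then show ?thesis
    proof cases
      case 1
      show ?thesis
        unfolding 1 by (rule "2.IH"(1)) (auto simp: 1 intro!: "2.prems")
    next
      case 2
      show ?thesis
        unfolding 2 by (rule "2.IH"(3)) (auto simp: 2 intro!: "2.prems")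
    next
      case 3
      then show ?thesis
        by (intro "2.IH"(5)) (auto intro!: "2.prems")
    qed
  qed
  have 2: "coord (fdown w) (\<lambda>v. u (1 # v)) = coord (fdown w) (\<lambda>v. u' (1 # v))"
    if "x = -1" "phi w > 0"
    using that by (intro "2.IH"(2)) (auto intro!: "2.prems" simp: abs_fdown sum_list_fdown)
  have 3: "coord (eup w) (\<lambda>v. u ((-1) # v)) = coord (eup w) (\<lambda>v. u' ((-1) # v))"
    if "x = 1" "eps w > 0"
    using that by (intro "2.IH"(4)) (auto intro!: "2.prems" simp: abs_eup sum_list_eup)
  show ?case
    using 1 2 3 by (cases "phi w = 0"; cases "eps w = 0") auto
qed simp

text \<open>E applied to E^(j-1) b is \<open>qint j\<close> times E^(j) b; in coordinates this says
  that \<open>coord\<close> really belongs to a basis of strings. The induction is on the length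
  because \<open>fdown\<close> and \<open>eup\<close> of the tail occur besides the tail
  itself.\<close>

lemma coord_word_E:
  assumes "sign_word w"
  shows "coord w (word_E u) = qint (phi w) * coord (fdown w) u"
  using assms
proof (induction "length w" arbitrary: w u)
  case (Suc k)
  then obtain x w' where w: "w = x # w'" and k: "length w' = k" and sw: "sign_word w'"
    and x: "x = -1 \<or> x = 0 \<or> x = 1"
    by (cases w) auto
  define j e where "j = phi w'" and "e = eps w'"
  have IH: "coord v (word_E u) = qint (phi v) * coord (fdown v) u"
    if "length v = k" "map abs v = map abs w'" for v u
    using Suc.hyps(1) that sw sign_word_abs_cong by blast
  \<comment> \<open>The extra term comes from E acting on the head. Since \<open>coord v\<close>
    only sees words with the sum of \<open>v\<close>, the power of q is constant and can be pulled
    out.\<close>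
  have plus: "coord v (\<lambda>v. word_E u (1 # v))
      = qint (phi v) * coord (fdown v) (\<lambda>v. u (1 # v))
        + inverse qq ^ phi v * qq ^ eps v * coord v (\<lambda>v. u ((-1) # v))"
    if v: "length v = k" "map abs v = map abs w'" for v
  proof -
    have "sign_word v"
      using sign_word_abs_cong [OF v(2)] sw by simp
    then have pow: "qq powi (- sum_list v) = inverse qq ^ phi v * qq ^ eps v"
      by (simp add: sum_list_sign_word power_int_diff power_inverse divide_inverse)
    have "coord v (\<lambda>v. qq powi (- sum_list v) * u ((-1) # v))
        = coord v (\<lambda>v'. qq powi (- sum_list v) * u ((-1) # v'))"
      by (rule coord_cong) simp
    then show ?thesis
      using IH [OF v, of "\<lambda>v. u (1 # v)"] by (simp add: coord_add coord_scale pow)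
  qed
  have minus: "coord v (\<lambda>v. word_E u ((-1) # v)) = qint (phi v) * coord (fdown v) (\<lambda>v. u ((-1) # v))"
    if v: "length v = k" "map abs v = map abs w'" for v
    using IH [OF v, of "\<lambda>v. u ((-1) # v)"] by simp
  note fd = plus [of "fdown w'"] minus [of "fdown w'"] minus [of "eup w'"]
  note fd = fd [unfolded length_fdown length_eup abs_fdown abs_eup, OF k refl]
  show ?case
    using x
  proof (elim disjE)
    assume x: "x = -1"
    show ?thesis
    proof (cases "j = 0")
      case True
      then show ?thesis
        using x by (simp add: w minus [OF k refl] flip: j_def e_def del: word_E.simps)
    next
      case False
      then obtain i where i: "j = Suc i"
        by (cases j) auto
      note fds = fdown_simps [of w', folded j_def e_def, unfolded i, simplified]
      define P where "P = qint (Suc (j + e))"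
      have P: "P \<noteq> 0"
        by (simp add: P_def qint_neq_0)
      define A B where "A = coord (fdown w') (\<lambda>v. u ((-1) # v))"
        and "B = coord (fdown (fdown w')) (\<lambda>v. u (1 # v))"
      have "coord w (word_E u) = inverse qq ^ j * qint (Suc e) / P * (qint j * A)
          + qint j / P * (qint i * B + inverse qq ^ i * qq ^ Suc e * A)"
        using x fds fd(1) by (simp add: w minus [OF k refl] A_def B_def P_def flip: j_def e_def del: word_E.simps)
      also have "\<dots> = qint j * ((inverse qq ^ j * qint (Suc e) + inverse qq ^ i * qq ^ Suc e) / P * A
          + qint i / P * B)"
        by (simp add: algebra_simps add_divide_distrib)
      \<comment> \<open>The two contributions to \<open>A\<close> merge by [e+2] = q^-1 [e+1] +
        q^(e+1) into the coefficient belonging to \<open>fdown w'\<close>, whose \<open>phi\<close>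
        is \<open>i\<close> and whose \<open>eps\<close> is \<open>Suc e\<close>.\<close>
      also have "inverse qq ^ j * qint (Suc e) + inverse qq ^ i * qq ^ Suc e
          = inverse qq ^ i * qint (Suc (Suc e))"
        unfolding qint_Suc' [of "Suc e"] i by (simp add: algebra_simps)
      also have "qint j * (inverse qq ^ i * qint (Suc (Suc e)) / P * A + qint i / P * B)
          = qint (phi w) * coord (fdown w) u"
        using x fds by (simp add: w A_def B_def P_def i flip: j_def e_def)
      finally show ?thesis .
    qed
  next
    assume x: "x = 1"
    define A B where "A = coord w' (\<lambda>v. u ((-1) # v))"
      and "B = coord (fdown w') (\<lambda>v. u (1 # v))"
    show ?thesis
    proof (cases "e = 0")
      case True
      have "coord w (word_E u) = qint j * B + inverse qq ^ j * A"
        using x True plus [OF k refl] by (simp add: w A_def B_def flip: j_def e_def del: word_E.simps)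
      also have "\<dots> = qint (Suc j) *
          (inverse qq ^ j * qint (Suc 0) / qint (Suc j) * A + qint j / qint (Suc j) * B)"
        using qint_neq_0 [of "Suc j"] by (simp add: field_simps qint_Suc [of 0])
      also have "\<dots> = qint (phi w) * coord (fdown w) u"
        using x True by (simp add: w A_def B_def flip: j_def e_def)
      finally show ?thesis .
    next
      case False
      define C where "C = coord (eup w') (\<lambda>v. u ((-1) # v))"
      note eus = eup_simps [of w', folded j_def e_def]
      have "coord w (word_E u) = qint j * B + inverse qq ^ j * qq ^ e * A - qq ^ e * (qint (Suc j) * A)"
        using x False plus [OF k refl] fd(3) eus
        by (simp add: w A_def B_def flip: j_def e_def del: word_E.simps)
      \<comment> \<open>Expanding [j+1] = q [j] + q^-j cancels the middle term. The exponent
        \<open>Suc e\<close> is \<open>eps (fdown w')\<close>, as required by the clause of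
        \<open>coord\<close> for the letter 1.\<close>
      also have "\<dots> = qint j * (B - qq ^ Suc e * A)"
        by (simp add: qint_Suc [of j] algebra_simps)
      also have "\<dots> = qint (phi w) * coord (fdown w) u"
      proof (cases "j = 0")
        case True
        then show ?thesis
          using x False by (simp add: w flip: j_def e_def)
      next
        case False
        note fds = fdown_simps [of w', folded j_def e_def]
        show ?thesis
          using x False \<open>e \<noteq> 0\<close> fds by (simp add: w A_def B_def flip: j_def e_def)
      qed
      finally show ?thesis .
    qed
  next
    assume "x = 0"
    then show ?thesis
      using IH [OF k refl, of "\<lambda>v. u (x # v)"] by (simp add: w)
  qed
qed simp

lemma phi_fdown_funpow: "r \<le> phi w \<Longrightarrow> phi ((fdown ^^ r) w) = phi w - r"
  by (induction r) (auto simp: fdown_simps)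

lemma eps_fdown_funpow: "r \<le> phi w \<Longrightarrow> eps ((fdown ^^ r) w) = eps w + r"
  by (induction r) (auto simp: fdown_simps phi_fdown_funpow)

lemma eup_fdown_funpow: "r \<le> phi w \<Longrightarrow> (eup ^^ r) ((fdown ^^ r) w) = w"
proof (induction r)
  case (Suc r)
  have "(eup ^^ Suc r) ((fdown ^^ Suc r) w) = (eup ^^ r) (eup (fdown ((fdown ^^ r) w)))"
    by (simp add: funpow_swap1)
  also have "\<dots> = w"
    using Suc by (simp add: fdown_simps phi_fdown_funpow)
  finally show ?case .
qed simp

lemma abs_fdown_funpow: "map abs ((fdown ^^ r) w) = map abs w"
  by (induction r) (auto simp: abs_fdown)

lemma coord_word_E_funpow:
  "sign_word w \<Longrightarrow> phi w = r \<Longrightarrow> coord w ((word_E ^^ r) u) = qfact r * coord ((fdown ^^ r) w) u"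
proof (induction r arbitrary: w)
  case (Suc r)
  then have "phi (fdown w) = r" "sign_word (fdown w)"
    using sign_word_abs_cong [OF abs_fdown] by (auto simp: fdown_simps)
  then have "coord (fdown w) ((word_E ^^ r) u) = qfact r * coord ((fdown ^^ r) (fdown w)) u"
    by (intro Suc.IH)
  moreover have "coord w ((word_E ^^ Suc r) u) = qint (phi w) * coord (fdown w) ((word_E ^^ r) u)"
    using Suc.prems by (simp add: coord_word_E)
  ultimately show ?case
    using Suc.prems by (simp add: funpow_swap1)
qed simp

lemma coord_word_E_funpow_eq_0:
  "sign_word w \<Longrightarrow> phi w < r \<Longrightarrow> coord w ((word_E ^^ r) u) = 0"
proof (induction r arbitrary: w)
  case (Suc r)
  show ?case
  proof (cases "phi w = 0")
    case False
    then have "phi (fdown w) < r" "sign_word (fdown w)"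
      using sign_word_abs_cong [OF abs_fdown] Suc by (auto simp: fdown_simps)
    then show ?thesis
      using Suc by (simp add: coord_word_E)
  qed (use Suc in \<open>simp add: coord_word_E\<close>)
qed simp

text \<open>At q = 0 the string basis becomes the basis of words, as for a crystal basis: in each
  clause of \<open>coord\<close> the main coefficient is 1 modulo q, and the correction carries a
  quotient that vanishes at 0 or a positive power of q.\<close>

lemma coord_regular:
  assumes "\<And>v. map abs v = map abs w \<Longrightarrow> u v \<in> regular"
  shows "coord w u - u w \<in> vanishing"
  using assms
proof (induction w u rule: coord.induct)
  case (2 x w u)
  have reg: "coord v (\<lambda>v. u (y # v)) \<in> regular"
    if "coord v (\<lambda>v. u (y # v)) - u (y # v) \<in> vanishing" "map abs v = map abs w" "\<bar>y\<bar> = \<bar>x\<bar>" for v y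
    using regular_add [OF vanishing_imp_regular [OF that(1)], of "u (y # v)"] "2.prems" [of "y # v"] that
    by simp
  consider "x = -1" | "x = 1" | "x \<noteq> 1" "x \<noteq> -1"
    by blast
  then show ?case
  proof cases
    case 1
    have IH: "coord w (\<lambda>v. u ((-1) # v)) - u ((-1) # w) \<in> vanishing"
      "coord (fdown w) (\<lambda>v. u (1 # v)) - u (1 # fdown w) \<in> vanishing"
      using 1 by (auto intro!: "2.IH" "2.prems" simp: abs_fdown)
    define A B c where "A = coord w (\<lambda>v. u ((-1) # v))" and "B = coord (fdown w) (\<lambda>v. u (1 # v))"
      and "c = inverse qq ^ phi w * qint (Suc (eps w)) / qint (Suc (phi w + eps w))"
    have "A \<in> regular" "B \<in> regular"
      using IH 1 by (auto simp: A_def B_def intro!: reg abs_fdown)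
    moreover have "c - 1 \<in> vanishing"
      unfolding c_def by (rule qint_quotient_1)
    ultimately have "(c - 1) * A + (A - u ((-1) # w))
        + qint (phi w) / qint (Suc (phi w + eps w)) * B \<in> vanishing"
      using IH(1) by (intro vanishing_add vanishing_mult_right qint_quotient_2) (auto simp: A_def)
    moreover have "(c - 1) * A + (A - u ((-1) # w)) = c * A - u ((-1) # w)"
      by (simp add: algebra_simps)
    ultimately show ?thesis
      using 1 by (simp add: A_def B_def c_def algebra_simps)
  next
    case 2
    have IH1: "coord w (\<lambda>v. u (1 # v)) - u (1 # w) \<in> vanishing"
      using 2 by (auto intro!: "2.IH"(3) "2.prems")
    show ?thesis
    proof (cases "eps w = 0")
      case False
      have IH2: "coord (eup w) (\<lambda>v. u ((-1) # v)) - u ((-1) # eup w) \<in> vanishing"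
        using 2 False by (auto intro!: "2.IH"(4) "2.prems" simp: abs_eup)
      have "qq ^ eps w * coord (eup w) (\<lambda>v. u ((-1) # v)) \<in> vanishing"
        using False IH2 2 by (intro vanishing_mult_right vanishing_power reg) (auto simp: abs_eup)
      from vanishing_diff [OF IH1 this] show ?thesis
        using 2 False by (simp add: algebra_simps)
    qed (use 2 IH1 in simp)
  next
    case 3
    then show ?thesis
      using "2.IH"(5) "2.prems" by auto
  qed
qed simp

lemma finite_abs_cong: "finite {v :: int list. map abs v = map abs w}"
proof (induction w)
  case (Cons x w)
  have "{v. map abs v = map abs (x # w)} \<subseteq> case_prod (#) ` ({x, -x} \<times> {v. map abs v = map abs w})"
  proof
    fix v assume "v \<in> {v. map abs v = map abs (x # w)}"
    then show "v \<in> case_prod (#) ` ({x, -x} \<times> {v. map abs v = map abs w})"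
      by (cases v) (auto simp: abs_eq_iff image_iff)
  qed
  then show ?case
    by (rule finite_subset) (use Cons in auto)
qed simp

text \<open>The coordinates detect the lattice: multiplying by a power of \<open>q\<close> brings all values into the
  lattice, and \<open>coord_regular\<close> then lowers the power step by step.\<close>

lemma coord_vanishing_imp:
  assumes "\<And>v. map abs v = map abs w \<Longrightarrow> coord v u \<in> vanishing"
  shows "u w \<in> vanishing"
proof -
  let ?W = "{v. map abs v = map abs w}"
  define P where "P s \<longleftrightarrow> (\<forall>v \<in> ?W. qq ^ s * u v \<in> vanishing)" for s
  have "\<forall>v. \<exists>s. qq ^ s * u v \<in> vanishing"
    by (simp add: power_mult_vanishing_ex)
  then obtain s where s: "qq ^ s v * u v \<in> vanishing" for v
    by metis
  \<comment> \<open>The sum dominates each summand and so is one exponent that works for all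
    compatible words at once.\<close>
  have "P (\<Sum>v\<in>?W. s v)"
    unfolding P_def
  proof
    fix v assume "v \<in> ?W"
    then have "(\<Sum>v\<in>?W. s v) = s v + (\<Sum>v\<in>?W - {v}. s v)"
      using finite_abs_cong by (rule sum.remove [rotated])
    then have "qq ^ (\<Sum>v\<in>?W. s v) * u v = qq ^ (\<Sum>v\<in>?W - {v}. s v) * (qq ^ s v * u v)"
      by (simp add: power_add algebra_simps)
    also have "\<dots> \<in> vanishing"
      by (rule vanishing_mult_left [OF regular_power [OF qq_regular] s])
    finally show "qq ^ (\<Sum>v\<in>?W. s v) * u v \<in> vanishing" .
  qed
  have "P s" if "P (Suc s)" for s
    unfolding P_def
  proof
    fix v assume v: "v \<in> ?W"
    have reg: "qq ^ s * u v' \<in> regular" if "v' \<in> ?W" for v'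
      using \<open>P (Suc s)\<close> that by (auto simp: P_def mult.assoc)
    have 1: "coord v (\<lambda>v. qq ^ s * u v) - qq ^ s * u v \<in> vanishing"
      using v reg by (intro coord_regular) auto
    have 2: "coord v (\<lambda>v. qq ^ s * u v) \<in> vanishing"
      using assms v by (simp add: coord_scale)
    show "qq ^ s * u v \<in> vanishing"
      using vanishing_diff [OF 2 1] by simp
  qed
  then have "P s \<Longrightarrow> P 0" for s
    by (induction s) auto
  with \<open>P (\<Sum>v\<in>?W. s v)\<close> have "P 0"
    by blast
  then show ?thesis
    by (simp add: P_def)
qed

section \<open>Powers of E on sign words: integrality and support\<close>

lemma word_E_add: "word_E (\<lambda>v. u v + u' v) w = word_E u w + word_E u' w"
proof (induction u w arbitrary: u' rule: word_E.induct)
  case (2 u x w)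
  show ?case
    by (simp add: "2.IH" [of "\<lambda>v. u' (x # v)"] distrib_left)
qed simp

text \<open>The factor with exponent \<open>- sum_list v\<close> is the action of the inverse of
  K_(a,a+1). E raises the letter sum by 2, so the two commute up to q^2.\<close>

lemma word_E_twist:
  "word_E (\<lambda>v. c * qq powi (s - sum_list v) * u v) w = c * qq powi (s + 2 - sum_list w) * word_E u w"
proof (induction u w arbitrary: s rule: word_E.induct)
  case (2 u x w)
  have "word_E (\<lambda>v. c * qq powi (s - (x + sum_list v)) * u (x # v)) w
      = c * qq powi (s + 2 - (x + sum_list w)) * word_E (\<lambda>v. u (x # v)) w"
    using "2.IH" [of "s - x"] by (simp add: algebra_simps)
  then show ?case
    by (simp add: algebra_simps)
qed simp

text \<open>The quantum binomial formula for the comultiplication of E^r. Since E^2 = 0 on the head,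
  at most one factor E acts there, and summing over which one gives \<open>qint r\<close> times a
  power of q. For \<open>r = 0\<close> the truncated \<open>r - 1\<close> is harmless because
  \<open>qint 0 = 0\<close>.\<close>

lemma word_E_funpow_Cons:
  "(word_E ^^ r) u (x # w) = (word_E ^^ r) (\<lambda>v. u (x # v)) w
     + (if x = 1
        then qint r * qq powi (int r - 1 - sum_list w) * (word_E ^^ (r - 1)) (\<lambda>v. u ((-1) # v)) w
        else 0)"
proof (induction r arbitrary: x w)
  case (Suc r)
  show ?case
  proof (cases "x = 1")
    case True
    have IH: "(\<lambda>v. (word_E ^^ r) u (1 # v)) = (\<lambda>v. (word_E ^^ r) (\<lambda>v. u (1 # v)) v
        + qint r * qq powi (int r - 1 - sum_list v) * (word_E ^^ (r - 1)) (\<lambda>v. u ((-1) # v)) v)"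
      using Suc by simp
    define A S where "A = (word_E ^^ r) (\<lambda>v. u ((-1) # v)) w" and "S = qq powi (- sum_list w)"
    have pow: "qq powi (int r + 1 - sum_list w) = qq * qq ^ r * S"
      "qq powi (int r - sum_list w) = qq ^ r * S" "qq powi (- sum_list w) = S"
      by (simp_all add: S_def power_int_diff power_int_add divide_inverse power_int_minus)
    have twist: "word_E (\<lambda>v. qint r * qq powi (int r - 1 - sum_list v)
        * (word_E ^^ (r - 1)) (\<lambda>v. u ((-1) # v)) v) w = qint r * (qq * qq ^ r * S) * A"
    proof -
      have shift: "int r - 1 + 2 - sum_list w = int r + 1 - sum_list w"
        by simp
      show ?thesis
        unfolding word_E_twist shift pow(1) by (cases r) (simp_all add: A_def)
    qed
    have "(word_E ^^ Suc r) u (1 # w)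
        = (word_E ^^ Suc r) (\<lambda>v. u (1 # v)) w + qint r * (qq * qq ^ r * S) * A + S * A"
      using twist by (simp add: IH word_E_add Suc A_def pow)
    also have "B + qint r * (qq * qq ^ r * S) * A + S * A = B + qint (Suc r) * (qq ^ r * S) * A" for B
      by (simp add: qint_Suc algebra_simps power_inverse)
    finally show ?thesis
      using True by (simp add: A_def add.assoc pow)
  qed (use Suc in simp)
qed simp

text \<open>Divided powers preserve the integral form: the factor \<open>qint r\<close> of the
  second term in \<open>word_E_funpow_Cons\<close> cancels against \<open>qfact r\<close>, leaving
  the divided power of order r - 1.\<close>

lemma word_E_funpow_laurent:
  assumes "\<And>v. map abs v = map abs w \<Longrightarrow> u v \<in> laurent"
  shows "(word_E ^^ r) u w / qfact r \<in> laurent"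
  using assms
proof (induction w arbitrary: u r)
  case Nil
  then show ?case
    by (cases r) auto
next
  case (Cons x w)
  have "(word_E ^^ r) (\<lambda>v. u (x # v)) w / qfact r \<in> laurent"
    by (rule Cons.IH) (auto intro: Cons.prems)
  moreover have "(word_E ^^ s) (\<lambda>v. u ((-1) # v)) w / qfact s \<in> laurent" if "x = 1" for s
    by (rule Cons.IH) (auto intro: Cons.prems simp: that)
  moreover have "(word_E ^^ r) u (1 # w) / qfact r = (word_E ^^ r) (\<lambda>v. u (1 # v)) w / qfact r
      + qq powi (int r - 1 - sum_list w)
        * ((word_E ^^ (r - 1)) (\<lambda>v. u ((-1) # v)) w / qfact (r - 1))" if "r > 0"
    using that unfolding word_E_funpow_Cons
    by (cases r) (simp_all add: add_divide_distrib qint_neq_0)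
  ultimately show ?case
    by (cases "x = 1 \<and> r > 0")
      (auto simp: word_E_funpow_Cons [of _ _ x] simp flip: times_divide_eq_right)
qed

lemma word_E_eq_sum:
  "word_E u w = (\<Sum>k | k < length w \<and> w ! k = 1.
     qq powi (- sum_list (drop (Suc k) w)) * u (w[k := -1]))"
proof (induction u w rule: word_E.induct)
  case (2 u x w)
  have "{k. k < length (x # w) \<and> (x # w) ! k = 1}
      = (if x = 1 then {0} else {}) \<union> Suc ` {k. k < length w \<and> w ! k = 1}"
    by (auto simp: image_iff less_Suc_eq_0_disj)
  then show ?case
    using "2.IH" by (simp add: sum.union_disjoint sum.reindex add.commute)
qed simp

lemma word_E_neq_0:
  assumes "word_E u w \<noteq> 0"
  shows "\<exists>v. map abs v = map abs w \<and> sum_list v = sum_list w - 2 \<and> u v \<noteq> 0"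
proof -
  obtain k where k: "k < length w" "w ! k = 1"
    and "qq powi (- sum_list (drop (Suc k) w)) * u (w[k := -1]) \<noteq> 0"
    using assms unfolding word_E_eq_sum
    by (elim sum.not_neutral_contains_not_neutral) blast
  then have "u (w[k := -1]) \<noteq> 0"
    by simp
  moreover have "map abs (w[k := -1]) = map abs w"
    using k by (auto simp: list_eq_iff_nth_eq nth_list_update)
  ultimately show ?thesis
    using k by (intro exI [of _ "w[k := -1]"]) (simp add: sum_list_list_update_int)
qed

lemma word_E_cong:
  assumes "\<And>v. map abs v = map abs w \<Longrightarrow> u v = u' v"
  shows "word_E u w = word_E u' w"
  using assms
proof (induction u w arbitrary: u' rule: word_E.induct)
  case (2 u x w)
  have "word_E (\<lambda>v. u (x # v)) w = word_E (\<lambda>v. u' (x # v)) w"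
    by (rule "2.IH") (simp add: "2.prems")
  moreover have "x = 1 \<Longrightarrow> u ((-1) # w) = u' ((-1) # w)"
    by (rule "2.prems") simp
  ultimately show ?case
    by simp
qed simp

lemma word_E_funpow_cong:
  assumes "\<And>v. map abs v = map abs w \<Longrightarrow> u v = u' v"
  shows "(word_E ^^ r) u w = (word_E ^^ r) u' w"
  using assms
proof (induction r arbitrary: w)
  case (Suc r)
  have "(word_E ^^ r) u v = (word_E ^^ r) u' v" if "map abs v = map abs w" for v
    by (rule Suc.IH) (simp add: Suc.prems that)
  then show ?case
    by (auto intro: word_E_cong)
qed simp

lemma word_E_funpow_neq_0:
  assumes "(word_E ^^ r) u w \<noteq> 0"
  shows "\<exists>v. map abs v = map abs w \<and> sum_list v = sum_list w - 2 * int r \<and> u v \<noteq> 0"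
  using assms
proof (induction r arbitrary: w)
  case (Suc r)
  then obtain v where v: "map abs v = map abs w" "sum_list v = sum_list w - 2" "(word_E ^^ r) u v \<noteq> 0"
    using word_E_neq_0 [of "(word_E ^^ r) u" w] by auto
  from Suc.IH [OF v(3)] show ?case
    using v by auto
qed auto

lemma phi_le_length: "phi w \<le> length w"
  by (induction w) auto

lemma eps_zeros: "\<forall>l < length w. w ! l = 0 \<Longrightarrow> eps w = 0"
proof (induction w)
  case (Cons x w)
  from Cons.prems have "x = 0" "\<forall>l < length w. w ! l = 0"
    by (auto simp: All_less_Suc2)
  with Cons.IH show ?case by simp
qed simp

text \<open>A letter 1 can only be cancelled by a later -1, and here only zeros follow.\<close>

lemma phi_last_plus:
  assumes "k < length w" "w ! k = 1" "\<And>l. k < l \<Longrightarrow> l < length w \<Longrightarrow> w ! l = 0"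
  shows "phi w > 0"
  using assms
proof (induction w arbitrary: k)
  case (Cons x w)
  show ?case
  proof (cases k)
    case 0
    have "\<forall>l < length w. w ! l = 0"
      using Cons.prems(3) [of "Suc _"] 0 by auto
    then show ?thesis
      using Cons.prems 0 by (simp add: eps_zeros)
  next
    case (Suc k')
    have "phi w > 0"
    proof (rule Cons.IH)
      show "k' < length w" "w ! k' = 1"
        using Cons.prems Suc by auto
      show "w ! l = 0" if "k' < l" "l < length w" for l
        using Cons.prems(3) [of "Suc l"] Suc that by simp
    qed
    then show ?thesis by auto
  qed
qed simp

lemma fdown_le: "i < length w \<Longrightarrow> fdown w ! i \<le> w ! i"
  by (induction w arbitrary: i) (auto simp: nth_Cons split: nat.splits)

lemma length_fdown_funpow [simp]: "length ((fdown ^^ r) w) = length w"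
  by (induction r) auto

lemma fdown_funpow_le: "i < length w \<Longrightarrow> (fdown ^^ r) w ! i \<le> w ! i"
proof (induction r)
  case (Suc r)
  then show ?case
    using fdown_le [of i "(fdown ^^ r) w"] by simp
qed simp


declare gen_tensor.simps [simp del]

locale fock_index =
  fixes ms :: "nat list" and n :: nat
begin

abbreviation "I \<equiv> Imn ms n"
abbreviation "m \<equiv> sum_list ms"
abbreviation "Zp \<equiv> Zmn_plus ms n"

section \<open>Blocks\<close>

text \<open>The single W-factor gets the number after those of the V-factors, so that both sides are
  treated alike and \<open>blk\<close> is monotone on \<open>I\<close>.\<close>

definition blk :: "int \<Rightarrow> nat" where
  "blk i = (if i > 0 then length ms else LEAST k. i < - int m + int (sum_list (take (Suc k) ms)))"

lemma blk_positive: "i > 0 \<Longrightarrow> blk i = length ms"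
  by (simp add: blk_def)

lemma finite_I [simp]: "finite I"
  by (simp add: Imn_def)

lemma zero_notin_I [simp]: "0 \<notin> I"
  by (simp add: Imn_def)

lemma sum_list_take_mono: "k \<le> l \<Longrightarrow> sum_list (take k ms) \<le> sum_list (take l ms)"
proof -
  assume "k \<le> l"
  then have "take l ms = take k ms @ take (l - k) (drop k ms)"
    by (metis le_add_diff_inverse take_add)
  then show ?thesis
    by simp
qed

lemma blk_negative:
  assumes "i \<in> I" "i < 0"
  shows "blk i < length ms" "i < - int m + int (sum_list (take (Suc (blk i)) ms))"
proof -
  let ?P = "\<lambda>k. i < - int m + int (sum_list (take (Suc k) ms))"
  have "ms \<noteq> []"
    using assms by (auto simp: Imn_def)
  then have *: "?P (length ms - 1)"
    using assms by simp
  have blk: "blk i = (LEAST k. ?P k)"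
    using assms by (simp add: blk_def)
  show "?P (blk i)"
    unfolding blk by (rule LeastI) (rule *)
  have "blk i \<le> length ms - 1"
    unfolding blk by (rule Least_le) (rule *)
  then show "blk i < length ms"
    using \<open>ms \<noteq> []\<close> by (cases ms) auto
qed

lemma mem_vblock_iff:
  assumes "k < length ms"
  shows "i \<in> vblock ms k \<longleftrightarrow> i \<in> I \<and> i < 0 \<and> blk i = k"
proof
  assume i: "i \<in> vblock ms k"
  have "sum_list (take (Suc k) ms) \<le> m"
    using sum_list_take_mono [of "Suc k" "length ms"] assms by simp
  then have "i < 0" "- int m \<le> i"
    using i by (auto simp: vblock_def)
  moreover have "(LEAST k. i < - int m + int (sum_list (take (Suc k) ms))) = k"
  proof (rule Least_equality)
    show "i < - int m + int (sum_list (take (Suc k) ms))"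
      using i by (auto simp: vblock_def)
    fix l assume l: "i < - int m + int (sum_list (take (Suc l) ms))"
    show "k \<le> l"
    proof (rule ccontr)
      assume "\<not> k \<le> l"
      then show False
        using sum_list_take_mono [of "Suc l" k] l i by (auto simp: vblock_def)
    qed
  qed
  ultimately show "i \<in> I \<and> i < 0 \<and> blk i = k"
    by (auto simp: Imn_def blk_def)
next
  assume i: "i \<in> I \<and> i < 0 \<and> blk i = k"
  have "- int m + int (sum_list (take k ms)) \<le> i"
  proof (cases k)
    case 0
    then show ?thesis using i by (auto simp: Imn_def)
  next
    case (Suc l)
    have blk: "blk i = (LEAST k. i < - int m + int (sum_list (take (Suc k) ms)))"
      using i by (simp add: blk_def)
    have "l < (LEAST k. i < - int m + int (sum_list (take (Suc k) ms)))"
      using Suc i unfolding blk [symmetric] by simp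
    from not_less_Least [OF this] show ?thesis
      using Suc by simp
  qed
  then show "i \<in> vblock ms k"
    using blk_negative(2) [of i] i by (auto simp: vblock_def)
qed

lemma blk_mono:
  assumes "i \<in> I" "j \<in> I" "i \<le> j"
  shows "blk i \<le> blk j"
proof (cases "j > 0")
  case True
  then show ?thesis
    using blk_negative(1) [of i] assms by (cases "i < 0") (auto simp: blk_positive Imn_def)
next
  case False
  then have "j < 0"
    using assms by (auto simp: Imn_def)
  show ?thesis
    using blk_negative(2) [OF assms(2) \<open>j < 0\<close>] assms \<open>j < 0\<close>
    by (subst blk_def) (auto intro!: Least_le)
qed

lemma blk_eq_imp_same_side: "i \<in> I \<Longrightarrow> j \<in> I \<Longrightarrow> blk i = blk j \<Longrightarrow> i < 0 \<longleftrightarrow> j < 0"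
  by (metis blk_negative(1) blk_positive less_irrefl linorder_neqE zero_notin_I)

lemma adjacent_iff: "adjacent ms n i \<longleftrightarrow> i \<in> I \<and> i + 1 \<in> I \<and> blk i = blk (i + 1)"
proof
  assume "adjacent ms n i"
  then show "i \<in> I \<and> i + 1 \<in> I \<and> blk i = blk (i + 1)"
    unfolding adjacent_def
  proof
    assume "\<exists>k<length ms. {i, i + 1} \<subseteq> vblock ms k"
    then show ?thesis
      by (auto simp: mem_vblock_iff)
  qed (auto simp: Imn_def blk_positive)
next
  assume i: "i \<in> I \<and> i + 1 \<in> I \<and> blk i = blk (i + 1)"
  show "adjacent ms n i"
  proof (cases "i < 0")
    case True
    then have "{i, i + 1} \<subseteq> vblock ms (blk i)"
      using i blk_eq_imp_same_side [of i "i + 1"] blk_negative(1) [of i] by (auto simp: mem_vblock_iff)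
    then show ?thesis
      using blk_negative(1) [of i] i True by (auto simp: adjacent_def)
  qed (use i in \<open>auto simp: adjacent_def Imn_def\<close>)
qed

lemma Zmn_plus_iff:
  "g \<in> Zp \<longleftrightarrow> g \<in> Zmn ms n \<and>
     (\<forall>i\<in>I. \<forall>j\<in>I. i < j \<longrightarrow> blk i = blk j \<longrightarrow> (if i < 0 then g j < g i else g i < g j))"
  (is "_ \<longleftrightarrow> _ \<and> ?R")
proof -
  have "(\<forall>k < length ms. strict_antimono_on (vblock ms k) g) \<and> strict_mono_on {1..int n} g \<longleftrightarrow> ?R"
  proof (intro iffI conjI)
    assume L: "(\<forall>k < length ms. strict_antimono_on (vblock ms k) g) \<and> strict_mono_on {1..int n} g"
    show ?R
    proof (intro ballI impI)
      fix i j assume ij: "i \<in> I" "j \<in> I" "i < j" "blk i = blk j"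
      show "if i < 0 then g j < g i else g i < g j"
      proof (cases "i < 0")
        case True
        then have "i \<in> vblock ms (blk i)" "j \<in> vblock ms (blk i)" "blk i < length ms"
          using ij blk_negative(1) [of i] blk_eq_imp_same_side [of i j] by (auto simp: mem_vblock_iff)
        then show ?thesis
          using L ij True by (auto simp: monotone_on_def)
      next
        case False
        then show ?thesis
          using L ij by (auto simp: monotone_on_def Imn_def)
      qed
    qed
  next
    assume R: ?R
    then show "\<forall>k < length ms. strict_antimono_on (vblock ms k) g"
      by (fastforce simp: monotone_on_def mem_vblock_iff)
    show "strict_mono_on {1..int n} g"
      using R by (auto simp: monotone_on_def Imn_def blk_positive)
  qed
  then show ?thesis
    by (auto simp: Zmn_plus_def)
qed

lemma Zmn_plus_strict:
  "g \<in> Zp \<Longrightarrow> i \<in> I \<Longrightarrow> j \<in> I \<Longrightarrow> i < j \<Longrightarrow> blk i = blk j \<Longrightarrow>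
    if i < 0 then g j < g i else g i < g j"
  by (simp add: Zmn_plus_iff)

lemma Zmn_plus_inj:
  "g \<in> Zp \<Longrightarrow> i \<in> I \<Longrightarrow> j \<in> I \<Longrightarrow> blk i = blk j \<Longrightarrow> g i = g j \<Longrightarrow> i = j"
  unfolding Zmn_plus_iff by (metis less_irrefl linorder_neqE)

section \<open>Coordinates of the classes modulo the wedge relations\<close>

definition inversions :: "(int \<Rightarrow> int) \<Rightarrow> (int \<times> int) set" where
  "inversions g = {(x, y). x \<in> I \<and> y \<in> I \<and> x < y \<and> blk x = blk y \<and>
     (if x < 0 then g x < g y else g y < g x)}"

text \<open>The coefficient of K_f after straightening the pure tensor at g: sorting costs a factor
  -q^-1 per inversion. Comparing images also deals with repeated values of g, because f in
  \<open>Zp\<close> is injective on each block and a repetition makes the image too small.\<close>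

definition block_coeff :: "(int \<Rightarrow> int) \<Rightarrow> (int \<Rightarrow> int) \<Rightarrow> qfield" where
  "block_coeff f g = (if \<forall>i\<in>I. g ` {j \<in> I. blk j = blk i} = f ` {j \<in> I. blk j = blk i}
     then (- inverse qq) ^ card (inversions g) else 0)"

definition tensor_coeff :: "(int \<Rightarrow> int) \<Rightarrow> tensor \<Rightarrow> qfield" where
  "tensor_coeff f x = (\<Sum>g\<in>Poly_Mapping.keys x. Poly_Mapping.lookup x g * block_coeff f g)"

lemma tensor_coeff_superset:
  assumes "finite S" "Poly_Mapping.keys x \<subseteq> S"
  shows "tensor_coeff f x = (\<Sum>g\<in>S. Poly_Mapping.lookup x g * block_coeff f g)"
  unfolding tensor_coeff_def
  by (rule sum.mono_neutral_left) (use assms in \<open>auto simp: in_keys_iff\<close>)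

lemma tensor_coeff_add: "tensor_coeff f (x + y) = tensor_coeff f x + tensor_coeff f y"
proof -
  let ?S = "Poly_Mapping.keys x \<union> Poly_Mapping.keys y"
  have "tensor_coeff f (x + y) = (\<Sum>g\<in>?S. Poly_Mapping.lookup (x + y) g * block_coeff f g)"
    by (rule tensor_coeff_superset) (auto simp: Poly_Mapping.keys_add)
  also have "\<dots> = tensor_coeff f x + tensor_coeff f y"
    by (simp add: tensor_coeff_superset [of ?S] lookup_add algebra_simps sum.distrib)
  finally show ?thesis .
qed

lemma tensor_coeff_single: "tensor_coeff f (Poly_Mapping.single g c) = c * block_coeff f g"
  by (simp add: tensor_coeff_superset [of "{g}"])

lemma tensor_coeff_diff: "tensor_coeff f (x - y) = tensor_coeff f x - tensor_coeff f y"
  using tensor_coeff_add [of f "x - y" y] by simp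

text \<open>The transposition of two neighbours carries the old inversions to inversions and creates
  exactly one new one, (i, i + 1). The resulting factor makes the two terms \<open>c\<close> and
  \<open>c * qq\<close> of a swap relation cancel.\<close>

lemma block_coeff_swap:
  assumes i: "i \<in> I" "i + 1 \<in> I" "blk i = blk (i + 1)"
    and order: "if i < 0 then g (i + 1) < g i else g i < g (i + 1)"
  shows "block_coeff f (swap_at i (i + 1) g) = - inverse qq * block_coeff f g"
proof -
  let ?h = "swap_at i (i + 1) g"
  define t where "t j = (if j = i then i + 1 else if j = i + 1 then i else j)" for j
  have t: "t (t j) = j" "j \<in> I \<Longrightarrow> t j \<in> I" "blk (t j) = blk j" for j
    using i by (auto simp: t_def)
  have h: "?h j = g (t j)" for j
    by (auto simp: swap_at_def t_def)
  have "?h ` {j \<in> I. blk j = k} = g ` {j \<in> I. blk j = k}" for k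
  proof -
    have "t ` {j \<in> I. blk j = k} = {j \<in> I. blk j = k}"
      using t by (auto simp: image_iff) (metis t)
    then show ?thesis
      unfolding h by (metis image_image)
  qed
  moreover have "card (inversions ?h) = Suc (card (inversions g))"
  proof -
    have "finite (inversions g)"
      by (rule finite_subset [of _ "I \<times> I"]) (auto simp: inversions_def)
    have neg: "t j < 0 \<longleftrightarrow> j < 0" if "j \<in> I" for j
      using that i by (auto simp: t_def Imn_def)
    have less: "t x < t y \<longleftrightarrow> x < y" if "(x, y) \<noteq> (i, i + 1)" "(x, y) \<noteq> (i + 1, i)" for x y
      using that by (auto simp: t_def)
    have "inversions ?h = insert (i, i + 1) (map_prod t t ` inversions g)"
    proof (intro set_eqI iffI)
      fix p assume p: "p \<in> inversions ?h"
      obtain x y where xy: "p = (x, y)" by force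
      show "p \<in> insert (i, i + 1) (map_prod t t ` inversions g)"
      proof (cases "p = (i, i + 1)")
        case False
        have "(t x, t y) \<in> inversions g"
          using p xy False t neg less [of x y] by (auto simp: inversions_def h)
        then show ?thesis
          using xy t by (auto simp: image_iff intro!: bexI [of _ "(t x, t y)"])
      qed auto
    next
      fix p assume "p \<in> insert (i, i + 1) (map_prod t t ` inversions g)"
      then consider "p = (i, i + 1)" | x y where "p = (t x, t y)" "(x, y) \<in> inversions g"
        by auto
      then show "p \<in> inversions ?h"
      proof cases
        case 1
        then show ?thesis
          using i order by (auto simp: inversions_def swap_at_def)
      next
        case 2
        moreover have "(x, y) \<noteq> (i, i + 1)" "(x, y) \<noteq> (i + 1, i)"
          using 2 order by (auto simp: inversions_def split: if_splits)
        ultimately show ?thesis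
          using t neg less [of x y] by (auto simp: inversions_def h)
      qed
    qed
    moreover have "(i, i + 1) \<notin> map_prod t t ` inversions g"
    proof
      assume "(i, i + 1) \<in> map_prod t t ` inversions g"
      then obtain x y where "(x, y) \<in> inversions g" "t x = i" "t y = i + 1"
        by auto
      then show False
        by (auto simp: t_def inversions_def split: if_splits)
    qed
    moreover have "inj (map_prod t t)"
      using prod.inj_map [of t t] inj_on_inverseI [of UNIV t t] t(1) by blast
    ultimately show ?thesis
      using \<open>finite (inversions g)\<close> by (simp add: card_image inj_on_subset)
  qed
  ultimately show ?thesis
    by (simp add: block_coeff_def)
qed

text \<open>The functionals descend to the quotient. As they return the coefficients of a
  combination of sorted monomials, they make the description in \<open>wedge\<close> unique.\<close>

lemma tensor_coeff_wedge_relations: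
  assumes "x \<in> wedge_relations ms n" "f \<in> Zp"
  shows "tensor_coeff f x = 0"
  using assms(1)
proof induction
  case zero
  then show ?case by (simp add: tensor_coeff_def)
next
  case (equal x g i c)
  let ?B = "{j \<in> I. blk j = blk i}"
  have i: "i \<in> I" "i + 1 \<in> I" "blk i = blk (i + 1)"
    using equal by (auto simp: adjacent_iff)
  have "g ` ?B \<noteq> f ` ?B"
  proof
    assume eq: "g ` ?B = f ` ?B"
    have "card (f ` ?B) = card ?B"
      by (rule card_image) (use Zmn_plus_inj [OF assms(2)] in \<open>auto simp: inj_on_def\<close>)
    then have "inj_on g ?B"
      by (intro eq_card_imp_inj_on) (simp_all add: eq)
    then show False
      using inj_onD [of g ?B i "i + 1"] i equal(4) by simp
  qed
  then have "block_coeff f g = 0"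
    using i by (auto simp: block_coeff_def)
  then show ?case
    using equal by (simp add: tensor_coeff_add tensor_coeff_single)
next
  case (swap x g i c)
  then have "block_coeff f (swap_at i (i + 1) g) = - inverse qq * block_coeff f g"
    by (intro block_coeff_swap) (auto simp: adjacent_iff)
  then show ?case
    using swap by (simp add: tensor_coeff_add tensor_coeff_single)
qed

lemma block_coeff_Zmn_plus:
  assumes "f \<in> Zp" "g \<in> Zp"
  shows "block_coeff f g = (if g = f then 1 else 0)"
proof -
  have "inversions g = {}"
  proof -
    have "(x, y) \<notin> inversions g" for x y
      using Zmn_plus_strict [OF assms(2), of x y] by (auto simp: inversions_def split: if_splits)
    then show ?thesis
      by auto
  qed
  moreover have "g = f" if eq: "\<forall>i\<in>I. g ` {j \<in> I. blk j = blk i} = f ` {j \<in> I. blk j = blk i}"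
  proof (rule ccontr)
    assume "g \<noteq> f"
    then have "\<exists>i\<in>I. g i \<noteq> f i"
      using assms by (metis Zmn_plus_iff Zmn_def PiE_ext)
    then obtain i where i: "i \<in> I" "g i \<noteq> f i" and min: "\<And>j. j \<in> I \<Longrightarrow> j < i \<Longrightarrow> g j = f j"
    proof -
      define i where "i = Min {i \<in> I. g i \<noteq> f i}"
      have *: "finite {i \<in> I. g i \<noteq> f i}" "{i \<in> I. g i \<noteq> f i} \<noteq> {}"
        using \<open>\<exists>i\<in>I. g i \<noteq> f i\<close> by auto
      have "i \<in> {i \<in> I. g i \<noteq> f i}"
        unfolding i_def by (rule Min_in [OF *])
      moreover have "\<not> j < i" if "j \<in> {i \<in> I. g i \<noteq> f i}" for j
        using Min_le [OF *(1) that] by (simp add: i_def)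
      ultimately show thesis
        using that by blast
    qed
    \<comment> \<open>Stated for an arbitrary pair because f and g enter symmetrically. At the first
      difference \<open>g'\<close> has the value that sorts earlier, so \<open>f'\<close> can take
      it only before \<open>i\<close>; there both agree, and \<open>g'\<close> would repeat
      it.\<close>
    have False if fg: "f' \<in> Zp" "g' \<in> Zp" "if i < 0 then f' i < g' i else g' i < f' i"
      "g' i \<in> f' ` {j \<in> I. blk j = blk i}" "\<And>j. j \<in> I \<Longrightarrow> j < i \<Longrightarrow> g' j = f' j" for f' g'
    proof -
      obtain j where j: "j \<in> I" "blk j = blk i" "g' i = f' j"
        using fg(4) by blast
      have side: "j < 0 \<longleftrightarrow> i < 0"
        using blk_eq_imp_same_side j i by blast
      show False
      proof (cases "j < i")
        case True
        then have "g' j = g' i"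
          using fg(5) j by simp
        then show False
          using Zmn_plus_inj [OF fg(2) j(1) i(1) j(2)] True by simp
      next
        case False
        then consider "j = i" | "i < j" by linarith
        then show False
          using Zmn_plus_strict [OF fg(1), of i j] j i fg(3) side by cases (auto split: if_splits)
      qed
    qed
    note key = this
    have "g i \<in> g ` {j \<in> I. blk j = blk i}" "f i \<in> f ` {j \<in> I. blk j = blk i}"
      using i by blast+
    then have mem: "g i \<in> f ` {j \<in> I. blk j = blk i}" "f i \<in> g ` {j \<in> I. blk j = blk i}"
      using eq i(1) by simp_all
    consider "if i < 0 then f i < g i else g i < f i" | "if i < 0 then g i < f i else f i < g i"
      using i(2) by (cases "i < 0"; cases "f i < g i") auto
    then show False
    proof cases
      case 1
      show False
        by (rule key [OF assms 1 mem(1)]) (rule min)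
    next
      case 2
      show False
        by (rule key [OF assms(2,1) 2 mem(2)]) (rule min [symmetric])
    qed
  qed
  ultimately show ?thesis
    by (auto simp: block_coeff_def)
qed

lemma tensor_coeff_Zmn_plus:
  assumes "f \<in> Zp" "Poly_Mapping.keys y \<subseteq> Zp"
  shows "tensor_coeff f y = Poly_Mapping.lookup y f"
proof -
  have "tensor_coeff f y = (\<Sum>g\<in>Poly_Mapping.keys y. if g = f then Poly_Mapping.lookup y g else 0)"
    unfolding tensor_coeff_def using assms
    by (intro sum.cong) (auto simp: block_coeff_Zmn_plus)
  then show ?thesis
    by (simp add: sum.delta in_keys_iff)
qed

lemma wedge_eqI:
  assumes "Poly_Mapping.keys y \<subseteq> Zp" "x - y \<in> wedge_relations ms n"
  shows "wedge ms n x = y"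
  unfolding wedge_def
proof (rule the_equality)
  fix z assume z: "Poly_Mapping.keys z \<subseteq> Zp \<and> x - z \<in> wedge_relations ms n"
  show "z = y"
  proof (rule poly_mapping_eqI)
    fix f
    show "Poly_Mapping.lookup z f = Poly_Mapping.lookup y f"
    proof (cases "f \<in> Zp")
      case True
      have "tensor_coeff f (x - y) = 0" "tensor_coeff f (x - z) = 0"
        using True assms z by (auto intro: tensor_coeff_wedge_relations)
      then show ?thesis
        using True assms z by (simp add: tensor_coeff_diff tensor_coeff_Zmn_plus)
    next
      case False
      then show ?thesis
        using assms z by (metis in_keys_iff subsetD)
    qed
  qed
qed (use assms in auto)

section \<open>The sign word of a monomial\<close>

abbreviation root_sign :: "int \<Rightarrow> int \<Rightarrow> int \<Rightarrow> int" where
  "root_sign a i b \<equiv> K_exp a i b - K_exp (a + 1) i b"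

definition active :: "int \<Rightarrow> (int \<Rightarrow> int) \<Rightarrow> int \<Rightarrow> bool" where
  "active a g i \<longleftrightarrow> i \<in> I \<and> g i \<in> {a, a + 1} \<and>
     (\<forall>j\<in>I. blk j = blk i \<longrightarrow> g j \<in> {a, a + 1} \<longrightarrow> j = i)"

lemma active_unique:
  "active a g i \<Longrightarrow> j \<in> I \<Longrightarrow> blk j = blk i \<Longrightarrow> g j \<in> {a, a + 1} \<Longrightarrow> j = i"
  unfolding active_def by blast

text \<open>If a block contains both \<open>a\<close> and \<open>a + 1\<close>, its wedge spans a trivial representation; its
  letters are \<open>0\<close>.\<close>

definition letter :: "int \<Rightarrow> (int \<Rightarrow> int) \<Rightarrow> int \<Rightarrow> int" where
  "letter a g i = (if active a g i then root_sign a i (g i) else 0)"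

text \<open>List positions are matched with indices in \<open>I\<close>, which skips 0; hence the
  shift by one in the second half.\<close>

definition pos :: "nat \<Rightarrow> int" where
  "pos k = (if k < m then int k - int m else int k - int m + 1)"

definition idx :: "int \<Rightarrow> nat" where
  "idx i = nat (if i < 0 then i + int m else i + int m - 1)"

definition word :: "int \<Rightarrow> (int \<Rightarrow> int) \<Rightarrow> int list" where
  "word a g = map (\<lambda>k. letter a g (pos k)) [0..<m + n]"

text \<open>Inverse to \<open>word\<close> for a fixed pattern of zero letters. W is dual to V, so
  the letter 1 stands for a at negative and for a + 1 at positive indices.\<close>

definition relabel :: "int \<Rightarrow> (int \<Rightarrow> int) \<Rightarrow> int list \<Rightarrow> int \<Rightarrow> int" where
  "relabel a g v = (\<lambda>i. if i \<in> I \<and> v ! idx i \<noteq> 0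
     then (if (v ! idx i = 1) = (i < 0) then a else a + 1) else g i)"

lemma pos_mem [simp]: "k < m + n \<Longrightarrow> pos k \<in> I"
  by (auto simp: pos_def Imn_def)

lemma idx_pos [simp]: "k < m + n \<Longrightarrow> idx (pos k) = k"
  by (auto simp: pos_def idx_def)

lemma pos_idx [simp]: "i \<in> I \<Longrightarrow> pos (idx i) = i"
  by (auto simp: pos_def idx_def Imn_def)

lemma idx_less [simp]: "i \<in> I \<Longrightarrow> idx i < m + n"
  by (auto simp: idx_def Imn_def)

lemma pos_less_iff: "k < m + n \<Longrightarrow> l < m + n \<Longrightarrow> pos k < pos l \<longleftrightarrow> k < l"
  by (auto simp: pos_def)

lemma length_word [simp]: "length (word a g) = m + n"
  by (simp add: word_def)

lemma word_nth: "k < m + n \<Longrightarrow> word a g ! k = letter a g (pos k)"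
  by (simp add: word_def)

lemma word_idx [simp]: "i \<in> I \<Longrightarrow> word a g ! idx i = letter a g i"
  by (simp add: word_nth)

lemma root_sign_cases:
  "root_sign a i b = (if b = a then (if i < 0 then 1 else -1)
     else if b = a + 1 then (if i < 0 then -1 else 1) else 0)"
  by (auto simp: K_exp_def delta_def)

lemma letter_range: "letter a g i \<in> {-1, 0, 1}"
  by (auto simp: letter_def root_sign_cases)

lemma letter_neq_0_iff: "letter a g i \<noteq> 0 \<longleftrightarrow> active a g i"
  by (auto simp: letter_def root_sign_cases active_def)

lemma sign_word_word [simp]: "sign_word (word a g)"
  using letter_range by (auto simp: sign_word_def word_def)

lemma relabel_word: "relabel a g (word a g) = g"
  by (auto simp: relabel_def fun_eq_iff letter_neq_0_iff letter_def root_sign_cases active_def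
      split: if_splits)

context
  fixes a :: int and g :: "int \<Rightarrow> int" and v :: "int list"
  assumes g: "g \<in> Zp" and v: "map abs v = map abs (word a g)"
begin

lemma length_compatible: "length v = m + n"
  using arg_cong [OF v, of length] by simp

lemma compatible_nth: "i \<in> I \<Longrightarrow> \<bar>v ! idx i\<bar> = \<bar>letter a g i\<bar>"
  using arg_cong [OF v, of "\<lambda>w. w ! idx i"] by (simp add: length_compatible)

lemma compatible_nth_cases:
  "i \<in> I \<Longrightarrow> active a g i \<and> (v ! idx i = 1 \<or> v ! idx i = -1) \<or> \<not> active a g i \<and> v ! idx i = 0"
  using compatible_nth [of i] letter_range [of a g i] letter_neq_0_iff [of a g i] by auto

lemma relabel_inactive: "\<not> active a g i \<Longrightarrow> relabel a g v i = g i"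
  using compatible_nth_cases [of i] by (auto simp: relabel_def)

lemma relabel_active:
  "active a g i \<Longrightarrow> relabel a g v i = (if (v ! idx i = 1) = (i < 0) then a else a + 1)"
  using compatible_nth_cases [of i] by (auto simp: relabel_def active_def)

lemma relabel_mem_iff: "relabel a g v i \<in> {a, a + 1} \<longleftrightarrow> g i \<in> {a, a + 1}"
  using relabel_active [of i] relabel_inactive [of i] by (cases "active a g i") (auto simp: active_def)

lemma active_relabel: "active a (relabel a g v) i \<longleftrightarrow> active a g i"
  unfolding active_def relabel_mem_iff ..

text \<open>No other entry in the block of an active index lies in {a, a + 1}, so exchanging a and a
  + 1 there passes no other entry.\<close>

lemma relabel_Zmn_plus: "relabel a g v \<in> Zp"
  unfolding Zmn_plus_iff
proof (intro conjI ballI impI)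
  show "relabel a g v \<in> Zmn ms n"
    using g by (auto simp: relabel_def Zmn_plus_iff Zmn_def PiE_iff extensional_def)
  fix i j assume ij: "i \<in> I" "j \<in> I" "i < j" "blk i = blk j"
  note strict = Zmn_plus_strict [OF g ij]
  consider "\<not> active a g i" "\<not> active a g j" | "active a g i" "g j \<notin> {a, a + 1}"
    | "active a g j" "g i \<notin> {a, a + 1}"
    using ij active_unique [of a g i j] active_unique [of a g j i] by force
  then show "if i < 0 then relabel a g v j < relabel a g v i else relabel a g v i < relabel a g v j"
  proof cases
    case 1
    then show ?thesis using strict by (simp add: relabel_inactive)
  next
    case 2
    then have "relabel a g v j = g j" "relabel a g v i \<in> {a, a + 1}" "g i \<in> {a, a + 1}"
      using relabel_inactive [of j] relabel_mem_iff [of i] by (auto simp: active_def)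
    then show ?thesis using strict 2 by (auto split: if_splits)
  next
    case 3
    then have "relabel a g v i = g i" "relabel a g v j \<in> {a, a + 1}" "g j \<in> {a, a + 1}"
      using relabel_inactive [of i] relabel_mem_iff [of j] by (auto simp: active_def)
    then show ?thesis using strict 3 by (auto split: if_splits)
  qed
qed

lemma letter_relabel: "i \<in> I \<Longrightarrow> letter a (relabel a g v) i = v ! idx i"
  using compatible_nth_cases [of i]
  by (auto simp: letter_def active_relabel relabel_active root_sign_cases)

lemma word_relabel: "word a (relabel a g v) = v"
  by (rule nth_equalityI) (simp_all add: length_compatible word_nth letter_relabel)

lemma relabel_relabel:
  assumes "map abs v' = map abs (word a g)"
  shows "relabel a (relabel a g v) v' = relabel a g v'"
proof
  fix i
  have "\<bar>v' ! idx i\<bar> = \<bar>v ! idx i\<bar>" if "i \<in> I"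
    using arg_cong [OF trans [OF assms v [symmetric]], of "\<lambda>w. w ! idx i"] that
      arg_cong [OF assms, of length] by (simp add: length_compatible)
  then have "v' ! idx i = 0 \<Longrightarrow> i \<in> I \<Longrightarrow> v ! idx i = 0"
    by simp
  then show "relabel a (relabel a g v) v' i = relabel a g v' i"
    by (auto simp: relabel_def)
qed

end

lemma relabel_update:
  assumes "g \<in> Zp" "i \<in> I" "letter a g i = 1"
  shows "relabel a g ((word a g)[idx i := -1]) = g(i := 2 * a + 1 - g i)"
proof
  fix j
  have "idx j = idx i \<longleftrightarrow> j = i" if "j \<in> I"
    using that assms by (metis pos_idx)
  moreover have "relabel a g (word a g) j = g j"
    by (simp add: relabel_word)
  ultimately show "relabel a g ((word a g)[idx i := -1]) j = (g(i := 2 * a + 1 - g i)) j"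
    using assms by (cases "j = i") (auto simp: relabel_def letter_def root_sign_cases split: if_splits)
qed

section \<open>Weights\<close>

definition wt :: "int \<Rightarrow> (int \<Rightarrow> int) \<Rightarrow> int" where
  "wt c g = (\<Sum>i\<in>I. K_exp c i (g i))"

text \<open>The two entries \<open>a\<close> and \<open>a + 1\<close> of a block that contains both cancel.\<close>

lemma sum_root_sign:
  assumes g: "g \<in> Zp" and J: "J \<subseteq> I"
    and closed: "\<And>i j. i \<in> J \<Longrightarrow> g i \<in> {a, a + 1} \<Longrightarrow> j \<in> I \<Longrightarrow> blk j = blk i \<Longrightarrow> j \<in> J"
  shows "(\<Sum>i\<in>J. root_sign a i (g i)) = (\<Sum>i\<in>J. letter a g i)"
proof -
  define S where "S = {i \<in> J. g i \<in> {a, a + 1} \<and> \<not> active a g i}"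
  have fin: "finite J"
    using J by (rule finite_subset) simp
  have "\<exists>j. j \<in> S \<and> blk j = blk i \<and> g j = 2 * a + 1 - g i" if i: "i \<in> S" for i
  proof -
    obtain j where j: "j \<in> I" "blk j = blk i" "g j \<in> {a, a + 1}" "j \<noteq> i"
      using i J by (auto simp: S_def active_def)
    have "g j \<noteq> g i"
      using Zmn_plus_inj [OF g, of j i] j i J by (auto simp: S_def)
    then have "g j = 2 * a + 1 - g i"
      using j i by (auto simp: S_def)
    moreover have "j \<in> J" "\<not> active a g j"
      using closed [of i j] i j J by (auto simp: S_def active_def)
    ultimately show ?thesis
      using j by (auto simp: S_def)
  qed
  then obtain p where p: "\<And>i. i \<in> S \<Longrightarrow> p i \<in> S \<and> blk (p i) = blk i \<and> g (p i) = 2 * a + 1 - g i"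
    by metis
  have pp: "p (p i) = i" if "i \<in> S" for i
  proof (rule Zmn_plus_inj [OF g])
    show "p (p i) \<in> I" "i \<in> I" "blk (p (p i)) = blk i" "g (p (p i)) = g i"
      using p [OF that] p [of "p i"] that J by (auto simp: S_def)
  qed
  have neg: "root_sign a (p i) (g (p i)) = - root_sign a i (g i)" if "i \<in> S" for i
    using p [OF that] blk_eq_imp_same_side [of "p i" i] that J by (auto simp: root_sign_cases S_def)
  have "(\<Sum>i\<in>S. root_sign a i (g i)) = (\<Sum>i\<in>S. - root_sign a i (g i))"
    by (rule sum.reindex_bij_witness [of _ p p]) (use p pp neg in auto)
  then have "(\<Sum>i\<in>S. root_sign a i (g i)) = 0"
    by (simp only: sum_negf)
  moreover have "(\<Sum>i\<in>J. root_sign a i (g i)) = (\<Sum>i\<in>J - S. root_sign a i (g i)) + (\<Sum>i\<in>S. root_sign a i (g i))"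
    by (rule sum.subset_diff) (use fin in \<open>auto simp: S_def\<close>)
  moreover have "(\<Sum>i\<in>J. letter a g i) = (\<Sum>i\<in>J - S. letter a g i) + (\<Sum>i\<in>S. letter a g i)"
    by (rule sum.subset_diff) (use fin in \<open>auto simp: S_def\<close>)
  moreover have "(\<Sum>i\<in>J - S. root_sign a i (g i)) = (\<Sum>i\<in>J - S. letter a g i)"
    by (rule sum.cong) (auto simp: S_def letter_def root_sign_cases)
  moreover have "(\<Sum>i\<in>S. letter a g i) = 0"
    by (rule sum.neutral) (auto simp: S_def letter_def)
  ultimately show ?thesis
    by simp
qed

lemma sum_list_word_tail:
  assumes "k \<le> m + n"
  shows "sum_list (drop k (word a g)) = (\<Sum>i\<in>{i \<in> I. k \<le> idx i}. letter a g i)"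
proof -
  have "sum_list (drop k (word a g)) = (\<Sum>l\<in>{k..<m + n}. letter a g (pos l))"
    by (simp add: word_def drop_map interv_sum_list_conv_sum_set_nat)
  also have "\<dots> = (\<Sum>i\<in>{i \<in> I. k \<le> idx i}. letter a g i)"
    by (rule sum.reindex_bij_witness [of _ idx pos]) auto
  finally show ?thesis .
qed

lemma sum_list_word:
  assumes "g \<in> Zp"
  shows "sum_list (word a g) = wt a g - wt (a + 1) g"
  using sum_list_word_tail [of 0 a g] sum_root_sign [OF assms, of I a]
  by (simp add: wt_def sum_subtractf)

text \<open>The coproduct involves all weights to the right of i, whereas the word omits paired
  entries. Blocks are intervals and the block of an active i contains no pair, so both entries of a
  pair lie on the same side of i and their signs cancel.\<close>

lemma sum_list_word_after:
  assumes "g \<in> Zp" "active a g i"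
  shows "sum_list (drop (Suc (idx i)) (word a g))
    = (\<Sum>j\<in>{j \<in> I. i < j}. root_sign a j (g j))"
proof -
  have i: "i \<in> I"
    using assms by (simp add: active_def)
  have "{j \<in> I. Suc (idx i) \<le> idx j} = {j \<in> I. i < j}"
    using i pos_less_iff [of "idx i"] by (auto simp: Suc_le_eq) (metis idx_less pos_idx)+
  moreover have "Suc (idx i) \<le> m + n"
    using idx_less [OF i] by simp
  moreover have "(\<Sum>j\<in>{j \<in> I. i < j}. root_sign a j (g j)) = (\<Sum>j\<in>{j \<in> I. i < j}. letter a g j)"
  proof (rule sum_root_sign [OF assms(1)])
    fix j j' assume j: "j \<in> {j \<in> I. i < j}" "g j \<in> {a, a + 1}" "j' \<in> I" "blk j' = blk j"
    have "blk j \<noteq> blk i"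
      using assms(2) j by (auto simp: active_def)
    then show "j' \<in> {j \<in> I. i < j}"
      using blk_mono [of i j] blk_mono [of j' i] i j by (cases "i < j'") auto
  qed auto
  ultimately show ?thesis
    using sum_list_word_tail [of "Suc (idx i)" a g] by simp
qed

section \<open>The action of \<open>E\<close>\<close>

text \<open>Vectors are coefficient functions, so the value at g collects the coefficients of the
  monomials that E_a sends to g. All of these are relabellings of g, which reduces the action to
  sign words.\<close>

definition fock_E :: "int \<Rightarrow> fock \<Rightarrow> fock" where
  "fock_E a u g = (if g \<in> Zp then word_E (\<lambda>v. u (relabel a g v)) (word a g) else 0)"

lemma fock_E_eq_sum:
  assumes "g \<in> Zp"
  shows "fock_E a u g = (\<Sum>i | i \<in> I \<and> letter a g i = 1.
    qq powi (\<Sum>j\<in>{j \<in> I. i < j}. K_exp (a + 1) j (g j) - K_exp a j (g j))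
      * u (g(i := 2 * a + 1 - g i)))"
proof -
  have "fock_E a u g = (\<Sum>k | k < length (word a g) \<and> word a g ! k = 1.
      qq powi (- sum_list (drop (Suc k) (word a g))) * u (relabel a g ((word a g)[k := -1])))"
    using assms by (simp add: fock_E_def word_E_eq_sum)
  also have "\<dots> = (\<Sum>i | i \<in> I \<and> letter a g i = 1.
      qq powi (- sum_list (drop (Suc (idx i)) (word a g)))
        * u (relabel a g ((word a g)[idx i := -1])))"
    by (rule sum.reindex_bij_witness [of _ idx pos]) (auto simp: word_nth)
  also have "\<dots> = (\<Sum>i | i \<in> I \<and> letter a g i = 1.
    qq powi (\<Sum>j\<in>{j \<in> I. i < j}. K_exp (a + 1) j (g j) - K_exp a j (g j))
      * u (g(i := 2 * a + 1 - g i)))"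
  proof (rule sum.cong [OF refl])
    fix i assume i: "i \<in> {i. i \<in> I \<and> letter a g i = 1}"
    then have "active a g i"
      using letter_neq_0_iff [of a g i] by simp
    from sum_list_word_after [OF assms this]
    show "qq powi (- sum_list (drop (Suc (idx i)) (word a g)))
        * u (relabel a g ((word a g)[idx i := -1]))
      = qq powi (\<Sum>j\<in>{j \<in> I. i < j}. K_exp (a + 1) j (g j) - K_exp a j (g j))
        * u (g(i := 2 * a + 1 - g i))"
      using relabel_update [OF assms, of i a] i by (simp flip: sum_negf)
  qed
  finally show ?thesis .
qed

lemma wedge_relations_sum:
  assumes "finite A" "\<And>i. i \<in> A \<Longrightarrow> g i \<in> Zmn ms n \<and> (\<exists>j. adjacent ms n j \<and> g i j = g i (j + 1))"
  shows "(\<Sum>i\<in>A. Poly_Mapping.single (g i) (c i)) \<in> wedge_relations ms n"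
  using assms
proof (induction A rule: finite_induct)
  case empty
  then show ?case by (simp add: wedge_relations.zero)
next
  case (insert i A)
  then obtain j where "adjacent ms n j" "g i j = g i (j + 1)"
    by auto
  with insert show ?case
    by (auto intro: wedge_relations.equal)
qed

text \<open>In a strictly ordered block, a and a + 1 are neighbours. Turning one into the other
  gives equal neighbours, so the wedge vanishes.\<close>

lemma inactive_flip_adjacent:
  assumes f: "f \<in> Zp" and i: "i \<in> I" "f i \<in> {a, a + 1}" "\<not> active a f i"
  shows "\<exists>j. adjacent ms n j \<and> (f(i := 2 * a + 1 - f i)) j = (f(i := 2 * a + 1 - f i)) (j + 1)"
proof -
  obtain j where j: "j \<in> I" "blk j = blk i" "f j \<in> {a, a + 1}" "j \<noteq> i"
    using i by (auto simp: active_def)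
  then have fj: "f j = 2 * a + 1 - f i"
    using i Zmn_plus_inj [OF f, of j i] by auto
  have adj: "y = x + 1"
    if xy: "x \<in> I" "y \<in> I" "blk x = blk y" "x < y" "f x \<in> {a, a + 1}" "f y \<in> {a, a + 1}" for x y
  proof (rule ccontr)
    assume "y \<noteq> x + 1"
    then have z: "x + 1 \<in> I" "x < x + 1" "x + 1 < y"
      using xy blk_eq_imp_same_side [of x y] by (auto simp: Imn_def)
    then have "blk x = blk (x + 1)"
      using xy blk_mono [of x "x + 1"] blk_mono [of "x + 1" y] by simp
    then show False
      using Zmn_plus_strict [OF f xy(1) z(1)] Zmn_plus_strict [OF f z(1) xy(2)] xy z
        blk_eq_imp_same_side [of x "x + 1"] by (auto split: if_splits)
  qed
  show ?thesis
  proof (cases "i < j")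
    case True
    then have "j = i + 1"
      using adj [of i j] i j by simp
    then show ?thesis
      using i j fj by (intro exI [of _ i]) (auto simp: adjacent_iff)
  next
    case False
    then have "i = j + 1"
      using adj [of j i] i j by simp
    then show ?thesis
      using i j fj by (intro exI [of _ j]) (auto simp: adjacent_iff)
  qed
qed

lemma active_flip:
  assumes f: "f \<in> Zp" and i: "active a f i"
  shows "f(i := 2 * a + 1 - f i) \<in> Zp"
    and "letter a (f(i := 2 * a + 1 - f i)) i = - root_sign a i (f i)"
proof -
  let ?v = "(word a f)[idx i := - letter a f i]"
  have iI: "i \<in> I" and fi: "f i \<in> {a, a + 1}"
    using i by (auto simp: active_def)
  have v: "map abs ?v = map abs (word a f)"
    using iI by (auto simp: map_update list_eq_iff_nth_eq nth_list_update)
  have eq: "relabel a f ?v = f(i := 2 * a + 1 - f i)"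
  proof
    fix j
    have "idx j = idx i \<longleftrightarrow> j = i" if "j \<in> I"
      using that iI by (metis pos_idx)
    moreover have "relabel a f (word a f) j = f j"
      by (simp add: relabel_word)
    ultimately show "relabel a f ?v j = (f(i := 2 * a + 1 - f i)) j"
      using iI i fi
      by (cases "j = i") (auto simp: relabel_def letter_def root_sign_cases split: if_splits)
  qed
  show "f(i := 2 * a + 1 - f i) \<in> Zp"
    using relabel_Zmn_plus [OF f v] by (simp add: eq)
  show "letter a (f(i := 2 * a + 1 - f i)) i = - root_sign a i (f i)"
    using letter_relabel [OF f v iI] i iI unfolding eq by (simp add: letter_def [of a f])
qed

definition E_coeff :: "int \<Rightarrow> (int \<Rightarrow> int) \<Rightarrow> int \<Rightarrow> qfield" where
  "E_coeff a f i = qq powi (\<Sum>j\<in>{j \<in> I. i < j}. K_exp (a + 1) j (f j) - K_exp a j (f j))"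

text \<open>Terms at active indices are already sorted monomials and those at inactive indices are
  zero in the quotient, so no straightening is required.\<close>

lemma wedge_gen_tensor_E:
  assumes f: "f \<in> Zp"
  shows "wedge ms n (gen_tensor ms n (UE a) f)
    = (\<Sum>i | active a f i \<and> root_sign a i (f i) = -1.
        Poly_Mapping.single (f(i := 2 * a + 1 - f i)) (E_coeff a f i))"
proof (rule wedge_eqI)
  let ?A = "{i. active a f i \<and> root_sign a i (f i) = -1}"
  let ?B = "{i \<in> I. f i \<in> {a, a + 1} \<and> root_sign a i (f i) = -1}"
  let ?s = "\<lambda>i. Poly_Mapping.single (f(i := 2 * a + 1 - f i)) (E_coeff a f i)"
  show "Poly_Mapping.keys (\<Sum>i\<in>?A. ?s i) \<subseteq> Zp"
  proof (rule order_trans [OF Poly_Mapping.keys_sum])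
    show "(\<Union>i\<in>?A. Poly_Mapping.keys (?s i)) \<subseteq> Zp"
      using active_flip(1) [OF f] by (auto split: if_splits)
  qed
  have "gen_tensor ms n (UE a) f = (\<Sum>i\<in>I. if i \<in> ?B then ?s i else 0)"
    unfolding gen_tensor.simps(1)
  proof (rule sum.cong [OF refl])
    fix i assume "i \<in> I"
    then show "(case E_factor a i (f i) of None \<Rightarrow> 0 | Some c \<Rightarrow> Poly_Mapping.single (f(i := c))
        (qq powi (\<Sum>j\<in>{j \<in> I. i < j}. K_exp (a + 1) j (f j) - K_exp a j (f j))))
      = (if i \<in> ?B then ?s i else 0)"
      by (auto simp: E_factor_def E_coeff_def root_sign_cases)
  qed
  also have "\<dots> = (\<Sum>i\<in>?B. ?s i)"
    by (simp add: sum.inter_filter [symmetric] flip: sum.inter_restrict)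
  also have "\<dots> = (\<Sum>i\<in>?B - ?A. ?s i) + (\<Sum>i\<in>?A. ?s i)"
    by (rule sum.subset_diff) (auto simp: active_def)
  finally have "gen_tensor ms n (UE a) f - (\<Sum>i\<in>?A. ?s i) = (\<Sum>i\<in>?B - ?A. ?s i)"
    by simp
  also have "\<dots> \<in> wedge_relations ms n"
  proof (rule wedge_relations_sum)
    fix i assume i: "i \<in> ?B - ?A"
    then have "f(i := 2 * a + 1 - f i) \<in> Zmn ms n"
      using f by (auto simp: Zmn_plus_iff Zmn_def PiE_iff extensional_def)
    moreover have "i \<in> I" "f i \<in> {a, a + 1}" "\<not> active a f i"
      using i by auto
    ultimately show "f(i := 2 * a + 1 - f i) \<in> Zmn ms n \<and>
        (\<exists>j. adjacent ms n j \<and> (f(i := 2 * a + 1 - f i)) j = (f(i := 2 * a + 1 - f i)) (j + 1))"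
      using inactive_flip_adjacent [OF f] by blast
  qed auto
  finally show "gen_tensor ms n (UE a) f - (\<Sum>i\<in>?A. ?s i) \<in> wedge_relations ms n" .
qed

text \<open>The same formula indexed by the target g. The flip is an involution, and
  \<open>E_coeff\<close> looks only to the right of i, so it may be evaluated at g.\<close>

lemma lookup_wedge_gen_tensor_E:
  assumes f: "f \<in> Zp"
  shows "Poly_Mapping.lookup (wedge ms n (gen_tensor ms n (UE a) f)) g
    = (\<Sum>i\<in>I. if g \<in> Zp \<and> letter a g i = 1 \<and> f = g(i := 2 * a + 1 - g i) then E_coeff a g i else 0)"
proof -
  have coeff: "E_coeff a (f(i := x)) i = E_coeff a f i" for f i x
    unfolding E_coeff_def by (rule arg_cong [where f = "\<lambda>s. qq powi s"]) (rule sum.cong, auto)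
  have "Poly_Mapping.lookup (wedge ms n (gen_tensor ms n (UE a) f)) g
    = (\<Sum>i | active a f i \<and> root_sign a i (f i) = -1.
        if f(i := 2 * a + 1 - f i) = g then E_coeff a f i else 0)"
    by (simp add: wedge_gen_tensor_E [OF f] lookup_sum lookup_single when_def)
  also have "\<dots> = (\<Sum>i\<in>I. if active a f i \<and> root_sign a i (f i) = -1 \<and> f(i := 2 * a + 1 - f i) = g
      then E_coeff a f i else 0)"
    by (rule sum.mono_neutral_cong_left) (auto simp: active_def)
  also have "\<dots> = (\<Sum>i\<in>I. if g \<in> Zp \<and> letter a g i = 1 \<and> f = g(i := 2 * a + 1 - g i) then E_coeff a g i else 0)"
  proof (rule sum.cong [OF refl])
    fix i assume "i \<in> I"
    have "(active a f i \<and> root_sign a i (f i) = -1 \<and> f(i := 2 * a + 1 - f i) = g)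
      \<longleftrightarrow> (g \<in> Zp \<and> letter a g i = 1 \<and> f = g(i := 2 * a + 1 - g i))"
    proof
      assume *: "active a f i \<and> root_sign a i (f i) = -1 \<and> f(i := 2 * a + 1 - f i) = g"
      then have g: "g = f(i := 2 * a + 1 - f i)"
        and "active a f i" "root_sign a i (f i) = -1"
        by simp_all
      then show "g \<in> Zp \<and> letter a g i = 1 \<and> f = g(i := 2 * a + 1 - g i)"
        unfolding g using active_flip [OF f, of a i] by simp
    next
      assume *: "g \<in> Zp \<and> letter a g i = 1 \<and> f = g(i := 2 * a + 1 - g i)"
      then have act: "active a g i" and rs: "root_sign a i (g i) = 1"
        by (auto simp: letter_def split: if_splits)
      from * have f': "f = g(i := 2 * a + 1 - g i)" and gZ: "g \<in> Zp"
        by simp_all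
      have "letter a f i = -1"
        unfolding f' using active_flip(2) [OF gZ act] rs by simp
      then have "active a f i \<and> root_sign a i (f i) = -1"
        unfolding letter_def [of a f] by (simp split: if_splits)
      moreover have "f(i := 2 * a + 1 - f i) = g"
        unfolding f' by simp
      ultimately show "active a f i \<and> root_sign a i (f i) = -1 \<and> f(i := 2 * a + 1 - f i) = g"
        by simp
    qed
    then show "(if active a f i \<and> root_sign a i (f i) = -1 \<and> f(i := 2 * a + 1 - f i) = g
        then E_coeff a f i else 0)
      = (if g \<in> Zp \<and> letter a g i = 1 \<and> f = g(i := 2 * a + 1 - g i) then E_coeff a g i else 0)"
      using coeff by (metis (full_types))
  qed
  finally show ?thesis .
qed

lemma gen_act_E:
  assumes "\<And>f. u f \<noteq> 0 \<Longrightarrow> f \<in> Zp"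
  shows "gen_act ms n (UE a) u = fock_E a u"
proof
  fix g
  let ?c = "\<lambda>f. Poly_Mapping.lookup (wedge ms n (gen_tensor ms n (UE a) f)) g"
  let ?J = "{i. i \<in> I \<and> letter a g i = 1}"
  let ?flip = "\<lambda>i. g(i := 2 * a + 1 - g i)"
  let ?S = "{f \<in> Zp. u f \<noteq> 0 \<and> ?c f \<noteq> 0}"
  show "gen_act ms n (UE a) u g = fock_E a u g"
  proof (cases "g \<in> Zp")
    case False
    then have "?c f = 0" if "f \<in> Zp" for f
      using that by (simp add: lookup_wedge_gen_tensor_E)
    then show ?thesis
      using False by (simp add: gen_act_def fock_E_def)
  next
    case True
    have c: "?c f = (\<Sum>i\<in>?J. if f = ?flip i then E_coeff a g i else 0)" if "f \<in> Zp" for f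
      unfolding lookup_wedge_gen_tensor_E [OF that] using True
      by (intro sum.mono_neutral_cong_right) auto
    have sub: "?S \<subseteq> ?flip ` ?J"
    proof
      fix f assume "f \<in> ?S"
      then have "(\<Sum>i\<in>?J. if f = ?flip i then E_coeff a g i else 0) \<noteq> 0"
        using c by auto
      then obtain i where "i \<in> ?J" "(if f = ?flip i then E_coeff a g i else 0) \<noteq> 0"
        by (rule sum.not_neutral_contains_not_neutral)
      then show "f \<in> ?flip ` ?J"
        by (auto split: if_splits)
    qed
    have flip: "?flip i \<in> Zp" if "i \<in> ?J" for i
      using active_flip(1) [OF True, of a i] letter_neq_0_iff [of a g i] that by auto
    have "gen_act ms n (UE a) u g = (\<Sum>f\<in>?S. u f * ?c f)"
      by (simp add: gen_act_def)
    also have "\<dots> = (\<Sum>f\<in>?flip ` ?J. u f * ?c f)"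
      by (rule sum.mono_neutral_left) (use sub flip in auto)
    also have "\<dots> = (\<Sum>f\<in>?flip ` ?J. \<Sum>i\<in>?J. if f = ?flip i then u f * E_coeff a g i else 0)"
      using flip c by (intro sum.cong refl) (auto simp: sum_distrib_left intro!: sum.cong)
    also have "\<dots> = (\<Sum>i\<in>?J. \<Sum>f\<in>?flip ` ?J. if f = ?flip i then u f * E_coeff a g i else 0)"
      by (rule sum.swap)
    also have "\<dots> = (\<Sum>i\<in>?J. u (?flip i) * E_coeff a g i)"
      by (rule sum.cong) (auto simp: sum.delta)
    also have "\<dots> = fock_E a u g"
      unfolding fock_E_eq_sum [OF True] by (simp add: E_coeff_def mult.commute)
    finally show ?thesis .
  qed
qed

lemma relabel_back:
  assumes "g \<in> Zp" "map abs v = map abs (word a g)"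
  shows "g = relabel a (relabel a g v) (word a g)"
    "map abs (word a g) = map abs (word a (relabel a g v))"
  using relabel_relabel [OF assms refl] word_relabel [OF assms] assms by (simp_all add: relabel_word)

text \<open>The letter sum is \<open>wt a - wt (a + 1)\<close>, and relabelling preserves
  \<open>wt a + wt (a + 1)\<close>. Doubling avoids a division by 2.\<close>

lemma wt_relabel:
  assumes g: "g \<in> Zp" and v: "map abs v = map abs (word a g)"
  shows "c \<notin> {a, a + 1} \<Longrightarrow> wt c (relabel a g v) = wt c g"
    and "2 * wt a (relabel a g v) = 2 * wt a g + (sum_list v - sum_list (word a g))"
    and "2 * wt (a + 1) (relabel a g v) = 2 * wt (a + 1) g - (sum_list v - sum_list (word a g))"
proof -
  let ?h = "relabel a g v"
  have mem: "?h i \<in> {a, a + 1} \<longleftrightarrow> g i \<in> {a, a + 1}" for i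
    by (rule relabel_mem_iff [OF g v])
  have eq: "?h i = g i" if "g i \<notin> {a, a + 1}" for i
    by (rule relabel_inactive [OF g v]) (use that in \<open>auto simp: active_def\<close>)
  have "K_exp c i (?h i) = K_exp c i (g i)" if "c \<notin> {a, a + 1}" for c i
    using mem [of i] eq [of i] that by (auto simp: K_exp_def delta_def)
  then show "wt c ?h = wt c g" if "c \<notin> {a, a + 1}"
    using that by (simp add: wt_def)
  have "K_exp a i (?h i) + K_exp (a + 1) i (?h i) = K_exp a i (g i) + K_exp (a + 1) i (g i)" for i
  proof -
    have *: "K_exp a i b + K_exp (a + 1) i b = (if i < 0 then 1 else -1)" if "b \<in> {a, a + 1}" for b
      using that by (auto simp: K_exp_def delta_def)
    show ?thesis
    proof (cases "g i \<in> {a, a + 1}")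
      case True
      then show ?thesis
        using * [of "g i"] * [of "?h i"] mem [of i] by metis
    next
      case False
      from eq [OF this] show ?thesis
        by (simp only:)
    qed
  qed
  then have sum: "wt a ?h + wt (a + 1) ?h = wt a g + wt (a + 1) g"
    by (simp add: wt_def flip: sum.distrib)
  have "wt a ?h - wt (a + 1) ?h = sum_list v"
    using sum_list_word [OF relabel_Zmn_plus [OF g v], of a] word_relabel [OF g v] by simp
  moreover have "wt a g - wt (a + 1) g = sum_list (word a g)"
    using sum_list_word [OF g, of a] by simp
  ultimately show "2 * wt a ?h = 2 * wt a g + (sum_list v - sum_list (word a g))"
    "2 * wt (a + 1) ?h = 2 * wt (a + 1) g - (sum_list v - sum_list (word a g))"
    using sum by linarith+
qed

lemma fock_E_funpow:
  assumes "g \<in> Zp"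
  shows "(fock_E a ^^ r) u g = (word_E ^^ r) (\<lambda>v. u (relabel a g v)) (word a g)"
  using assms
proof (induction r arbitrary: g)
  case 0
  then show ?case by (simp add: relabel_word)
next
  case (Suc r)
  have "(fock_E a ^^ r) u (relabel a g v) = (word_E ^^ r) (\<lambda>v. u (relabel a g v)) v"
    if v: "map abs v = map abs (word a g)" for v
  proof -
    have "(fock_E a ^^ r) u (relabel a g v) = (word_E ^^ r) (\<lambda>v'. u (relabel a (relabel a g v) v')) v"
      using Suc.IH [OF relabel_Zmn_plus [OF Suc.prems v]] word_relabel [OF Suc.prems v] by simp
    also have "\<dots> = (word_E ^^ r) (\<lambda>v. u (relabel a g v)) v"
      by (rule word_E_funpow_cong) (simp add: relabel_relabel [OF Suc.prems v] v)
    finally show ?thesis .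
  qed
  moreover have "(fock_E a ^^ Suc r) u g
      = word_E (\<lambda>v. (fock_E a ^^ r) u (relabel a g v)) (word a g)"
    using Suc.prems by (simp add: fock_E_def [of a "(fock_E a ^^ r) u"])
  ultimately show ?case
    by (auto intro: word_E_cong)
qed

section \<open>Divided powers and string coordinates\<close>

text \<open>The guard keeps the support in \<open>Zp\<close> also for \<open>r = 0\<close>, where
  \<open>fock_E\<close> is not applied.\<close>

definition dpE :: "int \<Rightarrow> nat \<Rightarrow> fock \<Rightarrow> fock" where
  "dpE a r u = (\<lambda>g. if g \<in> Zp then (fock_E a ^^ r) u g / qfact r else 0)"

definition fin_fock :: "fock set" where
  "fin_fock = {u. finite {f. u f \<noteq> 0} \<and> {f. u f \<noteq> 0} \<subseteq> Zp}"

definition compat :: "int \<Rightarrow> (int \<Rightarrow> int) \<Rightarrow> int list set" where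
  "compat a g = {v. map abs v = map abs (word a g)}"

lemma finite_compat: "finite (compat a g)"
  unfolding compat_def by (rule finite_abs_cong)

lemma dpE_neq_0:
  assumes "dpE a r u g \<noteq> 0"
  obtains f v where "u f \<noteq> 0" "f \<in> Zp" "v \<in> compat a f" "g = relabel a f v" "g \<in> Zp"
    "sum_list (word a f) = sum_list v - 2 * int r"
proof -
  have g: "g \<in> Zp" and "(word_E ^^ r) (\<lambda>v. u (relabel a g v)) (word a g) \<noteq> 0"
    using assms by (auto simp: dpE_def fock_E_funpow split: if_splits)
  then obtain v where v: "map abs v = map abs (word a g)"
    "sum_list v = sum_list (word a g) - 2 * int r" "u (relabel a g v) \<noteq> 0"
    using word_E_funpow_neq_0 by blast
  show thesis
    by (rule that [of "relabel a g v" "word a g"])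
      (use v g relabel_Zmn_plus [OF g v(1)] relabel_back [OF g v(1)] word_relabel [OF g v(1)]
        in \<open>auto simp: compat_def\<close>)
qed

lemma dpE_fin_fock:
  assumes "u \<in> fin_fock"
  shows "dpE a r u \<in> fin_fock"
proof -
  have "{g. dpE a r u g \<noteq> 0} \<subseteq> (\<Union>f\<in>{f. u f \<noteq> 0}. relabel a f ` compat a f)"
    by (auto elim!: dpE_neq_0)
  moreover have "finite (\<Union>f\<in>{f. u f \<noteq> 0}. relabel a f ` compat a f)"
    using assms finite_compat by (auto simp: fin_fock_def)
  ultimately show ?thesis
    by (auto simp: fin_fock_def dest: finite_subset split: if_splits elim!: dpE_neq_0)
qed

lemma dpE_laurent:
  assumes "\<And>f. u f \<in> laurent"
  shows "dpE a r u g \<in> laurent"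
  unfolding dpE_def by (auto simp: fock_E_funpow intro!: word_E_funpow_laurent assms)

definition dpE_elem :: "int \<Rightarrow> nat \<Rightarrow> uq_free" where
  "dpE_elem a r = Poly_Mapping.single (Word (replicate r (UE a))) (inverse (qfact r))"

lemma dpE_elem_usl: "dpE_elem a r \<in> usl"
proof -
  have "Poly_Mapping.single (Word (replicate r (UE a))) 1 \<in> usl_generated" for r
  proof (induction r)
    case 0
    then show ?case
      using usl_generated.scal [of 1] by (simp add: scal_def zero_uq_word_def)
  next
    case (Suc r)
    have "gE a * Poly_Mapping.single (Word (replicate r (UE a))) 1
        = Poly_Mapping.single (Word (replicate (Suc r) (UE a))) 1"
      by (simp add: gen_def mult_single plus_uq_word_def)
    then show ?case
      using usl_generated.mult [OF usl_generated.E Suc] by metis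
  qed
  from usl_generated.mult [OF usl_generated.scal this]
  have "dpE_elem a r \<in> usl_generated"
    by (simp add: scal_def mult_single dpE_elem_def)
  then show ?thesis
    unfolding usl_def using uq_ideal.zero by force
qed

lemma uq_bar_dpE_elem: "uq_bar (dpE_elem a r) = dpE_elem a r"
  by (simp add: uq_bar_def dpE_elem_def map_replicate qbar_inverse)

lemma uq_act_dpE_elem:
  assumes "\<And>f. u f \<noteq> 0 \<Longrightarrow> f \<in> Zp"
  shows "uq_act ms n (dpE_elem a r) u = dpE a r u"
proof -
  have supp: "(fock_E a ^^ r) u f \<noteq> 0 \<Longrightarrow> f \<in> Zp" for r f
    using assms by (cases r) (auto simp: fock_E_def split: if_splits)
  have "(gen_act ms n (UE a) ^^ r) u = (fock_E a ^^ r) u" for r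
    by (induction r) (auto simp: gen_act_E supp)
  then show ?thesis
    using supp [of r]
    by (auto simp: uq_act_def dpE_elem_def dpE_def divide_inverse mult.commute
        fun_eq_iff)
qed

section \<open>String coordinates on the Fock space\<close>

definition fock_coord :: "int \<Rightarrow> (int \<Rightarrow> int) \<Rightarrow> fock \<Rightarrow> qfield" where
  "fock_coord a g u = coord (word a g) (\<lambda>v. u (relabel a g v))"

text \<open>For \<open>r = phi (word a g)\<close> this is position 0 of the string of g, which
  determines g because \<open>eup\<close> undoes \<open>fdown\<close>.\<close>

definition lower :: "int \<Rightarrow> nat \<Rightarrow> (int \<Rightarrow> int) \<Rightarrow> int \<Rightarrow> int" where
  "lower a r g = relabel a g ((fdown ^^ r) (word a g))"

lemma lower_Zmn_plus: "g \<in> Zp \<Longrightarrow> lower a r g \<in> Zp"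
  unfolding lower_def by (rule relabel_Zmn_plus) (simp_all add: abs_fdown_funpow)

lemma word_lower: "g \<in> Zp \<Longrightarrow> word a (lower a r g) = (fdown ^^ r) (word a g)"
  unfolding lower_def by (rule word_relabel) (simp_all add: abs_fdown_funpow)

lemma lower_inject:
  assumes "g \<in> Zp" "g' \<in> Zp" "phi (word a g) = r" "phi (word a g') = r" "lower a r g = lower a r g'"
  shows "g = g'"
proof -
  have "h = relabel a (lower a r h) ((eup ^^ r) (word a (lower a r h)))"
    if "h \<in> Zp" "phi (word a h) = r" for h
    using relabel_back(1) [OF that(1), of "(fdown ^^ r) (word a h)" a] word_lower [OF that(1), of a r]
      that(2) by (simp add: abs_fdown_funpow eup_fdown_funpow lower_def)
  then show ?thesis
    using assms by metis
qed

text \<open>Walking down r steps of the string collects \<open>qfact r\<close>, which the divided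
  power cancels. From a position below r the walk reaches position 0 too early and meets the factor
  \<open>qint 0\<close>. Above r nothing is claimed: there quantum binomials may bring in
  poles.\<close>

lemma fock_coord_dpE:
  assumes g: "g \<in> Zp"
  shows "phi (word a g) = r \<Longrightarrow> fock_coord a g (dpE a r u) = fock_coord a (lower a r g) u"
    and "phi (word a g) < r \<Longrightarrow> fock_coord a g (dpE a r u) = 0"
proof -
  let ?u = "\<lambda>v. u (relabel a g v)"
  have "dpE a r u (relabel a g v) = inverse (qfact r) * (word_E ^^ r) ?u v"
    if v: "map abs v = map abs (word a g)" for v
  proof -
    have "(word_E ^^ r) (\<lambda>v'. u (relabel a (relabel a g v) v')) v = (word_E ^^ r) ?u v"
      by (rule word_E_funpow_cong) (simp add: relabel_relabel [OF g v] v)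
    then show ?thesis
      using relabel_Zmn_plus [OF g v] word_relabel [OF g v]
      by (simp add: dpE_def fock_E_funpow divide_inverse mult.commute)
  qed
  then have *: "fock_coord a g (dpE a r u) = inverse (qfact r) * coord (word a g) ((word_E ^^ r) ?u)"
    unfolding fock_coord_def coord_scale [symmetric] by (intro coord_cong) auto
  show "fock_coord a g (dpE a r u) = fock_coord a (lower a r g) u" if "phi (word a g) = r"
  proof -
    have "fock_coord a (lower a r g) u = coord ((fdown ^^ r) (word a g)) ?u"
      unfolding fock_coord_def word_lower [OF g]
      by (rule coord_cong) (simp add: lower_def relabel_relabel [OF g] abs_fdown_funpow)
    then show ?thesis
      using that by (simp add: * coord_word_E_funpow)
  qed
  show "fock_coord a g (dpE a r u) = 0" if "phi (word a g) < r"
    using that by (simp add: * coord_word_E_funpow_eq_0)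
qed

lemma fock_coord_linear:
  "fock_coord a g (\<lambda>h. c * u h + u' h) = c * fock_coord a g u + fock_coord a g u'"
  by (simp add: fock_coord_def coord_linear)

lemma fock_coord_diff: "fock_coord a g (\<lambda>h. u h - u' h) = fock_coord a g u - fock_coord a g u'"
  using fock_coord_linear [of a g "-1" u' u] by simp

lemma fock_coord_sum:
  "fock_coord a g (\<lambda>h. \<Sum>i\<in>J. c i * u i h) = (\<Sum>i\<in>J. c i * fock_coord a g (u i))"
  by (simp add: fock_coord_def coord_sum coord_scale)

lemma fock_coord_regular:
  assumes "\<And>h. u h \<in> regular"
  shows "fock_coord a g u - u g \<in> vanishing"
  using coord_regular [of "word a g" "\<lambda>v. u (relabel a g v)"] assms
  by (simp add: fock_coord_def relabel_word)

lemma fock_coord_vanishing_imp: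
  assumes "g \<in> Zp" "\<And>h. h \<in> Zp \<Longrightarrow> fock_coord a h u \<in> vanishing"
  shows "u g \<in> vanishing"
proof -
  have "u (relabel a g (word a g)) \<in> vanishing"
  proof (rule coord_vanishing_imp)
    fix v assume v: "map abs v = map abs (word a g)"
    have "coord v (\<lambda>v. u (relabel a g v)) = fock_coord a (relabel a g v) u"
      unfolding fock_coord_def word_relabel [OF assms(1) v]
      by (rule coord_cong) (simp add: relabel_relabel [OF assms(1) v] v)
    then show "coord v (\<lambda>v. u (relabel a g v)) \<in> vanishing"
      using assms relabel_Zmn_plus [OF assms(1) v] by simp
  qed
  then show ?thesis
    by (simp add: relabel_word)
qed

lemma fock_coord_neq_0:
  assumes g: "g \<in> Zp" and "fock_coord a g u \<noteq> 0"
  obtains f where "u f \<noteq> 0" "f \<in> Zp" "g \<in> relabel a f ` compat a f" "\<forall>c. wt c f = wt c g"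
proof -
  have "\<exists>v. map abs v = map abs (word a g) \<and> sum_list v = sum_list (word a g) \<and> u (relabel a g v) \<noteq> 0"
  proof (rule ccontr)
    assume "\<not> ?thesis"
    then have "coord (word a g) (\<lambda>v. u (relabel a g v)) = coord (word a g) (\<lambda>v. 0)"
      by (intro coord_cong) auto
    then show False
      using assms by (simp add: fock_coord_def)
  qed
  then obtain v where v: "map abs v = map abs (word a g)" "sum_list v = sum_list (word a g)"
    "u (relabel a g v) \<noteq> 0"
    by blast
  have "wt c (relabel a g v) = wt c g" for c
    using wt_relabel [OF g v(1)] v(2) by (cases "c = a"; cases "c = a + 1") auto
  then show thesis
    using v relabel_back [OF g v(1)] relabel_Zmn_plus [OF g v(1)]
    by (intro that [of "relabel a g v"]) (auto simp: compat_def)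
qed

lemma finite_fock_coord_support:
  assumes "u \<in> fin_fock"
  shows "finite {g \<in> Zp. fock_coord a g u \<noteq> 0}"
proof (rule finite_subset)
  show "{g \<in> Zp. fock_coord a g u \<noteq> 0} \<subseteq> (\<Union>f\<in>{f. u f \<noteq> 0}. relabel a f ` compat a f)"
  proof
    fix g assume "g \<in> {g \<in> Zp. fock_coord a g u \<noteq> 0}"
    then have "g \<in> Zp" "fock_coord a g u \<noteq> 0"
      by simp_all
    then obtain f where "u f \<noteq> 0" "f \<in> Zp" "g \<in> relabel a f ` compat a f" "\<forall>c. wt c f = wt c g"
      by (rule fock_coord_neq_0)
    then show "g \<in> (\<Union>f\<in>{f. u f \<noteq> 0}. relabel a f ` compat a f)"
      by blast
  qed
  show "finite (\<Union>f\<in>{f. u f \<noteq> 0}. relabel a f ` compat a f)"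
    using assms finite_compat by (auto simp: fin_fock_def)
qed

lemma wt_lower:
  assumes g: "g \<in> Zp" and r: "r \<le> phi (word a g)"
  shows "wt c (lower a r g) = wt c g - (if c = a then int r else 0) + (if c = a + 1 then int r else 0)"
proof -
  have v: "map abs ((fdown ^^ r) (word a g)) = map abs (word a g)"
    by (rule abs_fdown_funpow)
  have "sign_word ((fdown ^^ r) (word a g))"
    using sign_word_abs_cong [OF v] by simp
  then have "sum_list ((fdown ^^ r) (word a g)) = sum_list (word a g) - 2 * int r"
    using r by (simp add: sum_list_sign_word phi_fdown_funpow eps_fdown_funpow of_nat_diff)
  then show ?thesis
    using wt_relabel [OF g v] by (cases "c = a"; cases "c = a + 1") (auto simp: lower_def)
qed

lemma wt_dpE:
  assumes "dpE a r u g \<noteq> 0"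
  obtains f where "u f \<noteq> 0" "f \<in> Zp" "g \<in> Zp"
    "\<forall>c. wt c g = wt c f + (if c = a then int r else 0) - (if c = a + 1 then int r else 0)"
proof -
  from assms obtain f v where *: "u f \<noteq> 0" "f \<in> Zp" "v \<in> compat a f" "g = relabel a f v" "g \<in> Zp"
    "sum_list (word a f) = sum_list v - 2 * int r"
    by (rule dpE_neq_0)
  have v: "map abs v = map abs (word a f)" and s: "sum_list v = sum_list (word a f) + 2 * int r"
    using * by (simp_all add: compat_def)
  have "wt c g = wt c f + (if c = a then int r else 0) - (if c = a + 1 then int r else 0)" for c
  proof -
    note wt = wt_relabel [OF *(2) v, folded *(4)]
    consider "c = a" | "c = a + 1" | "c \<notin> {a, a + 1}"
      by blast
    then show ?thesis
    proof cases
      case 1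
      then show ?thesis using wt(2) s by simp
    next
      case 2
      then show ?thesis using wt(3) s by simp
    next
      case 3
      then show ?thesis using wt(1) by simp
    qed
  qed
  with * show thesis
    by (intro that) auto
qed

section \<open>The norm of a weight\<close>

definition wt_norm :: "(int \<Rightarrow> int) \<Rightarrow> int" where
  "wt_norm g = (\<Sum>c\<in>g ` I. (wt c g)\<^sup>2)"

lemma wt_norm_superset:
  assumes "finite C" "g ` I \<subseteq> C"
  shows "wt_norm g = (\<Sum>c\<in>C. (wt c g)\<^sup>2)"
  unfolding wt_norm_def
proof (rule sum.mono_neutral_left [OF assms])
  have "wt c g = 0" if "c \<notin> g ` I" for c
    unfolding wt_def using that by (intro sum.neutral) (auto simp: K_exp_def delta_def)
  then show "\<forall>c\<in>C - g ` I. (wt c g)\<^sup>2 = 0"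
    by simp
qed

lemma wt_norm_cong: "(\<And>c. wt c f = wt c g) \<Longrightarrow> wt_norm f = wt_norm g"
  by (simp add: wt_norm_superset [of "f ` I \<union> g ` I"])

text \<open>There are at most \<open>card I\<close> values, and each weight is at most
  \<open>card I\<close> in absolute value.\<close>

lemma wt_norm_le: "wt_norm g \<le> int (card I) ^ 3"
proof -
  have "(wt c g)\<^sup>2 \<le> int (card I) ^ 2" for c
  proof -
    have "\<bar>wt c g\<bar> \<le> (\<Sum>i\<in>I. \<bar>K_exp c i (g i)\<bar>)"
      unfolding wt_def by (rule sum_abs)
    also have "\<dots> \<le> (\<Sum>i\<in>I. 1)"
      by (rule sum_mono) (auto simp: K_exp_def delta_def)
    finally show ?thesis
      by (simp add: abs_le_square_iff [symmetric])
  qed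
  then have "wt_norm g \<le> (\<Sum>c\<in>g ` I. int (card I) ^ 2)"
    unfolding wt_norm_def by (intro sum_mono)
  also have "\<dots> = int (card (g ` I)) * int (card I) ^ 2"
    by simp
  also have "\<dots> \<le> int (card I) * int (card I) ^ 2"
    by (intro mult_right_mono) (auto simp: card_image_le)
  finally show ?thesis
    by (simp add: power3_eq_cube power2_eq_square mult.assoc)
qed

lemma wt_norm_lower:
  assumes g: "g \<in> Zp" and r: "r \<le> phi (word a g)"
  shows "wt_norm (lower a r g) = wt_norm g + 2 * int r * (int r - (wt a g - wt (a + 1) g))"
proof -
  let ?h = "lower a r g" and ?C = "g ` I \<union> lower a r g ` I \<union> {a, a + 1}"
  have split: "(\<Sum>c\<in>?C. (wt c k)\<^sup>2)
      = (wt a k)\<^sup>2 + (wt (a + 1) k)\<^sup>2 + (\<Sum>c\<in>?C - {a, a + 1}. (wt c k)\<^sup>2)" for k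
  proof -
    have "(\<Sum>c\<in>?C. (wt c k)\<^sup>2) = (\<Sum>c\<in>?C - {a, a + 1}. (wt c k)\<^sup>2) + (\<Sum>c\<in>{a, a + 1}. (wt c k)\<^sup>2)"
      by (rule sum.subset_diff) auto
    then show ?thesis
      by simp
  qed
  have "wt_norm ?h = (wt a ?h)\<^sup>2 + (wt (a + 1) ?h)\<^sup>2 + (\<Sum>c\<in>?C - {a, a + 1}. (wt c ?h)\<^sup>2)"
    unfolding split [symmetric] by (rule wt_norm_superset) auto
  moreover have "wt_norm g = (wt a g)\<^sup>2 + (wt (a + 1) g)\<^sup>2 + (\<Sum>c\<in>?C - {a, a + 1}. (wt c g)\<^sup>2)"
    unfolding split [symmetric] by (rule wt_norm_superset) auto
  moreover have "(\<Sum>c\<in>?C - {a, a + 1}. (wt c ?h)\<^sup>2) = (\<Sum>c\<in>?C - {a, a + 1}. (wt c g)\<^sup>2)"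
    by (rule sum.cong) (auto simp: wt_lower [OF g r])
  ultimately show ?thesis
    by (simp add: wt_lower [OF g r] power2_eq_square algebra_simps)
qed

section \<open>The super Bruhat order\<close>

lemma sum_update2:
  fixes F :: "int \<Rightarrow> int \<Rightarrow> int"
  assumes "i \<in> I" "j \<in> I" "i \<noteq> j"
  shows "(\<Sum>k\<in>I. F k ((f(i := x, j := y)) k)) = (\<Sum>k\<in>I. F k (f k)) - F i (f i) - F j (f j) + F i x + F j y"
proof -
  have split: "(\<Sum>k\<in>I. F k (g k)) = F i (g i) + F j (g j) + (\<Sum>k\<in>I - {i} - {j}. F k (g k))" for g
    using assms by (simp add: sum.remove [of I i] sum.remove [of "I - {i}" j])
  have "(\<Sum>k\<in>I - {i} - {j}. F k ((f(i := x, j := y)) k)) = (\<Sum>k\<in>I - {i} - {j}. F k (f k))"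
    by (rule sum.cong) auto
  then show ?thesis
    using split [of "f(i := x, j := y)"] split [of f] assms by simp
qed

text \<open>Strictly decreasing along every move: (a) lowers two values, while (b) and (c) bring the
  larger of two values to the index closer to 0. Maximal elements for the order can thus be found by
  maximizing an integer.\<close>

definition level :: "(int \<Rightarrow> int) \<Rightarrow> int" where
  "level f = (\<Sum>k\<in>I. \<bar>k\<bar> * f k)"

lemma bruhat_down_level:
  assumes "bruhat_down ms n f g"
  shows "level g < level f"
  using assms
proof cases
  case (1 i j)
  then show ?thesis
    unfolding level_def 1(1) by (subst sum_update2) (auto simp: algebra_simps)
next
  case (2 i j)
  have "0 < (j - i) * (f i - f j)"
    using 2 by (intro mult_pos_pos) auto
  then show ?thesis
    unfolding level_def swap_at_def 2(1) using 2 by (subst sum_update2) (auto simp: algebra_simps)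
next
  case (3 i j)
  have "0 < (j - i) * (f j - f i)"
    using 3 by (intro mult_pos_pos) auto
  then show ?thesis
    unfolding level_def swap_at_def 3(1) using 3 by (subst sum_update2) (auto simp: algebra_simps)
qed

lemma bruhat_down_wt:
  assumes "bruhat_down ms n f g"
  shows "wt c g = wt c f"
  using assms
proof cases
  case (1 i j)
  then show ?thesis
    unfolding wt_def 1(1) by (subst sum_update2) (auto simp: K_exp_def)
next
  case (2 i j)
  then show ?thesis
    unfolding wt_def swap_at_def 2(1) by (subst sum_update2) (auto simp: K_exp_def)
next
  case (3 i j)
  then show ?thesis
    unfolding wt_def swap_at_def 3(1) by (subst sum_update2) (auto simp: K_exp_def)
qed

text \<open>Going down, values at positive indices are only lowered or permuted, so a lower bound
  passes back up. Everything above a function therefore stays in the same region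
  \<open>bounded_below n d\<close>.\<close>

lemma bruhat_down_bounded_below:
  assumes "bruhat_down ms n f g" "g \<in> bounded_below n d"
  shows "f \<in> bounded_below n d"
  unfolding bounded_below_def
proof (intro CollectI ballI)
  fix k assume k: "k \<in> {1..int n}"
  have g: "- int d \<le> g l" if "l \<in> {1..int n}" for l
    using assms(2) that by (auto simp: bounded_below_def)
  show "- int d \<le> f k"
    using assms(1)
  proof cases
    case (1 i j)
    then show ?thesis
      using g [of k] k by (cases "k = j") auto
  next
    case (2 i j)
    then show ?thesis
      using g [of k] k by (auto simp: swap_at_def)
  next
    case (3 i j)
    have "i \<in> {1..int n}" "j \<in> {1..int n}"
      using 3 by (auto simp: Imn_def)
    then show ?thesis
      using g [of i] g [of j] g [of k] k 3(1,5)
      by (cases "k = i"; cases "k = j") (auto simp: swap_at_def)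
  qed
qed

lemma bruhat_down_le:
  assumes "bruhat_down ms n f g" "\<forall>k\<in>{1..int n}. f k \<le> B"
  shows "\<forall>k\<in>{1..int n}. g k \<le> B"
  using assms(1)
proof cases
  case (1 i j)
  then show ?thesis
    using assms(2) by (auto simp: Imn_def) (smt (verit) atLeastAtMost_iff)
next
  case (2 i j)
  then show ?thesis
    using assms(2) by (auto simp: swap_at_def)
next
  case (3 i j)
  then show ?thesis
    using assms(2) by (auto simp: swap_at_def Imn_def)
qed

lemma bruhat_less_level: "bruhat_less ms n g f \<Longrightarrow> level g < level f"
proof -
  assume "bruhat_less ms n g f"
  then have "(bruhat_down ms n)\<^sup>+\<^sup>+ f g"
    unfolding bruhat_less_def by (metis rtranclpD)
  then show ?thesis
    by induction (auto dest: bruhat_down_level)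
qed

lemma bruhat_less_wt: "bruhat_less ms n g f \<Longrightarrow> wt c g = wt c f"
proof -
  assume "bruhat_less ms n g f"
  then have "(bruhat_down ms n)\<^sup>*\<^sup>* f g"
    by (simp add: bruhat_less_def)
  then show ?thesis
    by induction (auto simp: bruhat_down_wt)
qed

lemma bruhat_less_bounded_below:
  assumes "bruhat_less ms n g f" "g \<in> bounded_below n d"
  shows "f \<in> bounded_below n d"
proof -
  have "(bruhat_down ms n)\<^sup>*\<^sup>* f g"
    using assms by (simp add: bruhat_less_def)
  then show ?thesis
    using assms(2) by induction (auto dest: bruhat_down_bounded_below)
qed

lemma bruhat_less_le:
  assumes "bruhat_less ms n g f" "\<forall>k\<in>{1..int n}. f k \<le> B"
  shows "\<forall>k\<in>{1..int n}. g k \<le> B"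
proof -
  have "(bruhat_down ms n)\<^sup>*\<^sup>* f g"
    using assms by (simp add: bruhat_less_def)
  then show ?thesis
    using assms(2) by induction (auto dest: bruhat_down_le)
qed

text \<open>Below such an \<open>f\<close>, move (a) never applies and the values are only permuted.\<close>

lemma finite_bruhat_down_typical:
  assumes typical: "\<And>i j. i \<in> I \<Longrightarrow> j \<in> I \<Longrightarrow> i < 0 \<Longrightarrow> 0 < j \<Longrightarrow> f j < f i"
  shows "finite {g. bruhat_less ms n g f}"
proof -
  define L R where "L = f ` {i \<in> I. i < 0}" and "R = f ` {i \<in> I. 0 < i}"
  have LR: "y < x" if "x \<in> L" "y \<in> R" for x y
    using that typical by (auto simp: L_def R_def)
  have vals: "g i \<in> (if i < 0 then L else R)"
    if "(bruhat_down ms n)\<^sup>*\<^sup>* f g" "i \<in> I" for g i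
    using that
  proof (induction arbitrary: i)
    case base
    then show ?case
      by (cases "i < 0") (auto simp: L_def R_def Imn_def)
  next
    case (step g h)
    show ?case
      using step.hyps(2)
    proof cases
      case (1 k l)
      then show ?thesis
        using step.IH [of k] step.IH [of l] LR [of "g k" "g l"] by auto
    next
      case (2 k l)
      then show ?thesis
        using step.IH [of k] step.IH [of l] step.IH [of i] step.prems by (auto simp: swap_at_def)
    next
      case (3 k l)
      then show ?thesis
        using step.IH [of k] step.IH [of l] step.IH [of i] step.prems by (auto simp: swap_at_def)
    qed
  qed
  have "{g. bruhat_less ms n g f} \<subseteq> I \<rightarrow>\<^sub>E (L \<union> R)"
  proof
    fix g assume "g \<in> {g. bruhat_less ms n g f}"
    then have "(bruhat_down ms n)\<^sup>*\<^sup>* f g" "g \<in> Zmn ms n"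
      by (auto simp: bruhat_less_def Zmn_plus_def)
    then show "g \<in> I \<rightarrow>\<^sub>E (L \<union> R)"
      using vals [of g] unfolding Zmn_def PiE_iff by (metis UnCI)
  qed
  moreover have "finite (I \<rightarrow>\<^sub>E (L \<union> R))"
    by (rule finite_PiE) (auto simp: L_def R_def)
  ultimately show ?thesis
    by (rule finite_subset)
qed

section \<open>The topology\<close>

lemma fock_hat_add: "u \<in> fock_hat ms n \<Longrightarrow> v \<in> fock_hat ms n \<Longrightarrow> (\<lambda>f. u f + v f) \<in> fock_hat ms n"
proof -
  assume uv: "u \<in> fock_hat ms n" "v \<in> fock_hat ms n"
  have "finite ({f. u f + v f \<noteq> 0} \<inter> bounded_below n d)" for d
  proof (rule finite_subset)
    show "{f. u f + v f \<noteq> 0} \<inter> bounded_below n d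
        \<subseteq> ({f. u f \<noteq> 0} \<inter> bounded_below n d) \<union> ({f. v f \<noteq> 0} \<inter> bounded_below n d)"
      by auto
    show "finite (({f. u f \<noteq> 0} \<inter> bounded_below n d) \<union> ({f. v f \<noteq> 0} \<inter> bounded_below n d))"
      using uv by (simp add: fock_hat_def)
  qed
  moreover have "u f = 0 \<and> v f = 0" if "f \<notin> Zp" for f
    using uv that by (auto simp: fock_hat_def)
  then have "{f. u f + v f \<noteq> 0} \<subseteq> Zp"
    by force
  ultimately show ?thesis
    by (simp add: fock_hat_def)
qed

lemma fock_hat_subset_support:
  "u \<in> fock_hat ms n \<Longrightarrow> {f. v f \<noteq> 0} \<subseteq> {f. u f \<noteq> 0} \<Longrightarrow> v \<in> fock_hat ms n"
  unfolding fock_hat_def by (auto intro: finite_subset [rotated])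

lemma fock_hat_scale: "u \<in> fock_hat ms n \<Longrightarrow> (\<lambda>f. c * u f) \<in> fock_hat ms n"
  by (erule fock_hat_subset_support) auto

lemma fin_fock_hat: "u \<in> fin_fock \<Longrightarrow> u \<in> fock_hat ms n"
  by (auto simp: fin_fock_def fock_hat_def)

lemma topspace_fock_topology: "topspace (fock_topology ms n) = fock_hat ms n"
  unfolding fock_topology_def topology_generated_by_topspace by auto

lemma bounded_below_mono: "d \<le> e \<Longrightarrow> bounded_below n d \<subseteq> bounded_below n e"
  by (force simp: bounded_below_def)

text \<open>The generating sets already form a neighbourhood basis: for an intersection, the larger
  of the two bounds serves.\<close>

lemma openin_fock_topology:
  assumes "openin (fock_topology ms n) S" "u \<in> S"
  shows "\<exists>d. {v \<in> fock_hat ms n. \<forall>f \<in> bounded_below n d. v f = u f} \<subseteq> S"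
proof -
  have "generate_topology_on
     {{v \<in> fock_hat ms n. \<forall>f \<in> bounded_below n d. v f = u f} | u d. u \<in> fock_hat ms n} S"
    using assms(1) by (simp add: fock_topology_def openin_topology_generated_by_iff)
  then show ?thesis
    using assms(2)
  proof (induction arbitrary: u)
    case Empty
    then show ?case by simp
  next
    case (Int S T)
    then obtain d e where "{v \<in> fock_hat ms n. \<forall>f \<in> bounded_below n d. v f = u f} \<subseteq> S"
      "{v \<in> fock_hat ms n. \<forall>f \<in> bounded_below n e. v f = u f} \<subseteq> T"
      by blast
    moreover have "bounded_below n d \<subseteq> bounded_below n (max d e)"
      "bounded_below n e \<subseteq> bounded_below n (max d e)"
      by (simp_all add: bounded_below_mono)
    ultimately show ?case
      by (intro exI [of _ "max d e"]) blast
  next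
    case (UN K)
    then obtain S where "S \<in> K" "u \<in> S"
      by blast
    with UN.IH [of S u] show ?case
      by blast
  next
    case (Basis S)
    then obtain u' d where S: "S = {v \<in> fock_hat ms n. \<forall>f \<in> bounded_below n d. v f = u' f}"
      by blast
    show ?case
      using Basis(2) unfolding S by (intro exI [of _ d]) auto
  qed
qed

end

section \<open>Rigidity of bar-invariant vectors\<close>

locale canonical_basis = fock_index +
  fixes \<psi> :: "fock \<Rightarrow> fock" and U :: "(int \<Rightarrow> int) \<Rightarrow> fock"
  assumes bar: "is_bar_map ms n \<psi>"
    and canonical: "is_canonical_basis ms n \<psi> U"
begin

abbreviation "Fh \<equiv> fock_hat ms n"

lemma psi_hat: "u \<in> Fh \<Longrightarrow> \<psi> u \<in> Fh"
  using bar continuous_map_image_subset_topspace [of "fock_topology ms n" "fock_topology ms n" \<psi>]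
  by (auto simp: is_bar_map_def topspace_fock_topology)

lemma psi_add: "u \<in> Fh \<Longrightarrow> v \<in> Fh \<Longrightarrow> \<psi> (\<lambda>f. u f + v f) = (\<lambda>f. \<psi> u f + \<psi> v f)"
  using bar by (simp add: is_bar_map_def)

lemma psi_scale: "u \<in> Fh \<Longrightarrow> \<psi> (\<lambda>f. c * u f) = (\<lambda>f. qbar c * \<psi> u f)"
  using bar by (simp add: is_bar_map_def)

lemma psi_dpE:
  assumes "u \<in> Fh"
  shows "\<psi> (dpE a r u) = dpE a r (\<psi> u)"
proof -
  have supp: "v f \<noteq> 0 \<Longrightarrow> f \<in> Zp" if "v \<in> Fh" for v f
    using that by (auto simp: fock_hat_def)
  have "\<forall>x \<in> usl. \<forall>u \<in> Fh. \<psi> (uq_act ms n x u) = uq_act ms n (uq_bar x) (\<psi> u)"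
    using bar unfolding is_bar_map_def by (elim conjE)
  from bspec [OF bspec [OF this dpE_elem_usl] assms]
  have "\<psi> (uq_act ms n (dpE_elem a r) u) = uq_act ms n (uq_bar (dpE_elem a r)) (\<psi> u)" .
  then show ?thesis
    using supp [OF assms] supp [OF psi_hat [OF assms]]
    by (simp add: uq_bar_dpE_elem uq_act_dpE_elem)
qed

lemma psi_zero: "\<psi> (\<lambda>_. 0) = (\<lambda>_. 0)"
  using psi_scale [of "\<lambda>_. 0" 0] by (simp add: fin_fock_hat fin_fock_def)

text \<open>Continuity at 0 written out. By additivity, the coordinates of \<open>\<psi> v\<close>
  in the region of e depend only on those of v in the region of some d.\<close>

lemma psi_continuous:
  "\<exists>d. \<forall>v\<in>Fh. (\<forall>f \<in> bounded_below n d. v f = 0) \<longrightarrow> (\<forall>f \<in> bounded_below n e. \<psi> v f = 0)"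
proof -
  let ?O = "{v \<in> Fh. \<forall>f \<in> bounded_below n e. v f = 0}"
  have zero: "(\<lambda>_. 0) \<in> Fh"
    by (simp add: fin_fock_hat fin_fock_def)
  have "openin (fock_topology ms n) ?O"
    unfolding fock_topology_def by (rule topology_generated_by_Basis) (use zero in force)
  moreover have "continuous_map (fock_topology ms n) (fock_topology ms n) \<psi>"
    using bar by (simp add: is_bar_map_def)
  ultimately have "openin (fock_topology ms n) {v \<in> Fh. \<psi> v \<in> ?O}"
    using openin_continuous_map_preimage by (fastforce simp: topspace_fock_topology)
  moreover have "(\<lambda>_. 0) \<in> {v \<in> Fh. \<psi> v \<in> ?O}"
    using zero by (simp add: psi_zero)
  ultimately obtain d where
    "{v \<in> Fh. \<forall>f \<in> bounded_below n d. v f = 0} \<subseteq> {v \<in> Fh. \<psi> v \<in> ?O}"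
    using openin_fock_topology by blast
  then show ?thesis
    by blast
qed

lemma monomial_fin_fock: "f \<in> Zp \<Longrightarrow> monomial f \<in> fin_fock"
  by (auto simp: monomial_def fin_fock_def)

lemma psi_monomial:
  assumes "f \<in> Zp"
  shows "\<psi> (monomial f) f = 1"
    and "g \<noteq> f \<Longrightarrow> \<psi> (monomial f) g \<noteq> 0 \<Longrightarrow> bruhat_less ms n g f"
  using bar assms by (auto simp: is_bar_map_def)

lemma restrict_fin_fock: "finite A \<Longrightarrow> A \<subseteq> Zp \<Longrightarrow> (\<lambda>g. if g \<in> A then z g else 0) \<in> fin_fock"
  by (auto simp: fin_fock_def)

lemma psi_restrict:
  assumes "finite A" "A \<subseteq> Zp"
  shows "\<psi> (\<lambda>g. if g \<in> A then z g else 0) g = (\<Sum>h\<in>A. qbar (z h) * \<psi> (monomial h) g)"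
  using assms
proof (induction A arbitrary: g rule: finite_induct)
  case empty
  then show ?case by (simp add: psi_zero)
next
  case (insert h A)
  have "(\<lambda>g. if g \<in> insert h A then z g else 0)
      = (\<lambda>g. (z h * monomial h g) + (if g \<in> A then z g else 0))"
    using insert by (auto simp: monomial_def)
  moreover have mono: "monomial h \<in> Fh" and "(\<lambda>g. if g \<in> A then z g else 0) \<in> Fh"
    using insert by (auto intro!: fin_fock_hat monomial_fin_fock restrict_fin_fock)
  moreover have "(\<lambda>g. z h * monomial h g) \<in> Fh"
    using mono by (rule fock_hat_scale)
  ultimately have "\<psi> (\<lambda>g. if g \<in> insert h A then z g else 0) g
      = qbar (z h) * \<psi> (monomial h) g + \<psi> (\<lambda>g. if g \<in> A then z g else 0) g"
    by (simp add: psi_add psi_scale)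
  then show ?case
    using insert by simp
qed

text \<open>Rigidity for possibly infinite sums. Continuity leaves a finite set \<open>A\<close> of
  monomials that can influence the region of e. At a supported f of maximal \<open>level\<close> in
  that region only f itself contributes, since anything above f lies in the region and has larger
  level; so the scalar \<open>z f\<close> is bar-invariant and hence 0.\<close>

lemma bar_invariant_vanishing_eq_0:
  assumes z: "z \<in> Fh" "\<psi> z = z" and zv: "\<And>g. z g \<in> vanishing" "\<And>g. z g \<in> laurent"
  shows "z g = 0"
proof (rule ccontr)
  assume g0: "z g \<noteq> 0"
  define e where "e = nat (\<Sum>i\<in>{1..int n}. \<bar>g i\<bar>)"
  have "- int e \<le> g i" if "i \<in> {1..int n}" for i
    using member_le_sum [of i "{1..int n}" "\<lambda>i. \<bar>g i\<bar>"] that by (simp add: e_def sum_nonneg)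
  then have ge: "g \<in> bounded_below n e"
    by (simp add: bounded_below_def)
  obtain d where d: "\<And>v f. v \<in> Fh \<Longrightarrow> (\<forall>f \<in> bounded_below n d. v f = 0) \<Longrightarrow>
      f \<in> bounded_below n e \<Longrightarrow> \<psi> v f = 0"
    using psi_continuous [of e] by blast
  define A where "A = {f. z f \<noteq> 0} \<inter> bounded_below n (max d e)"
  have A: "finite A" "A \<subseteq> Zp"
    using z(1) by (auto simp: A_def fock_hat_def)
  have ded: "bounded_below n d \<subseteq> bounded_below n (max d e)"
    "bounded_below n e \<subseteq> bounded_below n (max d e)"
    by (simp_all add: bounded_below_mono)
  let ?v = "\<lambda>f. if f \<in> bounded_below n (max d e) then 0 else z f"
  have vF: "?v \<in> Fh"
    by (rule fock_hat_subset_support [OF z(1)]) auto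
  have "z = (\<lambda>f. (if f \<in> A then z f else 0) + ?v f)"
    by (auto simp: A_def)
  then have psiz: "\<psi> z = (\<lambda>f. \<psi> (\<lambda>f. if f \<in> A then z f else 0) f + \<psi> ?v f)"
    using psi_add [OF fin_fock_hat [OF restrict_fin_fock [OF A]] vF, of z] by simp
  have zexp: "z f = (\<Sum>h\<in>A. qbar (z h) * \<psi> (monomial h) f)" if "f \<in> bounded_below n e" for f
  proof -
    have "\<psi> ?v f = 0"
      by (rule d [OF vF _ that]) (use ded in auto)
    then show ?thesis
      using fun_cong [OF psiz, of f] z(2) psi_restrict [OF A, of z f] by simp
  qed
  define B where "B = A \<inter> bounded_below n e"
  have B: "finite B" "B \<noteq> {}"
    using A g0 ge ded by (auto simp: B_def A_def)
  then have "Max (level ` B) \<in> level ` B"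
    by (intro Max_in) auto
  then obtain f where f: "f \<in> B" "level f = Max (level ` B)"
    by auto
  have fmax: "level h \<le> level f" if "h \<in> B" for h
    unfolding f(2) using B that by (intro Max_ge) auto
  have "qbar (z h) * \<psi> (monomial h) f = (if h = f then qbar (z f) else 0)" if h: "h \<in> A" for h
  proof (cases "h = f")
    case True
    then show ?thesis using psi_monomial(1) [of f] A h by auto
  next
    case False
    have "\<psi> (monomial h) f = 0"
    proof (rule ccontr)
      assume "\<psi> (monomial h) f \<noteq> 0"
      then have less: "bruhat_less ms n f h"
        using psi_monomial(2) [of h f] A h False by auto
      then have "h \<in> B"
        using bruhat_less_bounded_below [OF less] f(1) h by (auto simp: B_def)
      then show False
        using fmax bruhat_less_level [OF less] by force
    qed
    then show ?thesis using False by simp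
  qed
  then have "z f = qbar (z f)"
    using zexp [of f] f(1) A by (simp add: B_def)
  then have "z f = 0"
    using laurent_vanishing_bar_invariant_eq_0 [of "z f"] zv by simp
  then show False
    using f(1) by (simp add: B_def A_def)
qed

lemma U_hat: "f \<in> Zp \<Longrightarrow> U f \<in> Fh"
  using canonical by (simp add: is_canonical_basis_def topological_basis_on_def)

lemma U_props:
  assumes "f \<in> Zp"
  shows psi_U: "\<psi> (U f) = U f" and U_diag: "U f f = 1"
    and U_off_diag: "g \<noteq> f \<Longrightarrow> U f g \<in> q_Z_q" "g \<noteq> f \<Longrightarrow> U f g \<noteq> 0 \<Longrightarrow> bruhat_less ms n g f"
  using canonical assms unfolding is_canonical_basis_def by blast+

lemma U_support: "f \<in> Zp \<Longrightarrow> U f g \<noteq> 0 \<Longrightarrow> g \<in> Zp"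
  using U_hat by (auto simp: fock_hat_def)

lemma U_laurent: "f \<in> Zp \<Longrightarrow> U f g \<in> laurent"
  by (cases "g = f") (auto simp: U_diag dest: U_off_diag intro: q_Z_q_laurent)

lemma U_cong: "f \<in> Zp \<Longrightarrow> U f g - (if g = f then 1 else 0) \<in> vanishing"
  by (cases "g = f") (auto simp: U_diag dest: U_off_diag intro: q_Z_q_vanishing)

lemma U_regular: "f \<in> Zp \<Longrightarrow> U f g \<in> regular"
  by (cases "g = f") (auto simp: U_diag dest: U_off_diag intro: q_Z_q_vanishing vanishing_imp_regular)

lemma U_wt: "f \<in> Zp \<Longrightarrow> U f g \<noteq> 0 \<Longrightarrow> wt c g = wt c f"
  by (cases "g = f") (auto dest: U_off_diag bruhat_less_wt)

lemma fock_coord_U: "f \<in> Zp \<Longrightarrow> fock_coord a g (U f) - (if g = f then 1 else 0) \<in> vanishing"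
  using vanishing_add [OF fock_coord_regular [of "U f" a g] U_cong [of f g]] U_regular by simp

section \<open>Killing poles\<close>

text \<open>What survives adding bar-invariant Laurent multiples; nothing is required at q = 0,
  where the poles are still to be removed. The weight condition confines the corrections to
  functions of the weight of f, for which the norm comparison holds.\<close>

definition good :: "(int \<Rightarrow> int) \<Rightarrow> fock \<Rightarrow> bool" where
  "good f w \<longleftrightarrow> w \<in> fin_fock \<and> \<psi> w = w \<and> (\<forall>g. w g \<in> laurent) \<and>
     (\<forall>g c. w g \<noteq> 0 \<longrightarrow> wt c g = wt c f)"

lemma good_dpE_U:
  assumes f: "f \<in> Zp" and g: "g \<in> Zp" "\<forall>c. wt c g = wt c f" "phi (word a g) = r"
    and fin: "U (lower a r g) \<in> fin_fock"
  shows "good f (dpE a r (U (lower a r g)))"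
proof -
  have h: "lower a r g \<in> Zp"
    by (rule lower_Zmn_plus [OF g(1)])
  have "wt c k = wt c f" if k: "dpE a r (U (lower a r g)) k \<noteq> 0" for c k
  proof -
    obtain l where l: "U (lower a r g) l \<noteq> 0"
      and wt: "\<forall>c. wt c k = wt c l + (if c = a then int r else 0) - (if c = a + 1 then int r else 0)"
      using k by (rule wt_dpE)
    have "wt c l = wt c (lower a r g)"
      by (rule U_wt [OF h l])
    then show ?thesis
      using wt g wt_lower [OF g(1), of r a c] by simp
  qed
  then show ?thesis
    unfolding good_def
    using dpE_fin_fock [OF fin] psi_dpE [OF U_hat [OF h]] psi_U [OF h] U_laurent [OF h]
    by (simp add: dpE_laurent)
qed

lemma good_add_scale:
  assumes w: "good f w" and x: "good f x" and c: "c \<in> laurent" "qbar c = c"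
  shows "good f (\<lambda>g. w g + c * x g)"
proof -
  have "{g. w g + c * x g \<noteq> 0} \<subseteq> {g. w g \<noteq> 0} \<union> {g. x g \<noteq> 0}"
    by auto
  then have "(\<lambda>g. w g + c * x g) \<in> fin_fock"
    using w x unfolding good_def fin_fock_def
    by (auto dest: finite_subset [of "{g. w g + c * x g \<noteq> 0}"])
  moreover have "\<psi> (\<lambda>g. w g + c * x g) = (\<lambda>g. w g + c * x g)"
    using w x c psi_add [of w "\<lambda>g. c * x g"]
    by (simp add: good_def psi_scale fin_fock_hat fock_hat_scale)
  moreover have "wt d g = wt d f" if "w g + c * x g \<noteq> 0" for g d
  proof (cases "w g = 0")
    case True
    then show ?thesis using that x by (simp add: good_def)
  qed (use w in \<open>simp add: good_def\<close>)
  ultimately show ?thesis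
    using w x c by (simp add: good_def)
qed

lemma good_diff_sum:
  assumes "finite G" "good f w" "\<And>i. i \<in> G \<Longrightarrow> good f (x i) \<and> c i \<in> laurent \<and> qbar (c i) = c i"
  shows "good f (\<lambda>g. w g - (\<Sum>i\<in>G. c i * x i g))"
  using assms
proof (induction G rule: finite_induct)
  case empty
  then show ?case by simp
next
  case (insert i G)
  have "good f (\<lambda>g. (w g - (\<Sum>i\<in>G. c i * x i g)) + (- c i) * x i g)"
    using insert by (intro good_add_scale) (auto simp: qbar_uminus)
  then show ?case
    using insert by (simp add: algebra_simps)
qed

text \<open>At position R the coordinates of E^(R) U_h, with h the lowered g, are 1 at g and 0
  elsewhere modulo q. Subtracting such vectors with the leading coefficients of the poles thus
  lowers every pole order at R by one, without touching positions below R.\<close>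

lemma kill_poles_at:
  assumes f: "f \<in> Zp"
    and fin: "\<And>g. g \<in> Zp \<Longrightarrow> \<forall>c. wt c g = wt c f \<Longrightarrow> phi (word a g) = R \<Longrightarrow> U (lower a R g) \<in> fin_fock"
    and w: "good f w"
    and s: "\<And>g. g \<in> Zp \<Longrightarrow> phi (word a g) = R \<Longrightarrow> qq ^ s * fock_coord a g w \<in> vanishing"
  shows "\<exists>w'. good f w' \<and> (\<forall>g\<in>Zp. phi (word a g) = R \<longrightarrow> fock_coord a g w' \<in> vanishing) \<and>
    (\<forall>g\<in>Zp. phi (word a g) < R \<longrightarrow> fock_coord a g w' = fock_coord a g w)"
  using w s
proof (induction s arbitrary: w)
  case 0
  then show ?case by auto
next
  case (Suc s)
  define G where "G = {g \<in> Zp. phi (word a g) = R \<and> fock_coord a g w \<noteq> 0}"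
  have "finite G"
    by (rule finite_subset [OF _ finite_fock_coord_support [of w a]])
      (use Suc.prems in \<open>auto simp: G_def good_def\<close>)
  have "\<exists>p. qq ^ s * fock_coord a g w - to_fract [:p:] \<in> vanishing" if "g \<in> G" for g
  proof -
    have "qq ^ s * fock_coord a g w \<in> regular"
      using Suc.prems(2) [of g] that by (simp add: G_def mult.assoc)
    then show ?thesis
      by (rule regular_cong_constant) blast
  qed
  then obtain p where p: "\<And>g. g \<in> G \<Longrightarrow> qq ^ s * fock_coord a g w - to_fract [:p g:] \<in> vanishing"
    by metis
  \<comment> \<open>The bar-invariant substitute for q^-s: the mirror term q^s disappears modulo q
    after multiplication by q^s. For \<open>s = 0\<close> both terms coincide and would add up to
    2.\<close>
  define b where "b = (if s = 0 then 1 else qq ^ s + inverse qq ^ s)"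
  have b: "b \<in> laurent" "qbar b = b" "qq ^ s * b - 1 \<in> vanishing"
  proof -
    show "b \<in> laurent" by (simp add: b_def)
    show "qbar b = b"
      by (simp add: b_def qbar_add qbar_power qbar_qq qbar_inverse)
    have "qq ^ s * b - 1 = qq ^ s * qq ^ s" if "s > 0"
      using that by (simp add: b_def distrib_left power_inverse)
    then show "qq ^ s * b - 1 \<in> vanishing"
      using vanishing_power [of s] by (cases "s = 0") (auto simp: b_def vanishing_imp_regular)
  qed
  define x where "x g = dpE a R (U (lower a R g))" for g
  define w1 where "w1 = (\<lambda>h. w h - (\<Sum>g\<in>G. (to_fract [:p g:] * b) * x g h))"
  \<comment> \<open>String coordinates mix only monomials of equal weight, so poles occur only at
    functions of the weight of f.\<close>
  have Gwt: "\<forall>c. wt c g = wt c f" if "g \<in> G" for g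
  proof -
    have "g \<in> Zp" "fock_coord a g w \<noteq> 0"
      using that by (auto simp: G_def)
    then obtain k where "w k \<noteq> 0" "\<forall>c. wt c k = wt c g"
      by (rule fock_coord_neq_0)
    then show ?thesis
      using Suc.prems(1) by (auto simp: good_def)
  qed
  have "good f w1"
    unfolding w1_def x_def
    by (rule good_diff_sum [OF \<open>finite G\<close> Suc.prems(1)])
      (use Gwt b fin f in \<open>auto simp: G_def qbar_mult intro!: good_dpE_U\<close>)
  have coord: "fock_coord a h w1
      = fock_coord a h w - (\<Sum>g\<in>G. (to_fract [:p g:] * b) * fock_coord a h (x g))" for h
    unfolding w1_def fock_coord_diff fock_coord_sum ..
  have low: "fock_coord a h w1 = fock_coord a h w" if "h \<in> Zp" "phi (word a h) < R" for h
    using that by (simp add: coord x_def fock_coord_dpE)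
  have "qq ^ s * fock_coord a h w1 \<in> vanishing" if h: "h \<in> Zp" "phi (word a h) = R" for h
  proof -
    define y where "y g = fock_coord a h (x g) - (if g = h then 1 else 0)" for g
    have y: "y g \<in> vanishing" if g: "g \<in> G" for g
    proof -
      have "fock_coord a h (x g) = fock_coord a (lower a R h) (U (lower a R g))"
        using h by (simp add: x_def fock_coord_dpE)
      moreover have "lower a R h = lower a R g \<longleftrightarrow> g = h"
        using lower_inject [of h g a R] g h by (auto simp: G_def)
      ultimately show ?thesis
        using fock_coord_U [of "lower a R g" a "lower a R h"] g lower_Zmn_plus [of g a R]
        by (simp add: y_def G_def)
    qed
    have pb: "qq ^ s * b * to_fract [:p g:] \<in> regular" for g
      using regular_add [OF vanishing_imp_regular [OF b(3)] regular_1] by simp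
    have "(\<Sum>g\<in>G. (to_fract [:p g:] * b) * fock_coord a h (x g))
        = (\<Sum>g\<in>G. if g = h then to_fract [:p h:] * b else 0) + (\<Sum>g\<in>G. to_fract [:p g:] * b * y g)"
      unfolding sum.distrib [symmetric] by (rule sum.cong) (auto simp: y_def algebra_simps)
    also have "(\<Sum>g\<in>G. if g = h then to_fract [:p h:] * b else 0)
        = (if h \<in> G then to_fract [:p h:] * b else 0)"
      using \<open>finite G\<close> by simp
    finally have "qq ^ s * fock_coord a h w1
        = (qq ^ s * fock_coord a h w - (if h \<in> G then qq ^ s * b * to_fract [:p h:] else 0))
          - (\<Sum>g\<in>G. (qq ^ s * b * to_fract [:p g:]) * y g)"
      by (simp add: coord algebra_simps sum_distrib_left)
    moreover have "qq ^ s * fock_coord a h w - (if h \<in> G then qq ^ s * b * to_fract [:p h:] else 0)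
        \<in> vanishing"
    proof (cases "h \<in> G")
      case True
      show ?thesis
        using vanishing_diff [OF p [OF True] vanishing_mult_right [OF b(3) to_fract_regular [of "[:p h:]"]]] True
        by (simp add: algebra_simps)
    next
      case False
      then show ?thesis
        using h by (simp add: G_def)
    qed
    moreover have "(\<Sum>g\<in>G. (qq ^ s * b * to_fract [:p g:]) * y g) \<in> vanishing"
      using y pb by (intro vanishing_sum vanishing_mult_left) auto
    ultimately show ?thesis
      by simp
  qed
  from Suc.IH [OF \<open>good f w1\<close> this] show ?case
    using low by metis
qed

text \<open>Positions are treated in increasing order: a correction at R may create new poles above
  R, but none below.\<close>

lemma kill_poles_above:
  assumes f: "f \<in> Zp"
    and fin: "\<And>g R. g \<in> Zp \<Longrightarrow> \<forall>c. wt c g = wt c f \<Longrightarrow> phi (word a g) = R \<Longrightarrow> r < R \<Longrightarrow>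
      U (lower a R g) \<in> fin_fock"
    and w: "good f w"
  shows "\<exists>w'. good f w' \<and>
    (\<forall>g\<in>Zp. phi (word a g) \<le> r \<longrightarrow> fock_coord a g w' = fock_coord a g w) \<and>
    (\<forall>g\<in>Zp. r < phi (word a g) \<longrightarrow> phi (word a g) \<le> r + k \<longrightarrow> fock_coord a g w' \<in> vanishing)"
proof (induction k)
  case 0
  then show ?case
    using w by auto
next
  case (Suc k)
  then obtain w1 where w1: "good f w1"
    "\<forall>g\<in>Zp. phi (word a g) \<le> r \<longrightarrow> fock_coord a g w1 = fock_coord a g w"
    "\<forall>g\<in>Zp. r < phi (word a g) \<longrightarrow> phi (word a g) \<le> r + k \<longrightarrow> fock_coord a g w1 \<in> vanishing"
    by blast
  let ?G = "{g \<in> Zp. fock_coord a g w1 \<noteq> 0}"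
  have fin_G: "finite ?G"
    by (rule finite_fock_coord_support) (use w1 in \<open>simp add: good_def\<close>)
  have "\<forall>g. \<exists>s. qq ^ s * fock_coord a g w1 \<in> vanishing"
    by (simp add: power_mult_vanishing_ex)
  then obtain s where s: "\<And>g. qq ^ s g * fock_coord a g w1 \<in> vanishing"
    by metis
  have "qq ^ sum s ?G * fock_coord a g w1 \<in> vanishing" if "g \<in> Zp" for g
  proof (cases "g \<in> ?G")
    case True
    then have "qq ^ sum s ?G * fock_coord a g w1
        = qq ^ sum s (?G - {g}) * (qq ^ s g * fock_coord a g w1)"
      using sum.remove [OF fin_G True, of s] by (simp add: power_add algebra_simps)
    then show ?thesis
      using vanishing_mult_left [OF regular_power [OF qq_regular, of "sum s (?G - {g})"] s [of g]]
      by (simp only:)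
  qed (use that in simp)
  note regular = this
  have "\<exists>w2. good f w2 \<and>
    (\<forall>g\<in>Zp. phi (word a g) = r + Suc k \<longrightarrow> fock_coord a g w2 \<in> vanishing) \<and>
    (\<forall>g\<in>Zp. phi (word a g) < r + Suc k \<longrightarrow> fock_coord a g w2 = fock_coord a g w1)"
  proof (rule kill_poles_at [OF f _ w1(1)])
    show "U (lower a (r + Suc k) g) \<in> fin_fock"
      if "g \<in> Zp" "\<forall>c. wt c g = wt c f" "phi (word a g) = r + Suc k" for g
      using that by (rule fin) simp
  qed (rule regular)
  then obtain w2 where w2: "good f w2"
    "\<forall>g\<in>Zp. phi (word a g) = r + Suc k \<longrightarrow> fock_coord a g w2 \<in> vanishing"
    "\<forall>g\<in>Zp. phi (word a g) < r + Suc k \<longrightarrow> fock_coord a g w2 = fock_coord a g w1"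
    by blast
  show ?case
  proof (intro exI [of _ w2] conjI ballI impI)
    fix g assume g: "g \<in> Zp" "phi (word a g) \<le> r"
    then show "fock_coord a g w2 = fock_coord a g w"
      using w1(2) w2(3) by auto
  next
    fix g assume g: "g \<in> Zp" "r < phi (word a g)" "phi (word a g) \<le> r + Suc k"
    then show "fock_coord a g w2 \<in> vanishing"
      using w1(3) w2(2,3) by (cases "phi (word a g) = r + Suc k") auto
  qed (rule w2(1))
qed

text \<open>Once every string coordinate agrees with that of K_f modulo q, so does every
  coefficient. The difference to U_f is then bar-invariant, Laurent and vanishing at 0, and rigidity
  applies.\<close>

lemma U_finite_step:
  assumes f: "f \<in> Zp" and r: "phi (word a f) = r"
    and low: "U (lower a r f) \<in> fin_fock"
    and fin: "\<And>g R. g \<in> Zp \<Longrightarrow> \<forall>c. wt c g = wt c f \<Longrightarrow> phi (word a g) = R \<Longrightarrow> r < R \<Longrightarrow>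
      U (lower a R g) \<in> fin_fock"
  shows "U f \<in> fin_fock"
proof -
  define w0 where "w0 = dpE a r (U (lower a r f))"
  have "good f w0"
    unfolding w0_def using f r low by (intro good_dpE_U) auto
  \<comment> \<open>\<open>phi\<close> never exceeds the word length, so \<open>m + n\<close> steps
    reach all positions above r.\<close>
  from kill_poles_above [OF f fin this, where k = "m + n"]
  obtain w where w: "good f w"
    "\<And>g. g \<in> Zp \<Longrightarrow> phi (word a g) \<le> r \<Longrightarrow> fock_coord a g w = fock_coord a g w0"
    "\<And>g. g \<in> Zp \<Longrightarrow> r < phi (word a g) \<Longrightarrow> phi (word a g) \<le> r + (m + n) \<Longrightarrow>
      fock_coord a g w \<in> vanishing"
    by blast
  have coord: "fock_coord a g w - (if g = f then 1 else 0) \<in> vanishing" if g: "g \<in> Zp" for g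
  proof -
    consider "phi (word a g) < r" | "phi (word a g) = r" | "r < phi (word a g)"
      by linarith
    then show ?thesis
    proof cases
      case 1
      then show ?thesis
        using w(2) [OF g] r g by (auto simp: w0_def fock_coord_dpE)
    next
      case 2
      then have "fock_coord a g w = fock_coord a (lower a r g) (U (lower a r f))"
        using w(2) [OF g] g by (simp add: w0_def fock_coord_dpE)
      moreover have "lower a r g = lower a r f \<longleftrightarrow> g = f"
        using lower_inject [OF g f] 2 r by auto
      ultimately show ?thesis
        using fock_coord_U [of "lower a r f" a "lower a r g", OF lower_Zmn_plus [OF f]] by simp
    next
      case 3
      moreover have "phi (word a g) \<le> r + (m + n)"
        using phi_le_length [of "word a g"] by simp
      ultimately show ?thesis
        using w(3) [OF g] r by auto
    qed
  qed
  have supp: "w g = 0" if "g \<notin> Zp" for g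
    using w(1) that by (auto simp: good_def fin_fock_def)
  have cong: "w g - monomial f g \<in> vanishing" for g
  proof (cases "g \<in> Zp")
    case True
    then show ?thesis
    proof (rule fock_coord_vanishing_imp)
      fix h assume h: "h \<in> Zp"
      have "fock_coord a h (monomial f) - monomial f h \<in> vanishing"
        by (rule fock_coord_regular) (simp add: monomial_def)
      from vanishing_diff [OF coord [OF h] this]
      show "fock_coord a h (\<lambda>g. w g - monomial f g) \<in> vanishing"
        by (simp add: fock_coord_diff monomial_def [of f])
    qed
  next
    case False
    then show ?thesis
      using supp f by (auto simp: monomial_def)
  qed
  define z where "z = (\<lambda>g. w g + (-1) * U f g)"
  have "z g = 0" for g
  proof (rule bar_invariant_vanishing_eq_0 [of z])
    have wF: "w \<in> Fh" and UF: "(\<lambda>g. (-1) * U f g) \<in> Fh"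
      using w(1) U_hat [OF f] fock_hat_scale [of "U f" "-1"] by (auto simp: good_def fin_fock_hat)
    show "z \<in> Fh"
      unfolding z_def by (rule fock_hat_add [OF wF UF])
    show "\<psi> z = z"
      unfolding z_def psi_add [OF wF UF] psi_scale [OF U_hat [OF f]]
      using w(1) psi_U [OF f] by (simp add: good_def qbar_uminus)
    show "z g \<in> vanishing" for g
      using vanishing_diff [OF cong [of g] U_cong [OF f, of g]] by (simp add: z_def monomial_def)
    show "z g \<in> laurent" for g
      using w(1) U_laurent [OF f] by (simp add: z_def good_def)
  qed
  then have "w = U f"
    by (auto simp: z_def)
  then show ?thesis
    using w(1) by (simp add: good_def)
qed

lemma U_finite_typical:
  assumes f: "f \<in> Zp" and "\<And>i j. i \<in> I \<Longrightarrow> j \<in> I \<Longrightarrow> i < 0 \<Longrightarrow> 0 < j \<Longrightarrow> f j < f i"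
  shows "U f \<in> fin_fock"
proof -
  have "{g. U f g \<noteq> 0} \<subseteq> insert f {g. bruhat_less ms n g f}"
    using U_off_diag(2) [OF f] by blast
  moreover have "finite {g. bruhat_less ms n g f}"
    using assms(2) by (rule finite_bruhat_down_typical)
  ultimately show ?thesis
    using U_support [OF f] by (auto simp: fin_fock_def dest: finite_subset)
qed

section \<open>The induction\<close>

text \<open>No other positive index holds a or a + 1, so the letter 1 at j is the last nonzero
  letter and cannot be cancelled: r is positive, and since no uncancelled 1 remains after r steps,
  this letter has become -1. All other changes turn a letter 1 at a negative index into -1, that is,
  a into a + 1.\<close>

lemma lower_last_plus:
  assumes g: "g \<in> Zp" and j: "j \<in> I" "0 < j"
    and no: "\<forall>k\<in>I. 0 < k \<longrightarrow> g k \<noteq> g j - 1"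
  defines "a \<equiv> g j - 1"
  defines "r \<equiv> phi (word a g)"
  shows "r > 0" and "lower a r g j = g j - 1"
    and "\<And>k. k \<in> I \<Longrightarrow> 0 < k \<Longrightarrow> k \<noteq> j \<Longrightarrow> lower a r g k = g k"
    and "\<And>i. i \<in> I \<Longrightarrow> i < 0 \<Longrightarrow> g i \<le> lower a r g i"
proof -
  have uniq: "k = j" if "k \<in> I" "0 < k" "g k \<in> {a, a + 1}" for k
    using that bspec [OF no, of k] Zmn_plus_inj [OF g, of k j] j by (auto simp: a_def blk_positive)
  have act: "active a g j"
    unfolding active_def
    using j uniq blk_eq_imp_same_side [of _ j] by (auto simp: a_def) (metis less_asym linorder_neqE zero_notin_I)+
  have inact: "\<not> active a g k" if "k \<in> I" "0 < k" "k \<noteq> j" for k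
    using uniq [of k] that by (auto simp: active_def)
  have lj: "letter a g j = 1"
  proof -
    have "g j = a + 1"
      by (simp add: a_def)
    then show ?thesis
      using act j by (simp add: letter_def root_sign_cases)
  qed
  have zero: "v ! l = 0" if "map abs v = map abs (word a g)" "idx j < l" "l < m + n" for v l
  proof -
    have "j < pos l"
      using pos_less_iff [of "idx j" l] j that by simp
    then have "\<not> active a g (pos l)"
      using inact [of "pos l"] that j by simp
    then show ?thesis
      using compatible_nth_cases [OF g that(1), of "pos l"] that by simp
  qed
  show "r > 0"
    unfolding r_def
    by (rule phi_last_plus [of "idx j"]) (use j lj zero in auto)
  let ?v = "(fdown ^^ r) (word a g)"
  have v: "map abs ?v = map abs (word a g)"
    by (rule abs_fdown_funpow)
  have "phi ?v = 0"
    by (simp add: phi_fdown_funpow r_def)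
  then have "?v ! idx j \<noteq> 1"
    using phi_last_plus [of "idx j" ?v] zero [OF v] j by auto
  then have "?v ! idx j = -1"
    using compatible_nth_cases [OF g v j(1)] act by simp
  then show "lower a r g j = g j - 1"
    using j by (simp add: lower_def relabel_def a_def)
  show "lower a r g k = g k" if "k \<in> I" "0 < k" "k \<noteq> j" for k
    unfolding lower_def using relabel_inactive [OF g v] inact that by simp
  show "g i \<le> lower a r g i" if i: "i \<in> I" "i < 0" for i
  proof (cases "active a g i")
    case True
    show ?thesis
    proof (cases "?v ! idx i = 1")
      case False
      then show ?thesis
        using relabel_active [OF g v True] i True by (auto simp: lower_def active_def)
    next
      case one: True
      have "?v ! idx i \<le> word a g ! idx i"
        by (rule fdown_funpow_le) (use i in simp)
      then have "letter a g i = 1"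
        using one letter_range [of a g i] i by auto
      then have "g i = a"
        using i True by (auto simp: letter_def root_sign_cases active_def split: if_splits)
      then show ?thesis
        using relabel_active [OF g v True] i one by (simp add: lower_def)
    qed
  next
    case False
    then show ?thesis
      using relabel_inactive [OF g v] by (simp add: lower_def)
  qed
qed

text \<open>The weight difference of g is that of f, namely \<open>phi - eps\<close>. The increment
  is thus nonnegative for r equal to \<open>phi (word a f)\<close> and positive for larger
  r.\<close>

lemma wt_norm_lower_word:
  assumes g: "g \<in> Zp" and r: "r = phi (word a g)" and f: "f \<in> Zp" "\<forall>c. wt c g = wt c f"
  shows "wt_norm (lower a r g)
    = wt_norm f + 2 * int r * (int r - int (phi (word a f)) + int (eps (word a f)))"
proof -
  have "wt a f - wt (a + 1) f = int (phi (word a f)) - int (eps (word a f))"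
    using sum_list_word [OF f(1), of a] by (simp add: sum_list_sign_word)
  then show ?thesis
    using wt_norm_lower [OF g, of r a] r f(2) wt_norm_cong [of g f] by simp
qed

text \<open>Two nested inductions: the outer one on the distance of the norm from its upper bound,
  the inner one on the total excess of the positive entries over their targets \<open>t\<close>.
  Keeping \<open>wt_norm f \<le> wt_norm g\<close> in the inner one makes the outer hypothesis
  available after any strict increase.\<close>

lemma U_finite:
  assumes "f \<in> Zp"
  shows "U f \<in> fin_fock"
  using assms
proof (induction "nat (int (card I) ^ 3 - wt_norm f)" arbitrary: f rule: less_induct)
  case less
  have outer: "U g \<in> fin_fock" if "g \<in> Zp" "wt_norm f < wt_norm g" for g
    using less.hyps [of g] that wt_norm_le [of g] by auto
  obtain M where M: "\<And>i. i \<in> I \<Longrightarrow> M \<le> f i"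
  proof
    show "Min (f ` I) \<le> f i" if "i \<in> I" for i
      using that by simp
  qed
  \<comment> \<open>The last target is M - 1, below all values at negative indices, which only rise
    from f on. Spacing 1 ensures that if j is the first index above its target, the value
    \<open>g j - 1\<close> is not taken at a positive index.\<close>
  define t where "t k = M - int n + k - 1" for k
  have "U g \<in> fin_fock"
    if "g \<in> Zp" "wt_norm f \<le> wt_norm g" "\<And>i. i \<in> I \<Longrightarrow> i < 0 \<Longrightarrow> M \<le> g i" for g
    using that
  proof (induction "\<Sum>k\<in>{1..int n}. nat (g k - t k)" arbitrary: g rule: less_induct)
    case (less g)
    note g = less.prems
    show ?case
    proof (cases "\<forall>k\<in>{1..int n}. g k \<le> t k")
      case True
      have "g j < g i" if "i \<in> I" "j \<in> I" "i < 0" "0 < j" for i j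
      proof -
        have "j \<in> {1..int n}"
          using that by (auto simp: Imn_def)
        then have "g j \<le> t j" "j \<le> int n"
          using True by auto
        then show ?thesis
          using g(3) [OF that(1,3)] by (simp add: t_def)
      qed
      then show ?thesis
        using g(1) by (intro U_finite_typical)
    next
      case False
      define J where "J = {k \<in> {1..int n}. t k < g k}"
      have J: "finite J" "J \<noteq> {}"
        by (rule finite_subset [of _ "{1..int n}"]) (use False in \<open>auto simp: J_def\<close>)
      define j where "j = Min J"
      have "j \<in> J"
        unfolding j_def by (rule Min_in [OF J])
      have before: "g k \<le> t k" if "k \<in> {1..int n}" "k < j" for k
        using Min_le [OF J(1), of k] that by (force simp: j_def J_def)
      have j: "j \<in> I" "0 < j" "j \<in> {1..int n}" "t j < g j"
        using \<open>j \<in> J\<close> by (auto simp: J_def Imn_def)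
      have "\<forall>k\<in>I. 0 < k \<longrightarrow> g k \<noteq> g j - 1"
      proof (intro ballI impI notI)
        fix k assume k: "k \<in> I" "0 < k" and eq: "g k = g j - 1"
        have "k < j"
          using Zmn_plus_strict [OF g(1) j(1) k(1)] k(2) j(2) eq
          by (cases k j rule: linorder_cases) (simp_all add: blk_positive)
        then show False
          using before [of k] k j eq by (auto simp: Imn_def t_def)
      qed
      note lower = lower_last_plus [OF g(1) j(1,2) this]
      define a r where "a = g j - 1" and "r = phi (word a g)"
      note lower = lower [folded a_def, folded r_def]
      let ?h = "lower a r g"
      have norm: "wt_norm ?h = wt_norm g + 2 * int r * int (eps (word a g))"
        using wt_norm_lower_word [OF g(1) _ g(1), of r a] by (simp add: r_def)
      show ?thesis
      proof (rule U_finite_step [OF g(1), of a r])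
        show "phi (word a g) = r"
          by (simp add: r_def)
        show "U ?h \<in> fin_fock"
        proof (rule less.hyps)
          have "(\<Sum>k\<in>{1..int n}. nat (?h k - t k)) < (\<Sum>k\<in>{1..int n}. nat (g k - t k))"
          proof (rule sum_strict_mono_ex1)
            have "?h k \<le> g k" if "k \<in> {1..int n}" for k
              using lower(2) lower(3) [of k] that a_def by (cases "k = j") (auto simp: Imn_def)
            then show "\<forall>k\<in>{1..int n}. nat (?h k - t k) \<le> nat (g k - t k)"
              by (simp add: nat_mono)
            show "\<exists>k\<in>{1..int n}. nat (?h k - t k) < nat (g k - t k)"
              using j lower(2) a_def by (intro bexI [of _ j]) auto
          qed simp
          then show "(\<Sum>k\<in>{1..int n}. nat (?h k - t k)) < (\<Sum>k\<in>{1..int n}. nat (g k - t k))" .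
          show "?h \<in> Zp"
            by (rule lower_Zmn_plus [OF g(1)])
          have "0 \<le> 2 * int r * int (eps (word a g))"
            by simp
          then show "wt_norm f \<le> wt_norm ?h"
            using g(2) norm by linarith
          show "M \<le> ?h i" if "i \<in> I" "i < 0" for i
            using lower(4) [OF that] g(3) [OF that] by simp
        qed
        fix g' R assume g': "g' \<in> Zp" "\<forall>c. wt c g' = wt c g" "phi (word a g') = R" "r < R"
        have "0 < 2 * int R * (int R - int r + int (eps (word a g)))"
          using g'(4) by (intro mult_pos_pos) auto
        then have "wt_norm g < wt_norm (lower a R g')"
          using wt_norm_lower_word [OF g'(1) g'(3) [symmetric] g(1) g'(2)] by (simp add: r_def)
        then show "U (lower a R g') \<in> fin_fock"
          using g(2) by (intro outer lower_Zmn_plus [OF g'(1)]) simp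
      qed
    qed
  qed
  from this [of f] show ?case
    using less.prems M by simp
qed

end

theorem corollary4p10:
  fixes ms :: "nat list" and n :: nat
    and \<psi> :: "fock \<Rightarrow> fock" and U :: "(int \<Rightarrow> int) \<Rightarrow> fock" and f :: "int \<Rightarrow> int"
  assumes "\<forall>m \<in> set ms. m > 0"
    and "is_bar_map ms n \<psi>"
    and "is_canonical_basis ms n \<psi> U"
    and "f \<in> Zmn_plusplus ms n"
  shows "U f \<in> fock_plus ms n"
proof -
  interpret canonical_basis ms n \<psi> U
    by standard (rule assms(2,3))+
  have f: "f \<in> Zp" and fn: "n > 0 \<longrightarrow> f (int n) \<le> int n"
    using assms(4) by (auto simp: Zmn_plusplus_def)
  have fin: "U f \<in> fin_fock"
    by (rule U_finite [OF f])
  have le: "f k \<le> int n" if "k \<in> {1..int n}" for k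
    using Zmn_plus_strict [OF f, of k "int n"] fn that
    by (cases "k = int n") (auto simp: Imn_def blk_positive)
  \<comment> \<open>The last value of f is its largest at positive indices, and no move raises the
    maximum there, so the bound n passes to the whole support.\<close>
  have "g \<in> Zmn_plusplus ms n" if "U f g \<noteq> 0" for g
  proof (cases "g = f")
    case False
    then have "\<forall>k\<in>{1..int n}. g k \<le> int n"
      using bruhat_less_le [OF U_off_diag(2) [OF f False that]] le by blast
    then show ?thesis
      using U_support [OF f that] by (auto simp: Zmn_plusplus_def)
  qed (use assms(4) in simp)
  then show ?thesis
    using fin by (auto simp: fock_plus_def fin_fock_def)
qed

end
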